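(* Let $p\geq1$ and let $f:\mathbb{R}^d\to\mathbb{R}^d$, $g:\mathbb{R}^d\to\mathbb{M}^d$ satisfy: (a) $f$ is continuous and there is $L>0$ with $|f(x)|\leq L(1+|x|)$ for all $x$; (b) there are $\alpha\in(p-1,1]$ and $C_\alpha>0$ with $\|g(x)-g(y)\|\leq C_\alpha|x-y|^\alpha$ for all $x,y$. Let $\{a^n\}\subset D(\mathbb{R}^+,\mathbb{R})$, $\{z^n\},\{l^n\}\subset D(\mathbb{R}^+,\mathbb{R}^d)$ and $x^n_0\in\mathbb{R}^d$ with $x^n_0\geq l^n_0$ be such that $\sup_nV_1(a^n)_T<\infty$ and $\sup_nV_p(z^n)_T<\infty$ for all $T\in\mathbb{R}^+$, and \[ (x^n_0,a^n,z^n,l^n)\longrightarrow(x_0,a,z,l)\quad\text{in } \mathbb{R}^d\times D(\mathbb{R}^+,\mathbb{R}^{1+2d}). \] If for each $n$, $(x^n,k^n)$ is a solution of \[ x^n_t=x^n_0+\int_0^tf(x^n_{s-})\,da^n_s+\int_0^tg(x^n_{s-})\,dz^n_s+k^n_t,\quad t\in\mathbb{R}^+, \] then $\{(x^n,k^n)\}$ is relatively compact in $D(\mathbb{R}^+,\mathbb{R}^{2d})$ and each of its limit points is a solution of \[ x_t=x_0+\int_0^tf(x_{s-})\,da_s+\int_0^tg(x_{s-})\,dz_s+k_t,\quad t\in\mathbb{R}^+. \]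
   Context: $\mathbb{R}^+=[0,\infty)$; $\mathbb{M}^d$ = real $d\times d$ matrices with operator norm. $D(\mathbb{R}^+,\mathbb{R}^m)$ is the space of càdlàg functions with the Skorokhod $J_1$ topology; convergence/relative compactness of tuples is meant jointly in $D(\mathbb{R}^+,\mathbb{R}^{m})$ for the concatenated dimension $m$. For càdlàg $x$, $v_p(x)_{[a,b]}=\sup\sum_i|x_{t_i}-x_{t_{i-1}}|^p$ over subdivisions of $[a,b]$, $V_p=v_p^{1/p}$, subscript $T$ meaning $[0,T]$. Integrals are Riemann–Stieltjes integrals. Inequalities between vectors are componentwise. Skorokhod problem: for $y,l\in D(\mathbb{R}^+,\mathbb{R}^d)$ with $l_0\leq y_0$, $(x,k)=SP_l(y)$ means (i) $x_t=y_t+k_t\geq l_t$ for all $t$; (ii) $k_0=0$, each $k^i$ nondecreasing with $\int_0^t(x^i_s-l^i_s)dk^i_s=0$ for all $t,i$. Given $a\in D(\mathbb{R}^+,\mathbb{R})$, $z,l\in D(\mathbb{R}^+,\mathbb{R}^d)$ with $V_1(a)_T,V_p(z)_T<\infty$ for all $T$, and $x_0\geq l_0$, a solution of $x_t=x_0+\int_0^tf(x_{s-})da_s+\int_0^tg(x_{s-})dz_s+k_t$ is a pair $(x,k)$ in $D(\mathbb{R}^+,\mathbb{R}^d)^2$ with $V_p(x)_T<\infty$ for all $T$ and $(x,k)=SP_l(y)$, $y_t=x_0+\int_0^tf(x_{s-})da_s+\int_0^tg(x_{s-})dz_s$. *)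

theory Defs
  imports "HOL-Analysis.Analysis"
begin

(* Cadlag paths on R^+ = [0,oo): only the values on [0,oo) matter. *)
definition cadlag :: "(real \<Rightarrow> 'a::metric_space) \<Rightarrow> bool" where
  "cadlag x \<longleftrightarrow> (\<forall>t\<ge>0. (x \<longlongrightarrow> x t) (at_right t)) \<and>
                 (\<forall>t>0. \<exists>L. (x \<longlongrightarrow> L) (at_left t))"

definition leftlim :: "(real \<Rightarrow> 'a::metric_space) \<Rightarrow> real \<Rightarrow> 'a" where
  "leftlim x s = (if s \<le> 0 then x 0 else Lim (at_left s) x)"

definition subdivision :: "real list \<Rightarrow> real \<Rightarrow> real \<Rightarrow> bool" where
  "subdivision P a b \<longleftrightarrow> P \<noteq> [] \<and> hd P = a \<and> last P = b \<and> sorted_wrt (<) P"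

definition v_var :: "real \<Rightarrow> (real \<Rightarrow> 'a::real_normed_vector) \<Rightarrow> real \<Rightarrow> real \<Rightarrow> ereal" where
  "v_var p x a b = (SUP P \<in> {P. subdivision P a b}.
       ereal (\<Sum>i < length P - 1. norm (x (P ! Suc i) - x (P ! i)) powr p))"

definition V_var :: "real \<Rightarrow> (real \<Rightarrow> 'a::real_normed_vector) \<Rightarrow> real \<Rightarrow> real \<Rightarrow> ereal" where
  "V_var p x a b = (if v_var p x a b = \<infinity> then \<infinity>
                    else ereal (real_of_ereal (v_var p x a b) powr (1 / p)))"

(* Riemann-Stieltjes integral (refinement sense): (h dz) over [a,b] has value I,
   where m is the bilinear pairing of integrand and increment. *)
definition RS_has :: "('b \<Rightarrow> 'c \<Rightarrow> 'e::real_normed_vector) \<Rightarrow> (real \<Rightarrow> 'b) \<Rightarrow>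
                      (real \<Rightarrow> 'c::real_normed_vector) \<Rightarrow> real \<Rightarrow> real \<Rightarrow> 'e \<Rightarrow> bool" where
  "RS_has m h z a b I \<longleftrightarrow>
     (\<forall>e>0. \<exists>P. subdivision P a b \<and>
        (\<forall>Q \<xi>. subdivision Q a b \<and> set P \<subseteq> set Q \<and>
               (\<forall>i < length Q - 1. Q ! i \<le> \<xi> i \<and> \<xi> i \<le> Q ! Suc i) \<longrightarrow>
               norm ((\<Sum>i < length Q - 1. m (h (\<xi> i)) (z (Q ! Suc i) - z (Q ! i))) - I) < e))"

(* Skorokhod problem with lower barrier l: (x,k) = SP_l(y).
   The condition  int_0^t (x^i_s - l^i_s) dk^i_s = 0  is taken as the Stieltjes
   integral w.r.t. the measure dk^i on (0,t] (k_0 = 0, so no mass at 0). *)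
definition SP :: "(real \<Rightarrow> real^'d) \<Rightarrow> (real \<Rightarrow> real^'d) \<Rightarrow> (real \<Rightarrow> real^'d) \<Rightarrow>
                  (real \<Rightarrow> real^'d) \<Rightarrow> bool" where
  "SP l y x k \<longleftrightarrow>
     (\<forall>t\<ge>0. x t = y t + k t \<and> l t \<le> x t) \<and>
     k 0 = 0 \<and>
     (\<forall>i. mono_on {0..} (\<lambda>t. k t $ i)) \<and>
     (\<forall>i. \<forall>t\<ge>0. (\<integral>\<^sup>+ s. ennreal (x s $ i - l s $ i) * indicator {0<..t} s
                    \<partial>interval_measure (\<lambda>s. k (max 0 s) $ i)) = 0)"

definition is_solution :: "real \<Rightarrow> (real^'d \<Rightarrow> real^'d) \<Rightarrow> (real^'d \<Rightarrow> real^'d^'d) \<Rightarrow>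
     real^'d \<Rightarrow> (real \<Rightarrow> real) \<Rightarrow> (real \<Rightarrow> real^'d) \<Rightarrow> (real \<Rightarrow> real^'d) \<Rightarrow>
     (real \<Rightarrow> real^'d) \<Rightarrow> (real \<Rightarrow> real^'d) \<Rightarrow> bool" where
  "is_solution p f g x0 a z l x k \<longleftrightarrow>
     cadlag x \<and> cadlag k \<and> (\<forall>T\<ge>0. V_var p x 0 T < \<infinity>) \<and>
     (\<exists>I J. (\<forall>t\<ge>0. RS_has (\<lambda>v r. r *\<^sub>R v) (\<lambda>s. f (leftlim x s)) a 0 t (I t) \<and>
                    RS_has (\<lambda>A v. A *v v) (\<lambda>s. g (leftlim x s)) z 0 t (J t)) \<and>
            SP l (\<lambda>t. x0 + I t + J t) x k)"

definition time_change :: "(real \<Rightarrow> real) \<Rightarrow> bool" where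
  "time_change lam \<longleftrightarrow> lam 0 = 0 \<and> continuous_on {0..} lam \<and> strict_mono_on {0..} lam \<and>
                      lam ` {0..} = {0..}"

definition J1_conv :: "(nat \<Rightarrow> real \<Rightarrow> 'a::metric_space) \<Rightarrow> (real \<Rightarrow> 'a) \<Rightarrow> bool" where
  "J1_conv xs x \<longleftrightarrow> cadlag x \<and>
     (\<exists>lam. (\<forall>n. time_change (lam n)) \<and>
        (\<forall>e>0. \<exists>N. \<forall>n\<ge>N. \<forall>t\<ge>0. \<bar>lam n t - t\<bar> \<le> e) \<and>
        (\<forall>T\<ge>0. \<forall>e>0. \<exists>N. \<forall>n\<ge>N. \<forall>t\<in>{0..T}. dist (xs n (lam n t)) (x t) \<le> e))"

(* relative compactness in D(R^+, E) (a metrizable space): sequential *)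
definition relcompact_D :: "(real \<Rightarrow> 'a::metric_space) set \<Rightarrow> bool" where
  "relcompact_D S \<longleftrightarrow> (\<forall>X. (\<forall>n. X n \<in> S) \<longrightarrow> (\<exists>(r::nat \<Rightarrow> nat) y. strict_mono r \<and> J1_conv (X \<circ> r) y))"

end

theory Submission
  imports Defs "HOL-Library.Diagonal_Subsequence"
begin

text \<open>After the time changes of the \<open>J\<^sub>1\<close> convergence the drivers converge locally uniformly.
  Their \<open>p\<close>-variation bounds, the Young estimate for integrals (in the form of a sewing lemma) and
  the explicit formula for the reflection term give a uniform bound on the \<open>p\<close>-variation of the
  solutions: on stretches where the driver moves little, the variation of the solution is bounded
  by half of itself plus a constant, and the number of such stretches is bounded uniformly.
  Interpolating between the variation bound and the small oscillation of the drivers on the pieces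
  of a common partition shows that both integrals have uniformly small oscillation on these pieces,
  so that an Arzela-Ascoli argument for regulated functions yields locally uniformly convergent
  subsequences; the reflection term is Lipschitz in the remaining data. The same interpolation
  controls the Riemann sums uniformly in \<open>n\<close> and thereby identifies the limits of the integrals.\<close>

text \<open>Two obstacles shape the estimates. First, jumps: no refinement makes a jump of a driver
  small, and x jumps with it. Hence the estimates of the integrals over [u,v] use x on [u,v) only,
  as left-point sums permit, and a bound obtained before a jump can be carried across it. Second, l
  has no finite variation. But each coordinate of k is nondecreasing, so that its variation is its
  increment, and this is bounded by suprema of l and oscillations of the integrals. The condition
  \<alpha> > p - 1 enters as (1 + \<alpha>) / p > 1, the exponent that sewing requires. The
  integrals of left limits and the complementarity condition on dk are traded for
  \<open>Lint\<close> and \<open>skor\<close>, which are stable under time changes; the original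
  notions are recovered for the limit only.\<close>

lemma subdivisionD:
  assumes "subdivision Q u v"
  shows "Q ! 0 = u" "Q ! (length Q - 1) = v" "0 < length Q"
    and "\<And>i j. i < j \<Longrightarrow> j \<le> length Q - 1 \<Longrightarrow> Q ! i < Q ! j"
    and "\<And>i j. i \<le> j \<Longrightarrow> j \<le> length Q - 1 \<Longrightarrow> Q ! i \<le> Q ! j"
    and "\<And>i. i \<le> length Q - 1 \<Longrightarrow> u \<le> Q ! i \<and> Q ! i \<le> v"
    and "\<And>s. s \<in> set Q \<Longrightarrow> u \<le> s \<and> s \<le> v"
    and "u \<in> set Q" "v \<in> set Q" "distinct Q" "sorted Q"
proof -
  have ne: "Q \<noteq> []" and hl: "hd Q = u" "last Q = v" and so: "sorted_wrt (<) Q"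
    using assms by (auto simp: subdivision_def)
  show 0: "Q ! 0 = u" using ne hl by (simp add: hd_conv_nth)
  show l: "Q ! (length Q - 1) = v" using ne hl by (simp add: last_conv_nth)
  show pos: "0 < length Q" using ne by simp
  show lt: "Q ! i < Q ! j" if "i < j" "j \<le> length Q - 1" for i j
    using so that pos by (simp add: sorted_wrt_iff_nth_less)
  show le: "Q ! i \<le> Q ! j" if "i \<le> j" "j \<le> length Q - 1" for i j
    using lt[of i j] that by (cases "i = j") auto
  show b: "u \<le> Q ! i \<and> Q ! i \<le> v" if "i \<le> length Q - 1" for i
    using le[of 0 i] le[of i "length Q - 1"] that 0 l by auto
  show "u \<le> s \<and> s \<le> v" if "s \<in> set Q" for s
    using that b pos by (auto simp: in_set_conv_nth)
  show "u \<in> set Q" "v \<in> set Q" using hl ne by auto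
  show "distinct Q" "sorted Q"
    using so strict_sorted_iff by auto
qed

lemma subdivision_sorted_list_of_set:
  assumes "finite S" "a \<in> S" "b \<in> S" "S \<subseteq> {a..b}"
  shows "subdivision (sorted_list_of_set S) a b"
proof -
  let ?Q = "sorted_list_of_set S"
  have st: "set ?Q = S" using assms by simp
  have ne: "?Q \<noteq> []" using assms by auto
  have so: "sorted ?Q" by simp
  have "hd ?Q = a"
  proof -
    have "hd ?Q \<in> S" using ne st by (metis hd_in_set)
    moreover have "hd ?Q \<le> a" using so ne assms(2) st
      by (metis list.set_cases list.sel(1) order_refl sorted_simps(2))
    ultimately show ?thesis using assms(4) by fastforce
  qed
  moreover have "last ?Q = b"
  proof -
    have "last ?Q \<in> S" using ne st by (metis last_in_set)
    moreover obtain i where "i < length ?Q" "?Q ! i = b" using assms(3) st by (metis in_set_conv_nth)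
    then have "i \<le> length ?Q - 1" "length ?Q - 1 < length ?Q" by linarith+
    then have "b \<le> last ?Q" using ne sorted_nth_mono[OF so, of i "length ?Q - 1"] \<open>?Q ! i = b\<close>
      by (simp add: last_conv_nth)
    ultimately show ?thesis using assms(4) by fastforce
  qed
  ultimately show ?thesis using ne by (simp add: subdivision_def)
qed

subsection \<open>Sewing\<close>

text \<open>The fixed point K of K = 2 powr (1 - \<theta>) * K + 2: two blocks with half of the
  control each contribute K with weight 2 powr (-\<theta>), and one splitting costs two defects. For
  \<theta> > 1 the factor of K is below 1.\<close>

definition sew_const :: "real \<Rightarrow> real" where
  "sew_const \<theta> = 2 / (1 - 2 powr (1 - \<theta>))"

lemma sew_const_props:
  assumes "\<theta> > 1"
  shows "sew_const \<theta> \<ge> 0" "2 * (sew_const \<theta> * (1/2) powr \<theta>) + 2 = sew_const \<theta>"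
proof -
  have "(2::real) powr (1 - \<theta>) < 2 powr 0" using assms by (intro powr_less_mono) auto
  then have lt: "1 - (2::real) powr (1 - \<theta>) > 0" by simp
  then show "sew_const \<theta> \<ge> 0" by (simp add: sew_const_def)
  have "2 * (1/2::real) powr \<theta> = 2 powr (1 - \<theta>)"
    by (simp add: powr_diff powr_divide)
  then have A: "2 * (sew_const \<theta> * (1/2) powr \<theta>) = sew_const \<theta> * 2 powr (1 - \<theta>)"
    by (metis mult.left_commute)
  have "2 / (1 - c) * c + 2 = 2 / (1 - c)" if "1 - c > 0" for c :: real
    using that by (simp add: field_simps)
  then have B: "sew_const \<theta> * 2 powr (1 - \<theta>) + 2 = sew_const \<theta>"
    using lt unfolding sew_const_def by blast
  show "2 * (sew_const \<theta> * (1/2) powr \<theta>) + 2 = sew_const \<theta>" by (simp only: A B)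
qed

text \<open>Splitting at the index where the control passes its midpoint halves the control on both
  remaining blocks, so that the errors form a geometric series of ratio \<open>2 powr (1 - \<theta>)\<close>.\<close>

lemma sewing:
  fixes X :: "nat \<Rightarrow> nat \<Rightarrow> 'e::real_normed_vector" and F :: "nat \<Rightarrow> real"
  assumes th: "\<theta> > 1" and D: "D \<ge> 0"
    and mono: "\<And>i j. i \<le> j \<Longrightarrow> j \<le> m \<Longrightarrow> F i \<le> F j"
    and X: "\<And>i j k. i \<le> j \<Longrightarrow> j \<le> k \<Longrightarrow> k \<le> m \<Longrightarrow>
              norm (X i k - X i j - X j k) \<le> D * (F k - F i) powr \<theta>"
  shows "j \<le> k \<Longrightarrow> k \<le> m \<Longrightarrow>
     norm ((\<Sum>i=j..<k. X i (Suc i)) - X j k) \<le> sew_const \<theta> * D * (F k - F j) powr \<theta>"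
proof (induction "k - j" arbitrary: j k rule: less_induct)
  case less
  let ?K = "sew_const \<theta>"
  show ?case
  proof (cases "j = k")
    case True
    then show ?thesis using X[of j j j] less.prems by simp
  next
    case False
    then have jk: "j < k" using less.prems by simp
    define h where "h = (F j + F k) / 2"
    \<comment> \<open>r will be the last index whose control is at most the midpoint. The single
      step from r to \<open>Suc r\<close> may jump across the midpoint, so its term is left as it
      is; splitting at r and again at \<open>Suc r\<close> costs the two defects bounded in C and
      E.\<close>
    define R where "R = {r\<in>{j..<k}. F r \<le> h}"
    have Fjk: "F j \<le> F k" using mono less.prems by auto
    have "j \<in> R" using jk Fjk by (auto simp: R_def h_def)
    have finR: "finite R" by (simp add: R_def)
    define r where "r = Max R"
    have "r \<in> R" using Max_in[OF finR] \<open>j \<in> R\<close> by (auto simp: r_def)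
    then have r: "j \<le> r" "r < k" "F r \<le> h" by (auto simp: R_def)
    have r1: "h \<le> F (Suc r)"
    proof (cases "Suc r = k")
      case True then show ?thesis using Fjk by (simp add: h_def)
    next
      case False
      then have "Suc r \<notin> R" using Max_ge[OF finR, of "Suc r"] by (auto simp: r_def)
      then show ?thesis using False r by (auto simp: R_def)
    qed
    define d where "d = F k - F j"
    have d: "d \<ge> 0" using Fjk by (simp add: d_def)
    have A: "norm ((\<Sum>i=j..<r. X i (Suc i)) - X j r) \<le> ?K * D * (d/2) powr \<theta>"
    proof -
      have "norm ((\<Sum>i=j..<r. X i (Suc i)) - X j r) \<le> ?K * D * (F r - F j) powr \<theta>"
        using less.hyps[of r j] r less.prems by auto
      also have "\<dots> \<le> ?K * D * (d/2) powr \<theta>"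
        using r mono[of j r] less.prems th D sew_const_props(1)[OF th]
        by (intro mult_left_mono powr_mono2) (auto simp: d_def h_def field_simps)
      finally show ?thesis .
    qed
    have B: "norm ((\<Sum>i=Suc r..<k. X i (Suc i)) - X (Suc r) k) \<le> ?K * D * (d/2) powr \<theta>"
    proof -
      have "norm ((\<Sum>i=Suc r..<k. X i (Suc i)) - X (Suc r) k) \<le> ?K * D * (F k - F (Suc r)) powr \<theta>"
        using less.hyps[of k "Suc r"] r less.prems by auto
      also have "\<dots> \<le> ?K * D * (d/2) powr \<theta>"
        using r r1 mono[of "Suc r" k] less.prems th D sew_const_props(1)[OF th]
        by (intro mult_left_mono powr_mono2) (auto simp: d_def h_def field_simps)
      finally show ?thesis .
    qed
    have C: "norm (X j k - X j r - X r k) \<le> D * d powr \<theta>"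
      using X[of j r k] r less.prems by (simp add: d_def)
    have E: "norm (X r k - X r (Suc r) - X (Suc r) k) \<le> D * d powr \<theta>"
    proof -
      have "norm (X r k - X r (Suc r) - X (Suc r) k) \<le> D * (F k - F r) powr \<theta>"
        using X[of r "Suc r" k] r less.prems by simp
      also have "\<dots> \<le> D * d powr \<theta>"
        using r mono[of j r] mono[of r k] less.prems th D
        by (intro mult_left_mono powr_mono2) (auto simp: d_def)
      finally show ?thesis .
    qed
    have split: "(\<Sum>i=j..<k. X i (Suc i)) = (\<Sum>i=j..<r. X i (Suc i)) + X r (Suc r) + (\<Sum>i=Suc r..<k. X i (Suc i))"
    proof -
      have "(\<Sum>i=j..<k. X i (Suc i)) = (\<Sum>i=j..<r. X i (Suc i)) + (\<Sum>i=r..<k. X i (Suc i))"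
        using r by (simp add: sum.atLeastLessThan_concat)
      then show ?thesis using r by (simp add: sum.atLeast_Suc_lessThan)
    qed
    let ?a = "(\<Sum>i=j..<r. X i (Suc i)) - X j r"
    let ?b = "(\<Sum>i=Suc r..<k. X i (Suc i)) - X (Suc r) k"
    let ?c = "X j k - X j r - X r k"
    let ?e = "X r k - X r (Suc r) - X (Suc r) k"
    have eq: "(\<Sum>i=j..<k. X i (Suc i)) - X j k = (?a + ?b) - (?c + ?e)"
      unfolding split by (simp add: algebra_simps)
    have "norm ((\<Sum>i=j..<k. X i (Suc i)) - X j k) \<le> (norm ?a + norm ?b) + (norm ?c + norm ?e)"
      using arg_cong[OF eq, of norm] norm_triangle_ineq4[of "?a + ?b" "?c + ?e"] norm_triangle_ineq[of ?a ?b]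
        norm_triangle_ineq[of ?c ?e] by linarith
    also have "\<dots> \<le> 2 * (?K * D * (d/2) powr \<theta>) + 2 * (D * d powr \<theta>)"
      using A B C E by linarith
    also have "\<dots> = (2 * (?K * (1/2) powr \<theta>) + 2) * D * d powr \<theta>"
    proof -
      have "(d/2) powr \<theta> = (1/2) powr \<theta> * d powr \<theta>" using d by (simp add: powr_divide)
      then show ?thesis by (simp add: algebra_simps)
    qed
    also have "\<dots> = ?K * D * d powr \<theta>" using sew_const_props(2)[OF th] by simp
    finally show ?thesis by (simp add: d_def)
  qed
qed

subsection \<open>Left-point sums\<close>

text \<open>One good subdivision per interval and tolerance is enough, because the estimates below
  hold for all left-point sums alike and so pass to the increments of I.\<close>

definition Lint :: "('x \<Rightarrow> 'c::real_normed_vector \<Rightarrow> 'e::real_normed_vector) \<Rightarrow> (real \<Rightarrow> 'x) \<Rightarrow>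
    (real \<Rightarrow> 'c) \<Rightarrow> (real \<Rightarrow> 'e) \<Rightarrow> bool" where
  "Lint M x z I \<longleftrightarrow> (\<forall>u v e. 0 \<le> u \<longrightarrow> u < v \<longrightarrow> 0 < e \<longrightarrow> (\<exists>Q. subdivision Q u v \<and>
     norm ((\<Sum>i<length Q - 1. M (x (Q!i)) (z (Q!Suc i) - z (Q!i))) - (I v - I u)) < e))"

text \<open>Some left-point sum lies within any given distance of the increment, so a bound on all
  of them is inherited.\<close>

lemma Lint_bound:
  assumes "Lint M x z I" "0 \<le> u" "u < v"
    and "\<And>Q. subdivision Q u v \<Longrightarrow>
       norm ((\<Sum>i<length Q - 1. M (x (Q!i)) (z (Q!Suc i) - z (Q!i))) - c) \<le> B"
  shows "norm (I v - I u - c) \<le> B"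
proof (rule field_le_epsilon)
  fix e :: real assume "e > 0"
  then obtain Q where Q: "subdivision Q u v"
    "norm ((\<Sum>i<length Q - 1. M (x (Q!i)) (z (Q!Suc i) - z (Q!i))) - (I v - I u)) < e"
    using assms(1-3) unfolding Lint_def by blast
  let ?S = "\<Sum>i<length Q - 1. M (x (Q!i)) (z (Q!Suc i) - z (Q!i))"
  have eq: "I v - I u - c = (?S - c) - (?S - (I v - I u))" by simp
  have "norm (I v - I u - c) \<le> norm (?S - c) + norm (?S - (I v - I u))"
 using arg_cong[OF eq, of norm] norm_triangle_ineq4[of "?S - c" "?S - (I v - I u)"] by linarith
  then show "norm (I v - I u - c) \<le> B + e" using assms(4)[OF Q(1)] Q(2) by linarith
qed

lemma leftlim_tendsto:
  assumes "cadlag x" "s > 0"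
  shows "(x \<longlongrightarrow> leftlim x s) (at_left s)"
proof -
  obtain l where l: "(x \<longlongrightarrow> l) (at_left s)" using assms by (auto simp: cadlag_def)
  then have "Lim (at_left s) x = l" by (intro tendsto_Lim) auto
  then show ?thesis using l assms by (simp add: leftlim_def)
qed

text \<open>Left limits at points just after s are limits of values of x just after s. It is what
  lets a tag slightly to the right of a subdivision point reproduce the value of x at that
  point.\<close>

lemma leftlim_at_right:
  assumes "cadlag x" "s \<ge> 0"
  shows "(leftlim x \<longlongrightarrow> x s) (at_right s)"
proof (rule tendstoI)
  fix e :: real assume e: "e > 0"
  have "(x \<longlongrightarrow> x s) (at_right s)" using assms by (auto simp: cadlag_def)
  then have "eventually (\<lambda>r. dist (x r) (x s) < e/2) (at_right s)"
    by (rule tendstoD) (use e in simp)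
  then obtain b where b: "b > s" "\<And>r. s < r \<Longrightarrow> r < b \<Longrightarrow> dist (x r) (x s) < e/2"
    by (auto simp: eventually_at_right[OF less_add_one])
  have "dist (leftlim x r) (x s) < e" if r: "s < r" "r < b" for r
  proof -
    have "(x \<longlongrightarrow> leftlim x r) (at_left r)" using leftlim_tendsto[OF assms(1), of r] assms(2) r by auto
    then have "((\<lambda>t. dist (x t) (x s)) \<longlongrightarrow> dist (leftlim x r) (x s)) (at_left r)"
      by (intro tendsto_intros)
    moreover have "eventually (\<lambda>t. dist (x t) (x s) \<le> e/2) (at_left r)"
      using b r by (subst eventually_at_left[of s]) (auto intro!: exI[of _ s] less_imp_le)
    ultimately have "dist (leftlim x r) (x s) \<le> e/2"
      by (rule tendsto_upperbound) simp
    then show ?thesis using e by simp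
  qed
  then show "eventually (\<lambda>r. dist (leftlim x r) (x s) < e) (at_right s)"
    using b by (subst eventually_at_right[OF less_add_one]) auto
qed

lemma subdivision_union:
  assumes "subdivision P a b" "finite S" "S \<subseteq> {a..b}"
  obtains Q where "subdivision Q a b" "set Q = set P \<union> S"
proof
  show "subdivision (sorted_list_of_set (set P \<union> S)) a b"
    using subdivisionD(7-9)[OF assms(1)] assms(2,3)
    by (intro subdivision_sorted_list_of_set) auto
  show "set (sorted_list_of_set (set P \<union> S)) = set P \<union> S" using assms by simp
qed

lemma subdivision_take_drop:
  assumes "subdivision Q a b" "n \<le> length Q - 1"
  shows "subdivision (take (Suc n) Q) a (Q!n)" "subdivision (drop n Q) (Q!n) b"
    "set (take (Suc n) Q) = {s\<in>set Q. s \<le> Q!n}"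
proof -
  note D = subdivisionD[OF assms(1)]
  have so: "sorted_wrt (<) Q" and hl: "hd Q = a" "last Q = b" using assms by (auto simp: subdivision_def)
  have n: "n < length Q" using assms D(3) by linarith
  show "subdivision (take (Suc n) Q) a (Q!n)"
    using sorted_wrt_take[OF so, of "Suc n"] hl n D(3)
    by (auto simp: subdivision_def take_Suc_conv_app_nth[OF n] hd_append hd_conv_nth)
  show "subdivision (drop n Q) (Q!n) b"
    using so hl n by (auto simp: subdivision_def sorted_wrt_drop hd_drop_conv_nth)
  show "set (take (Suc n) Q) = {s\<in>set Q. s \<le> Q!n}"
  proof safe
    fix s assume "s \<in> set (take (Suc n) Q)"
    then obtain i where "i < Suc n" "i < length Q" "s = Q!i" by (auto simp: in_set_conv_nth)
    then show "s \<in> set Q" "s \<le> Q!n" using D(5)[of i n] assms by auto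
  next
    fix s assume s: "s \<in> set Q" "s \<le> Q!n"
    then obtain i where i: "i < length Q" "s = Q!i" by (auto simp: in_set_conv_nth)
    have "i \<le> n" using D(4)[of n i] s i by force
    then show "s \<in> set (take (Suc n) Q)" using i by (auto simp: in_set_conv_nth intro!: exI[of _ i])
  qed
qed

text \<open>Tags are free in \<open>RS_has\<close>, so each is put just to the right of its left
  endpoint, where \<open>leftlim x\<close> is close to x at the endpoint. On a subdivision of [0,v]
  that refines those chosen for u and for v, the sum over [u,v] is a difference of two tagged
  sums.\<close>

lemma RS_has_imp_Lint:
  fixes M :: "'x::metric_space \<Rightarrow> 'c::real_normed_vector \<Rightarrow> 'e::real_normed_vector"
  assumes cad: "cadlag x" and cont: "\<And>c. continuous_on UNIV (\<lambda>y. M y c)"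
    and RS: "\<And>t. t \<ge> 0 \<Longrightarrow> RS_has M (leftlim x) z 0 t (I t)"
  shows "Lint M x z I"
  unfolding Lint_def
proof (intro allI impI)
  fix u v e :: real assume u: "0 \<le> u" and uv: "u < v" and e: "0 < e"
  have e4: "e/4 > 0" using e by simp
  have v0: "v \<ge> 0" using u uv by simp
  obtain Pu where Pu: "subdivision Pu 0 u" and
    Pu': "\<And>Q \<xi>. subdivision Q 0 u \<Longrightarrow> set Pu \<subseteq> set Q \<Longrightarrow> (\<forall>i < length Q - 1. Q ! i \<le> \<xi> i \<and> \<xi> i \<le> Q ! Suc i) \<Longrightarrow>
       norm ((\<Sum>i < length Q - 1. M (leftlim x (\<xi> i)) (z (Q ! Suc i) - z (Q ! i))) - I u) < e/4"
    using RS[of u] u e4 unfolding RS_has_def by blast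
  obtain Pv where Pv: "subdivision Pv 0 v" and
    Pv': "\<And>Q \<xi>. subdivision Q 0 v \<Longrightarrow> set Pv \<subseteq> set Q \<Longrightarrow> (\<forall>i < length Q - 1. Q ! i \<le> \<xi> i \<and> \<xi> i \<le> Q ! Suc i) \<Longrightarrow>
       norm ((\<Sum>i < length Q - 1. M (leftlim x (\<xi> i)) (z (Q ! Suc i) - z (Q ! i))) - I v) < e/4"
    using RS[of v] v0 e4 unfolding RS_has_def by blast
  obtain Q where Q: "subdivision Q 0 v" "set Q = set Pv \<union> set Pu"
    using subdivision_union[OF Pv, of "set Pu"] subdivisionD(7)[OF Pu] uv
    by (metis List.finite_set atLeastAtMost_iff le_less_trans less_imp_le subsetI)
  note D = subdivisionD[OF Q(1)]
  define m where "m = length Q - 1"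
  obtain n where n: "n < length Q" "Q ! n = u"
    using subdivisionD(9)[OF Pu] Q(2) by (metis UnI2 in_set_conv_nth)
  have nm: "n \<le> m" using n by (simp add: m_def)
  \<comment> \<open>Q is fixed by now, so the tag errors can be spread over its m intervals to stay
    below e/2 in total.\<close>
  define \<epsilon> where "\<epsilon> = e / (2 * (real m + 1))"
  have eps: "\<epsilon> > 0" using e by (simp add: \<epsilon>_def)
  have "\<exists>r. Q!i \<le> r \<and> r \<le> Q!Suc i \<and> norm (M (leftlim x r) (z (Q!Suc i) - z (Q!i)) - M (x (Q!i)) (z (Q!Suc i) - z (Q!i))) < \<epsilon>"
    if i: "i < m" for i
  proof -
    let ?c = "z (Q!Suc i) - z (Q!i)"
    have lt: "Q!i < Q!Suc i" using D(4)[of i "Suc i"] i by (simp add: m_def)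
    have "0 \<le> Q!i" using D(6)[of i] i by (auto simp: m_def)
    then have "((\<lambda>r. M (leftlim x r) ?c) \<longlongrightarrow> M (x (Q!i)) ?c) (at_right (Q!i))"
      using continuous_on_tendsto_compose[OF cont leftlim_at_right[OF cad]] by simp
    then have "eventually (\<lambda>r. dist (M (leftlim x r) ?c) (M (x (Q!i)) ?c) < \<epsilon>) (at_right (Q!i))"
      by (rule tendstoD) (rule eps)
    moreover have "eventually (\<lambda>r. Q!i < r \<and> r < Q!Suc i) (at_right (Q!i))"
      using lt by (simp add: eventually_at_right_less eventually_at_right[OF lt] exI[of _ "Q!Suc i"])
    ultimately have "eventually (\<lambda>r. dist (M (leftlim x r) ?c) (M (x (Q!i)) ?c) < \<epsilon> \<and> Q!i < r \<and> r < Q!Suc i) (at_right (Q!i))"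
      by (rule eventually_conj)
    then obtain r where "dist (M (leftlim x r) ?c) (M (x (Q!i)) ?c) < \<epsilon> \<and> Q!i < r \<and> r < Q!Suc i"
      using eventually_happens'[OF trivial_limit_at_right_real] by blast
    then show ?thesis by (intro exI[of _ r]) (auto simp: dist_norm)
  qed
  then obtain \<xi> where xi: "\<And>i. i < m \<Longrightarrow> Q!i \<le> \<xi> i \<and> \<xi> i \<le> Q!Suc i \<and>
      norm (M (leftlim x (\<xi> i)) (z (Q!Suc i) - z (Q!i)) - M (x (Q!i)) (z (Q!Suc i) - z (Q!i))) < \<epsilon>"
    by metis
  let ?T = "\<lambda>i. M (leftlim x (\<xi> i)) (z (Q!Suc i) - z (Q!i))"
  let ?L = "\<lambda>i. M (x (Q!i)) (z (Q!Suc i) - z (Q!i))"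
  have 1: "norm ((\<Sum>i<m. ?T i) - I v) < e/4"
    using Pv'[OF Q(1), of \<xi>] Q(2) xi by (auto simp: m_def)
  \<comment> \<open>The part of Q up to u refines \<open>Pu\<close>, so the same tags also
    approximate I u.\<close>
  have 2: "norm ((\<Sum>i<n. ?T i) - I u) < e/4"
  proof -
    let ?R = "take (Suc n) Q"
    have len: "length ?R - 1 = n" using n by simp
    have sub: "subdivision ?R 0 u" "set ?R = {s\<in>set Q. s \<le> u}"
      using subdivision_take_drop[OF Q(1), of n] n by auto
    have "norm ((\<Sum>i < length ?R - 1. M (leftlim x (\<xi> i)) (z (?R ! Suc i) - z (?R ! i))) - I u) < e/4"
    proof (rule Pu'[OF sub(1)])
      show "set Pu \<subseteq> set ?R" using subdivisionD(7)[OF Pu] Q(2) unfolding sub(2) by auto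
      show "\<forall>i<length ?R - 1. ?R ! i \<le> \<xi> i \<and> \<xi> i \<le> ?R ! Suc i" using xi nm by (auto simp: len)
    qed
    then show ?thesis unfolding len by (simp cong: sum.cong_simp)
  qed
  have 3: "norm ((\<Sum>i=n..<m. ?L i) - (\<Sum>i=n..<m. ?T i)) \<le> e/2"
  proof -
    have "norm ((\<Sum>i=n..<m. ?L i) - (\<Sum>i=n..<m. ?T i)) = norm (\<Sum>i=n..<m. ?T i - ?L i)"
      by (simp add: sum_subtractf norm_minus_commute)
    also have "\<dots> \<le> (\<Sum>i=n..<m. \<epsilon>)"
      using xi by (intro sum_norm_le) (auto intro: less_imp_le)
    also have "\<dots> \<le> (real m + 1) * \<epsilon>" using eps nm by (simp add: mult_right_mono)
    also have "\<dots> = e/2" by (simp add: \<epsilon>_def field_simps)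
    finally show ?thesis .
  qed
  have 4: "(\<Sum>i<m. ?T i) = (\<Sum>i<n. ?T i) + (\<Sum>i=n..<m. ?T i)"
    using sum.atLeastLessThan_concat[of 0 n m ?T] nm by (simp add: lessThan_atLeast0)
  have "norm ((\<Sum>i=n..<m. ?L i) - (I v - I u)) < e"
  proof -
    have eq: "(\<Sum>i=n..<m. ?L i) - (I v - I u) =
       ((\<Sum>i=n..<m. ?L i) - (\<Sum>i=n..<m. ?T i)) + (((\<Sum>i<m. ?T i) - I v) - ((\<Sum>i<n. ?T i) - I u))"
      unfolding 4 by (simp only: algebra_simps)
    have "norm ((\<Sum>i=n..<m. ?L i) - (I v - I u)) \<le> norm ((\<Sum>i=n..<m. ?L i) - (\<Sum>i=n..<m. ?T i))
       + (norm ((\<Sum>i<m. ?T i) - I v) + norm ((\<Sum>i<n. ?T i) - I u))"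
      unfolding eq by (intro order_trans[OF norm_triangle_ineq] add_left_mono norm_triangle_ineq4)
    then show ?thesis using 1 2 3 by linarith
  qed
  moreover have "(\<Sum>i<length (drop n Q) - 1. M (x (drop n Q!i)) (z (drop n Q!Suc i) - z (drop n Q!i))) = (\<Sum>i=n..<m. ?L i)"
  proof -
    have "(\<Sum>i=n..<m. ?L i) = (\<Sum>i=0..<m-n. ?L (i + n))"
      using sum.shift_bounds_nat_ivl[of ?L 0 n "m - n"] nm by simp
    then show ?thesis using n by (auto simp: m_def lessThan_atLeast0 add.commute intro!: sum.cong)
  qed
  ultimately show "\<exists>Q. subdivision Q u v \<and>
     norm ((\<Sum>i<length Q - 1. M (x (Q!i)) (z (Q!Suc i) - z (Q!i))) - (I v - I u)) < e"
    using subdivision_take_drop(2)[OF Q(1), of n] n nm by (intro exI[of _ "drop n Q"]) (auto simp: m_def)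
qed

text \<open>A left-point sum depends only on the values at its nodes; pulling the nodes back along
  the inverse of \<open>lam\<close> changes no term.\<close>

lemma Lint_compose:
  assumes "Lint M x z I" "time_change lam"
  shows "Lint M (x \<circ> lam) (z \<circ> lam) (I \<circ> lam)"
  unfolding Lint_def
proof (intro allI impI)
  fix u v e :: real assume u: "0 \<le> u" and uv: "u < v" and e: "0 < e"
  have sm: "strict_mono_on {0..} lam" and im: "lam ` {0..} = {0..}" and l0: "lam 0 = 0"
    using assms(2) by (auto simp: time_change_def)
  have lu: "0 \<le> lam u" "lam u < lam v"
    using im u sm uv by (auto simp: strict_mono_on_def)
  then obtain Q where Q: "subdivision Q (lam u) (lam v)"
    "norm ((\<Sum>i<length Q - 1. M (x (Q!i)) (z (Q!Suc i) - z (Q!i))) - (I (lam v) - I (lam u))) < e"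
    using assms(1) e unfolding Lint_def by blast
  note D = subdivisionD[OF Q(1)]
  define mu where "mu = inv_into {0..} lam"
  have inj: "inj_on lam {0..}" using sm by (rule strict_mono_on_imp_inj_on)
  have mu1: "mu (lam s) = s" if "s \<ge> 0" for s using inj that by (simp add: mu_def)
  have mu2: "lam (mu s) = s" "mu s \<ge> 0" if "s \<ge> 0" for s
    using that im f_inv_into_f[of s lam "{0..}"] inv_into_into[of s lam "{0..}"] by (auto simp: mu_def)
  have mul: "mu s < mu t" if "0 \<le> s" "s < t" for s t
    using strict_mono_on_leD[OF sm, of "mu t" "mu s"] mu2[of s] mu2[of t] that by force
  let ?R = "map mu Q"
  have so: "sorted_wrt (<) Q" using Q by (simp add: subdivision_def)
  have "subdivision ?R u v"
  proof -
    have "sorted_wrt (<) ?R"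
      unfolding sorted_wrt_map
      by (rule sorted_wrt_mono_rel[OF _ so]) (use mul D(7) lu in force)
    then show ?thesis using Q mu1 u uv
      by (auto simp: subdivision_def hd_map last_map)
  qed
  moreover have "lam (?R ! i) = Q ! i" if "i < length Q" for i
    using that mu2(1)[of "Q!i"] D(6)[of i] lu by fastforce
  ultimately show "\<exists>Q. subdivision Q u v \<and>
     norm ((\<Sum>i<length Q - 1. M ((x \<circ> lam) (Q!i)) ((z \<circ> lam) (Q!Suc i) - (z \<circ> lam) (Q!i))) - ((I \<circ> lam) v - (I \<circ> lam) u)) < e"
    using Q(2) by (intro exI[of _ ?R]) (auto cong: sum.cong_simp)
qed

subsection \<open>Estimates for limits of left-point sums\<close>

text \<open>The errors of the single terms are increments of E, so their sum telescopes. With N = 0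
  this is a size bound; with N the integrand frozen at one point it is the error of a one-term
  approximation.\<close>

lemma Lint_telescope:
  fixes M :: "'x \<Rightarrow> 'c::real_normed_vector \<Rightarrow> 'e::real_normed_vector"
  assumes L: "Lint M x z I" and uv: "0 \<le> u" "u < v"
    and N: "\<And>a b. N (a - b) = N a - N b"
    and E: "\<And>s t. u \<le> s \<Longrightarrow> s < t \<Longrightarrow> t \<le> v \<Longrightarrow>
              norm (M (x s) (z t - z s) - N (z t - z s)) \<le> E t - E s"
  shows "norm (I v - I u - N (z v - z u)) \<le> E v - (E u :: real)"
proof (rule Lint_bound[OF L uv])
  fix Q assume Q: "subdivision Q u v"
  note D = subdivisionD[OF Q]
  let ?m = "length Q - 1"
  let ?X = "\<lambda>i. M (x (Q!i)) (z (Q!Suc i) - z (Q!i))"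
  have "N (z v - z u) = (\<Sum>i<?m. N (z (Q!Suc i)) - N (z (Q!i)))"
    using sum_lessThan_telescope[of "\<lambda>i. N (z (Q!i))" ?m] D(1,2) N by simp
  then have "norm ((\<Sum>i<?m. ?X i) - N (z v - z u)) = norm (\<Sum>i<?m. ?X i - N (z (Q!Suc i) - z (Q!i)))"
    by (simp add: sum_subtractf N)
  also have "\<dots> \<le> (\<Sum>i<?m. E (Q!Suc i) - E (Q!i))"
  proof (rule sum_norm_le)
    fix i assume "i \<in> {..<?m}"
    then show "norm (?X i - N (z (Q!Suc i) - z (Q!i))) \<le> E (Q!Suc i) - E (Q!i)"
      using D(4)[of i "Suc i"] D(6)[of i] D(6)[of "Suc i"] by (intro E) auto
  qed
  also have "\<dots> = E v - E u"
    using sum_lessThan_telescope[of "\<lambda>i. E (Q!i)" ?m] D(1,2) by simp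
  finally show "norm ((\<Sum>i<?m. ?X i) - N (z v - z u)) \<le> E v - E u" .
qed

text \<open>The germ M (x (Q!i)) (z (Q!j) - z (Q!i)) fails to be additive by exactly the difference
  that E bounds; sewing then compares the whole sum with the single term over [u,v].\<close>

lemma Lint_young:
  fixes M :: "'x \<Rightarrow> 'c::real_normed_vector \<Rightarrow> 'e::real_normed_vector"
  assumes L: "Lint M x z I" and uv: "0 \<le> u" "u < v"
    and M: "\<And>y a b. M y (a - b) = M y a - M y b"
    and th: "\<theta> > 1" and D: "D \<ge> 0"
    and F: "\<And>s t. u \<le> s \<Longrightarrow> s \<le> t \<Longrightarrow> t \<le> v \<Longrightarrow> F s \<le> F t"
    and E: "\<And>r s t. u \<le> r \<Longrightarrow> r \<le> s \<Longrightarrow> s < t \<Longrightarrow> t \<le> v \<Longrightarrow>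
        norm (M (x s) (z t - z s) - M (x r) (z t - z s)) \<le> D * (F t - F r) powr \<theta>"
  shows "norm (I v - I u - M (x u) (z v - z u)) \<le> sew_const \<theta> * D * (F v - F u) powr \<theta>"
proof (rule Lint_bound[OF L uv])
  fix Q assume Q: "subdivision Q u v"
  note Q = subdivisionD[OF Q]
  let ?m = "length Q - 1"
  let ?X = "\<lambda>i j. M (x (Q!i)) (z (Q!j) - z (Q!i))"
  have M0: "M y 0 = 0" for y using M[of y 0 0] by simp
  have "norm ((\<Sum>i=0..<?m. ?X i (Suc i)) - ?X 0 ?m) \<le> sew_const \<theta> * D * (F (Q!?m) - F (Q!0)) powr \<theta>"
  proof (rule sewing[where m = ?m, OF th D])
    fix i j assume "i \<le> j" "j \<le> ?m"
    then show "F (Q!i) \<le> F (Q!j)" using Q(5)[of i j] Q(6)[of i] Q(6)[of j] by (intro F) auto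
  next
    fix i j k assume ijk: "i \<le> j" "j \<le> k" "k \<le> ?m"
    have "?X i k - ?X i j - ?X j k = - (M (x (Q!j)) (z (Q!k) - z (Q!j)) - M (x (Q!i)) (z (Q!k) - z (Q!j)))"
      by (simp add: M)
    then have "norm (?X i k - ?X i j - ?X j k) = norm (M (x (Q!j)) (z (Q!k) - z (Q!j)) - M (x (Q!i)) (z (Q!k) - z (Q!j)))"
      by (simp only: norm_minus_cancel)
    also have "\<dots> \<le> D * (F (Q!k) - F (Q!i)) powr \<theta>"
    proof (cases "j = k")
      case True
      then show ?thesis using M0 D by simp
    next
      case False
      then show ?thesis using ijk Q(4)[of j k] Q(5)[of i j] Q(6)[of i] Q(6)[of k] by (intro E) auto
    qed
    finally show "norm (?X i k - ?X i j - ?X j k) \<le> D * (F (Q!k) - F (Q!i)) powr \<theta>" .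
  qed auto
  then show "norm ((\<Sum>i<?m. ?X i (Suc i)) - M (x u) (z v - z u)) \<le> sew_const \<theta> * D * (F v - F u) powr \<theta>"
    using Q(1,2) by (simp add: lessThan_atLeast0)
qed

text \<open>Along the sum the integrand can move by more than \<open>\<eta>\<close> at most \<open>(F v - F u) / \<kappa>\<close> times,
  and between two such moves the sum is close to a multiple of an increment of \<open>z\<close>.\<close>

lemma Lint_count:
  fixes M :: "'x \<Rightarrow> 'c::real_normed_vector \<Rightarrow> 'e::real_normed_vector"
  assumes L: "Lint M x z I" and uv: "0 \<le> u" "u < v"
    and M: "\<And>y a b. M y (a - b) = M y a - M y b"
    and k: "\<kappa> > 0" and B: "B \<ge> 0" and \<delta>: "\<delta> \<ge> 0" and \<eta>: "\<eta> \<ge> 0"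
    and F: "\<And>s t. u \<le> s \<Longrightarrow> s \<le> t \<Longrightarrow> t \<le> v \<Longrightarrow> F s \<le> F t"
    and osc: "\<And>r s c. u \<le> r \<Longrightarrow> r \<le> s \<Longrightarrow> s \<le> v \<Longrightarrow> F s - F r < \<kappa> \<Longrightarrow>
        norm (M (x s) c - M (x r) c) \<le> \<eta> * norm c"
    and bnd: "\<And>s c. u \<le> s \<Longrightarrow> s \<le> v \<Longrightarrow> norm (M (x s) c) \<le> B * norm c"
    and z: "\<And>s t. u \<le> s \<Longrightarrow> s \<le> t \<Longrightarrow> t \<le> v \<Longrightarrow> norm (z t - z s) \<le> \<delta>"
    and A: "\<And>s t. u \<le> s \<Longrightarrow> s \<le> t \<Longrightarrow> t \<le> v \<Longrightarrow> norm (z t - z s) \<le> A t - A s"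
  shows "norm (I v - I u) \<le> \<eta> * (A v - A u) + (1 + (F v - F u) / \<kappa>) * (B * \<delta>)"
proof -
  have "norm (I v - I u - 0) \<le> \<eta> * (A v - A u) + (1 + (F v - F u) / \<kappa>) * (B * \<delta>)"
  proof (rule Lint_bound[OF L uv])
    fix Q assume Q: "subdivision Q u v"
    note Q = subdivisionD[OF Q]
    define m where "m = length Q - 1"
    let ?X = "\<lambda>i. M (x (Q!i)) (z (Q!Suc i) - z (Q!i))"
    have Qb: "u \<le> Q!i \<and> Q!i \<le> v" if "i \<le> m" for i using Q(6) that by (simp add: m_def)
    have Ql: "Q!i \<le> Q!j" if "i \<le> j" "j \<le> m" for i j using Q(5) that by (simp add: m_def)
    \<comment> \<open>On a block whose tags all stay within \<open>\<kappa>\<close> of the first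
      one, freezing the integrand leaves a single increment of z, bounded by
      \<open>\<delta>\<close>, and an error weighted by \<open>\<eta>\<close>.\<close>
    have step: "norm (\<Sum>i=j..<r. ?X i) \<le> \<eta> * (A (Q!r) - A (Q!j)) + B * \<delta>"
      if jr: "j \<le> r" "r \<le> m" and sm: "\<And>i. j \<le> i \<Longrightarrow> i < r \<Longrightarrow> F (Q!i) - F (Q!j) < \<kappa>" for j r
    proof -
      let ?c = "\<lambda>i. z (Q!Suc i) - z (Q!i)"
      let ?Y = "M (x (Q!j)) (z (Q!r) - z (Q!j))"
      have Y: "?Y = (\<Sum>i=j..<r. M (x (Q!j)) (?c i))"
        using sum_Suc_diff'[of j r "\<lambda>i. M (x (Q!j)) (z (Q!i))"] jr by (simp add: M)
      have "norm ((\<Sum>i=j..<r. ?X i) - ?Y) = norm (\<Sum>i=j..<r. ?X i - M (x (Q!j)) (?c i))"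
        unfolding Y by (simp add: sum_subtractf)
      also have "\<dots> \<le> (\<Sum>i=j..<r. \<eta> * (A (Q!Suc i) - A (Q!i)))"
      proof (rule sum_norm_le)
        fix i assume i: "i \<in> {j..<r}"
        then have "norm (?X i - M (x (Q!j)) (?c i)) \<le> \<eta> * norm (?c i)"
          using jr Ql[of j i] Qb[of j] Qb[of i] sm[of i] by (intro osc) auto
        also have "\<dots> \<le> \<eta> * (A (Q!Suc i) - A (Q!i))"
          using i jr Ql[of i "Suc i"] Qb[of i] Qb[of "Suc i"] \<eta> by (intro mult_left_mono A) auto
        finally show "norm (?X i - M (x (Q!j)) (?c i)) \<le> \<eta> * (A (Q!Suc i) - A (Q!i))" .
      qed
      also have "\<dots> = \<eta> * (A (Q!r) - A (Q!j))"
        using sum_Suc_diff'[of j r "\<lambda>i. A (Q!i)"] jr by (simp add: sum_distrib_left[symmetric])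
      finally have 1: "norm ((\<Sum>i=j..<r. ?X i) - ?Y) \<le> \<eta> * (A (Q!r) - A (Q!j))" .
      have "norm ?Y \<le> B * norm (z (Q!r) - z (Q!j))" using jr Qb[of j] by (intro bnd) auto
      also have "\<dots> \<le> B * \<delta>" using jr Qb[of j] Qb[of r] Ql[of j r] B by (intro mult_left_mono z) auto
      finally have 2: "norm ?Y \<le> B * \<delta>" .
      show ?thesis using norm_triangle_sub[of "\<Sum>i=j..<r. ?X i" ?Y] 1 2 by linarith
    qed
    have "j \<le> m \<Longrightarrow> norm (\<Sum>i=j..<m. ?X i) \<le> \<eta> * (A (Q!m) - A (Q!j)) + (1 + (F (Q!m) - F (Q!j)) / \<kappa>) * (B * \<delta>)" for j
    proof (induction "m - j" arbitrary: j rule: less_induct)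
      case less
      show ?case
      proof (cases "\<forall>i. j \<le> i \<longrightarrow> i < m \<longrightarrow> F (Q!i) - F (Q!j) < \<kappa>")
        case True
        have "0 \<le> (F (Q!m) - F (Q!j)) / \<kappa> * (B * \<delta>)"
          using F[of "Q!j" "Q!m"] Qb[of j] Qb[of m] Ql[of j m] less.prems k B \<delta> by auto
        then show ?thesis using step[of j m] less.prems True by (simp add: algebra_simps)
      next
        case False
        \<comment> \<open>The first tag at which the control has gained \<open>\<kappa>\<close>. The
          block ends before this tag, so all its tags are still close to each other; the gain at r,
          however large, pays for one further B * \<delta>.\<close>
        define r where "r = (LEAST i. j \<le> i \<and> i < m \<and> \<kappa> \<le> F (Q!i) - F (Q!j))"
        have "\<exists>i. j \<le> i \<and> i < m \<and> \<kappa> \<le> F (Q!i) - F (Q!j)" using False by (auto simp: not_less)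
        then have r: "j \<le> r" "r < m" "\<kappa> \<le> F (Q!r) - F (Q!j)"
          using LeastI_ex[of "\<lambda>i. j \<le> i \<and> i < m \<and> \<kappa> \<le> F (Q!i) - F (Q!j)"] by (auto simp: r_def)
        have rl: "F (Q!i) - F (Q!j) < \<kappa>" if "j \<le> i" "i < r" for i
          using not_less_Least[of i "\<lambda>i. j \<le> i \<and> i < m \<and> \<kappa> \<le> F (Q!i) - F (Q!j)"] that r by (auto simp: r_def)
        have "r \<noteq> j" using r(3) k by auto
        then have IH: "norm (\<Sum>i=r..<m. ?X i) \<le> \<eta> * (A (Q!m) - A (Q!r)) + (1 + (F (Q!m) - F (Q!r)) / \<kappa>) * (B * \<delta>)"
          using less.hyps[of r] r by auto
        have 1: "norm (\<Sum>i=j..<r. ?X i) \<le> \<eta> * (A (Q!r) - A (Q!j)) + B * \<delta>"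
          using step[of j r] r rl by auto
        have "(F (Q!m) - F (Q!r)) / \<kappa> \<le> (F (Q!m) - F (Q!j) - \<kappa>) / \<kappa>"
          using r k by (intro divide_right_mono) auto
        also have "\<dots> = (F (Q!m) - F (Q!j)) / \<kappa> - 1" using k by (simp add: field_simps)
        finally have 2: "(1 + (F (Q!m) - F (Q!r)) / \<kappa>) * (B * \<delta>) \<le> ((F (Q!m) - F (Q!j)) / \<kappa>) * (B * \<delta>)"
          using B \<delta> by (intro mult_right_mono) auto
        have 3: "(\<Sum>i=j..<m. ?X i) = (\<Sum>i=j..<r. ?X i) + (\<Sum>i=r..<m. ?X i)"
          using r by (simp add: sum.atLeastLessThan_concat)
        have "norm (\<Sum>i=j..<m. ?X i) \<le> norm (\<Sum>i=j..<r. ?X i) + norm (\<Sum>i=r..<m. ?X i)"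
          unfolding 3 by (rule norm_triangle_ineq)
        then show ?thesis using 1 2 IH by (simp add: algebra_simps)
      qed
    qed
    from this[of 0] show "norm ((\<Sum>i<length Q - 1. ?X i) - 0) \<le> \<eta> * (A v - A u) + (1 + (F v - F u) / \<kappa>) * (B * \<delta>)"
      using Q(1,2) by (simp add: lessThan_atLeast0 m_def)
  qed
  then show ?thesis by simp
qed

subsection \<open>Controls of finite variation\<close>

text \<open>A control written as the increment of a function of one variable. Superadditivity makes
  t \<mapsto> \<open>v_var p x a t\<close> such an F, and conversely any F bounds the p-variation by
  its increment, so suprema over subdivisions can be left behind.\<close>

definition pcontrol :: "real \<Rightarrow> real set \<Rightarrow> (real \<Rightarrow> 'a::real_normed_vector) \<Rightarrow> (real \<Rightarrow> real) \<Rightarrow> bool" where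
  "pcontrol p S x F \<longleftrightarrow> (\<forall>s\<in>S. \<forall>t\<in>S. s \<le> t \<longrightarrow> norm (x t - x s) powr p \<le> F t - F s)"

lemma pcontrolD: "pcontrol p S x F \<Longrightarrow> s \<in> S \<Longrightarrow> t \<in> S \<Longrightarrow> s \<le> t \<Longrightarrow> norm (x t - x s) powr p \<le> F t - F s"
  by (auto simp: pcontrol_def)

lemma pcontrol_mono: "pcontrol p S x F \<Longrightarrow> s \<in> S \<Longrightarrow> t \<in> S \<Longrightarrow> s \<le> t \<Longrightarrow> F s \<le> F t"
  using pcontrolD[of p S x F s t] by (smt (verit) powr_ge_zero)

lemma pcontrol_subset: "pcontrol p S x F \<Longrightarrow> R \<subseteq> S \<Longrightarrow> pcontrol p R x F"
  by (auto simp: pcontrol_def)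

lemma pcontrol_add:
  assumes "pcontrol p S x F" "\<And>s t. s \<in> S \<Longrightarrow> t \<in> S \<Longrightarrow> s \<le> t \<Longrightarrow> G s \<le> G t"
  shows "pcontrol p S x (\<lambda>t. F t + G t)"
  using assms unfolding pcontrol_def by (smt (verit))

lemma le_powr_inverse:
  fixes a b :: real
  assumes "a powr p \<le> b" "p > 0" "a \<ge> 0"
  shows "a \<le> b powr (1/p)"
proof -
  have "a = (a powr p) powr (1/p)" using assms by (simp add: powr_powr)
  also have "\<dots> \<le> b powr (1/p)" using assms by (intro powr_mono2) auto
  finally show ?thesis .
qed

lemma pcontrol_norm:
  assumes "pcontrol p S x F" "p > 0" "s \<in> S" "t \<in> S" "s \<le> t"
  shows "norm (x t - x s) \<le> (F t - F s) powr (1/p)"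
  using pcontrolD[OF assms(1,3-5)] assms(2) by (intro le_powr_inverse) auto

lemma pcontrol_1_norm:
  assumes "pcontrol 1 S x F" "s \<in> S" "t \<in> S" "s \<le> t"
  shows "norm (x t - x s) \<le> F t - F s"
  using pcontrolD[OF assms] by simp

lemma v_var_le:
  assumes "pcontrol p {a..b} x F"
  shows "v_var p x a b \<le> ereal (F b - F a)"
  unfolding v_var_def
proof (rule SUP_least)
  fix P assume "P \<in> {P. subdivision P a b}"
  then have P: "subdivision P a b" by simp
  note D = subdivisionD[OF P]
  have "(\<Sum>i < length P - 1. norm (x (P ! Suc i) - x (P ! i)) powr p) \<le> (\<Sum>i < length P - 1. F (P!Suc i) - F (P!i))"
    using D(6) D(5) by (intro sum_mono pcontrolD[OF assms]) auto
  also have "\<dots> = F b - F a"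
    using sum_lessThan_telescope[of "\<lambda>i. F (P!i)" "length P - 1"] D(1,2) by simp
  finally show "ereal (\<Sum>i < length P - 1. norm (x (P ! Suc i) - x (P ! i)) powr p) \<le> ereal (F b - F a)" by simp
qed

lemma v_var_nonneg:
  assumes "a \<le> b"
  shows "0 \<le> v_var p x a b"
proof -
  have "subdivision (sorted_list_of_set {a,b}) a b"
    using assms by (intro subdivision_sorted_list_of_set) auto
  then have "ereal (\<Sum>i < length (sorted_list_of_set {a,b}) - 1. norm (x (sorted_list_of_set {a,b} ! Suc i) - x (sorted_list_of_set {a,b} ! i)) powr p) \<le> v_var p x a b"
    unfolding v_var_def by (intro SUP_upper) simp
  moreover have "0 \<le> ereal (\<Sum>i < length (sorted_list_of_set {a,b}) - 1. norm (x (sorted_list_of_set {a,b} ! Suc i) - x (sorted_list_of_set {a,b} ! i)) powr p)"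
    by (simp add: sum_nonneg)
  ultimately show ?thesis by (rule order_trans[rotated])
qed

text \<open>Appending t to a subdivision of [a,s] adds one term. This is the superadditivity behind
  \<open>v_var_pcontrol\<close>.\<close>

lemma v_var_snoc:
  assumes "a \<le> s" "s \<le> t"
  shows "v_var p x a s + ereal (norm (x t - x s) powr p) \<le> v_var p x a t"
proof (cases "s = t")
  case True
  then show ?thesis by simp
next
  case False
  then have st: "s < t" using assms by simp
  have "v_var p x a s \<le> v_var p x a t - ereal (norm (x t - x s) powr p)"
    unfolding v_var_def[of p x a s]
  proof (rule SUP_least)
    fix P assume "P \<in> {P. subdivision P a s}"
    then have P: "subdivision P a s" by simp
    note D = subdivisionD[OF P]
    have "sorted_wrt (<) (P @ [t])"
      using P D(7) st by (fastforce simp: subdivision_def sorted_wrt_append)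
    then have "subdivision (P @ [t]) a t" using P by (auto simp: subdivision_def)
    then have "ereal (\<Sum>i < length (P@[t]) - 1. norm (x ((P@[t]) ! Suc i) - x ((P@[t]) ! i)) powr p) \<le> v_var p x a t"
      unfolding v_var_def by (intro SUP_upper) simp
    moreover have "(\<Sum>i < length (P@[t]) - 1. norm (x ((P@[t]) ! Suc i) - x ((P@[t]) ! i)) powr p)
       = (\<Sum>i < length P - 1. norm (x (P ! Suc i) - x (P ! i)) powr p) + norm (x t - x s) powr p"
    proof -
      have l: "length (P@[t]) - 1 = Suc (length P - 1)" using D(3) by simp
      show ?thesis unfolding l sum.lessThan_Suc
        using D(2,3) by (intro arg_cong2[where f="(+)"] sum.cong) (auto simp: nth_append)
    qed
    ultimately show "ereal (\<Sum>i < length P - 1. norm (x (P ! Suc i) - x (P ! i)) powr p) \<le> v_var p x a t - ereal (norm (x t - x s) powr p)"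
      by (simp add: ereal_le_minus)
  qed
  then show ?thesis by (simp add: ereal_le_minus)
qed

lemma v_var_mono:
  assumes "a \<le> s" "s \<le> t"
  shows "v_var p x a s \<le> v_var p x a t"
proof -
  have "v_var p x a s + 0 \<le> v_var p x a s + ereal (norm (x t - x s) powr p)"
    by (intro add_left_mono) simp
  then show ?thesis using v_var_snoc[OF assms, of p x] by (metis add.right_neutral order_trans)
qed

lemma v_var_pcontrol:
  assumes "\<And>t. t \<in> S \<Longrightarrow> a \<le> t \<and> v_var p x a t < \<infinity>"
  shows "pcontrol p S x (\<lambda>t. real_of_ereal (v_var p x a t))"
  unfolding pcontrol_def
proof (intro ballI impI)
  fix s t assume st: "s \<in> S" "t \<in> S" "s \<le> t"
  obtain u where u: "v_var p x a s = ereal u"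
    using assms[OF st(1)] v_var_nonneg[of a s p x] by (cases "v_var p x a s") auto
  obtain w where w: "v_var p x a t = ereal w"
    using assms[OF st(2)] v_var_nonneg[of a t p x] by (cases "v_var p x a t") auto
  show "norm (x t - x s) powr p \<le> real_of_ereal (v_var p x a t) - real_of_ereal (v_var p x a s)"
    using v_var_snoc[of a s t p x] assms[OF st(1)] st u w by simp
qed

lemma V_var_imp_v_var:
  assumes "V_var p x a b \<le> ereal B" "p > 0" "a \<le> b"
  shows "v_var p x a b \<le> ereal (\<bar>B\<bar> powr p)"
proof -
  have ni: "v_var p x a b \<noteq> \<infinity>" using assms(1) by (auto simp: V_var_def split: if_splits)
  then obtain w where w: "v_var p x a b = ereal w" "w \<ge> 0"
    using v_var_nonneg[OF assms(3), of p x] by (cases "v_var p x a b") auto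
  then have "w powr (1/p) \<le> B" using assms(1) ni by (simp add: V_var_def)
  then have "(w powr (1/p)) powr p \<le> \<bar>B\<bar> powr p" using assms(2) by (intro powr_mono2) auto
  then show ?thesis using w assms(2) by (simp add: powr_powr)
qed

text \<open>For nondecreasing F the infimum over later times is the right limit. Right-continuity
  matters because the a priori bound stops at the first time at which a control reaches a level, and
  the level must be reached at that time.\<close>

definition rlim :: "(real \<Rightarrow> real) \<Rightarrow> real \<Rightarrow> real" where
  "rlim F t = Inf (F ` {t<..})"

context
  fixes F :: "real \<Rightarrow> real"
  assumes F: "mono_on {0..} F"
begin

lemma rlim_le:
  assumes "0 \<le> t" "t < u"
  shows "rlim F t \<le> F u"
  unfolding rlim_def using assms F
  by (intro cINF_lower bdd_belowI2[where m = "F t"]) (auto simp: mono_on_def)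

lemma rlim_ge:
  assumes "0 \<le> t"
  shows "F t \<le> rlim F t"
  unfolding rlim_def using assms F
  by (intro cINF_greatest) (auto simp: mono_on_def)

lemma rlim_less:
  assumes "0 \<le> t" "rlim F t < c"
  obtains u where "t < u" "F u < c"
  using cInf_lessD[of "F ` {t<..}" c] assms by (auto simp: rlim_def)

lemma rlim_right:
  assumes "0 \<le> t" "rlim F t < c"
  obtains u where "t < u" "rlim F u < c"
proof -
  obtain u where u: "t < u" "F u < c" using rlim_less assms by blast
  have "rlim F ((t+u)/2) \<le> F u" using u assms by (intro rlim_le) auto
  then show ?thesis using that[of "(t+u)/2"] u by auto
qed

text \<open>As z is right-continuous, both endpoints can be approached from the right: first the
  left one, with the right one fixed at some u > t, then the right one.\<close>

lemma pcontrol_rlim: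
  assumes pc: "pcontrol p {0..} z F" and p: "p > 0"
    and z: "\<And>t. t \<ge> 0 \<Longrightarrow> (z \<longlongrightarrow> z t) (at_right t)"
  shows "pcontrol p {0..} z (rlim F)"
  unfolding pcontrol_def
proof (intro ballI impI)
  fix s t :: real assume "s \<in> {0..}" "t \<in> {0..}" "s \<le> t"
  then have st: "0 \<le> s" "s \<le> t" by auto
  show "norm (z t - z s) powr p \<le> rlim F t - rlim F s"
  proof (cases "s = t")
    case False
    then have lt: "s < t" using st by simp
    have 1: "norm (z u - z s) powr p \<le> F u - rlim F s" if u: "u > t" for u
    proof -
      have "((\<lambda>r. norm (z u - z r) powr p) \<longlongrightarrow> norm (z u - z s) powr p) (at_right s)"
        using z[of s] st p by (intro tendsto_intros) auto
      moreover have "eventually (\<lambda>r. norm (z u - z r) powr p \<le> F u - rlim F s) (at_right s)"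
      proof -
        have "norm (z u - z r) powr p \<le> F u - rlim F s" if "s < r" "r < t" for r
          using pcontrolD[OF pc, of r u] rlim_le[of s r] that st u by auto
        then show ?thesis using lt by (subst eventually_at_right[OF lt]) auto
      qed
      ultimately show ?thesis by (rule tendsto_upperbound) simp
    qed
    have "norm (z t - z s) powr p + rlim F s \<le> c" if c: "c > rlim F t" for c
    proof -
      obtain w where w: "t < w" "F w < c" using rlim_less[of t c] c st by auto
      have "((\<lambda>r. norm (z r - z s) powr p + rlim F s) \<longlongrightarrow> norm (z t - z s) powr p + rlim F s) (at_right t)"
        using z[of t] st p by (intro tendsto_intros) auto
      moreover have "eventually (\<lambda>r. norm (z r - z s) powr p + rlim F s \<le> c) (at_right t)"
      proof -
        have "norm (z r - z s) powr p + rlim F s \<le> c" if "t < r" "r < w" for r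
          using 1[of r] that w F st mono_onD[OF F, of r w] by auto
        then show ?thesis using w by (subst eventually_at_right[OF w(1)]) auto
      qed
      ultimately show ?thesis by (rule tendsto_upperbound) simp
    qed
    then show ?thesis using dense_ge[of "rlim F t" "norm (z t - z s) powr p + rlim F s"] by simp
  qed (use p in simp)
qed

end

subsection \<open>Cadlag paths and locally uniform convergence\<close>

text \<open>Two points lie in the same piece \<open>[s, s')\<close> of the partition given by \<open>S\<close> exactly if
  \<open>S \<inter> {u<..v} = {}\<close>.\<close>

lemma cadlag_partition:
  fixes x :: "real \<Rightarrow> 'a::metric_space"
  assumes x: "cadlag x" and T: "0 \<le> T" and e: "e > 0"
  obtains S where "finite S"
    "\<And>u v. 0 \<le> u \<Longrightarrow> u \<le> v \<Longrightarrow> v \<le> T \<Longrightarrow> S \<inter> {u<..v} = {} \<Longrightarrow> dist (x u) (x v) \<le> e"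
proof -
  define P where "P a b \<longleftrightarrow> (\<exists>S. finite S \<and> (\<forall>u v. 0 \<le> u \<longrightarrow> a \<le> u \<longrightarrow> u \<le> v \<longrightarrow> v \<le> b \<longrightarrow> S \<inter> {u<..v} = {} \<longrightarrow> dist (x u) (x v) \<le> e))" for a b :: real
  have "P 0 T"
    using T
  proof (induction rule: Bolzano)
    case (trans a b c)
    obtain S1 where S1: "finite S1" "\<And>u v. 0 \<le> u \<Longrightarrow> a \<le> u \<Longrightarrow> u \<le> v \<Longrightarrow> v \<le> b \<Longrightarrow> S1 \<inter> {u<..v} = {} \<Longrightarrow> dist (x u) (x v) \<le> e"
      using trans unfolding P_def by blast
    obtain S2 where S2: "finite S2" "\<And>u v. 0 \<le> u \<Longrightarrow> b \<le> u \<Longrightarrow> u \<le> v \<Longrightarrow> v \<le> c \<Longrightarrow> S2 \<inter> {u<..v} = {} \<Longrightarrow> dist (x u) (x v) \<le> e"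
      using trans unfolding P_def by blast
    show ?case unfolding P_def
    proof (intro exI[of _ "insert b (S1 \<union> S2)"] conjI allI impI)
      fix u v assume *: "0 \<le> u" "a \<le> u" "u \<le> v" "v \<le> c" "insert b (S1 \<union> S2) \<inter> {u<..v} = {}"
      then have "v \<le> b \<or> b \<le> u" by auto
      then show "dist (x u) (x v) \<le> e" using S1(2)[of u v] S2(2)[of u v] * by auto
    qed (use S1 S2 in auto)
  next
    case (local t)
    have "(x \<longlongrightarrow> x t) (at_right t)" using x local by (auto simp: cadlag_def)
    then have "eventually (\<lambda>r. dist (x r) (x t) < e/2) (at_right t)"
      by (rule tendstoD) (use e in simp)
    then obtain b where b: "b > t" "\<And>r. t < r \<Longrightarrow> r < b \<Longrightarrow> dist (x r) (x t) < e/2"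
      by (auto simp: eventually_at_right[OF less_add_one])
    have R: "dist (x u) (x v) \<le> e" if "t \<le> u" "t \<le> v" "u < b" "v < b" for u v
    proof -
      have "dist (x u) (x t) \<le> e/2" using b(2)[of u] that e by (cases "u = t") auto
      moreover have "dist (x v) (x t) \<le> e/2" using b(2)[of v] that e by (cases "v = t") auto
      ultimately show ?thesis using dist_triangle2[of "x u" "x v" "x t"] by linarith
    qed
    obtain c where c: "c < t" "\<And>u v. 0 \<le> u \<Longrightarrow> 0 \<le> v \<Longrightarrow> c < u \<Longrightarrow> u < t \<Longrightarrow> c < v \<Longrightarrow> v < t \<Longrightarrow> dist (x u) (x v) \<le> e"
    proof (cases "t > 0")
      case True
      then obtain l where "(x \<longlongrightarrow> l) (at_left t)" using x by (auto simp: cadlag_def)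
      then have "eventually (\<lambda>r. dist (x r) l < e/2) (at_left t)"
        by (rule tendstoD) (use e in simp)
      then obtain c where c: "c < t" "\<And>r. c < r \<Longrightarrow> r < t \<Longrightarrow> dist (x r) l < e/2"
        using eventually_at_left[of "t - 1" t] by auto
      have "dist (x u) (x v) \<le> e" if "c < u" "u < t" "c < v" "v < t" for u v
        using c(2)[of u] c(2)[of v] that dist_triangle2[of "x u" "x v" l] by simp
      then show ?thesis using c(1) that by blast
    next
      \<comment> \<open>Here t = 0, where no left limit is given. No admissible u < t exists, so the
        claim on the left side is vacuous.\<close>
      case False
      then show ?thesis using that[of "t - 1"] by auto
    qed
    define d where "d = min (b - t) (t - c)"
    have "P r s" if "r \<le> t" "t \<le> s" "s - r < d" for r s
      unfolding P_def
    proof (intro exI[of _ "{t}"] conjI allI impI)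
      fix u v assume *: "0 \<le> u" "r \<le> u" "u \<le> v" "v \<le> s" "{t} \<inter> {u<..v} = {}"
      then have "v < t \<or> t \<le> u" by auto
      then show "dist (x u) (x v) \<le> e"
        using R[of u v] c(2)[of u v] * that by (auto simp: d_def)
    qed simp
    moreover have "d > 0" using b c by (simp add: d_def)
    ultimately show ?case by blast
  qed
  then show ?thesis using that unfolding P_def by blast
qed

text \<open>Each piece of the partition is represented by its left endpoint, one of finitely many
  points. Uniform statements on [0,T] reduce to these points plus the oscillation on the
  pieces.\<close>

lemma partition_left_point:
  fixes S :: "real set"
  assumes "finite S" "0 \<le> t"
  obtains s where "s \<in> insert 0 (S \<inter> {0..})" "s \<le> t" "S \<inter> {s<..t} = {}"
proof -
  let ?R = "{s \<in> insert 0 (S \<inter> {0..}). s \<le> t}"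
  have fin: "finite ?R" and "0 \<in> ?R" using assms by auto
  then have "Max ?R \<in> ?R" by (intro Max_in) auto
  moreover have "S \<inter> {Max ?R<..t} = {}"
  proof -
    have "s \<le> Max ?R" if "s \<in> S" "s \<le> t" "0 \<le> s" for s using that fin by (intro Max_ge) auto
    moreover have "0 \<le> Max ?R" using fin assms by (intro Max_ge) auto
    ultimately show ?thesis by fastforce
  qed
  ultimately show ?thesis using that by auto
qed

lemma cadlag_bounded:
  fixes x :: "real \<Rightarrow> 'a::real_normed_vector"
  assumes x: "cadlag x"
  obtains B where "B \<ge> 0" "\<And>t. 0 \<le> t \<Longrightarrow> t \<le> T \<Longrightarrow> norm (x t) \<le> B"
proof (cases "T \<ge> 0")
  case True
  obtain S where S: "finite S"
    "\<And>u v. 0 \<le> u \<Longrightarrow> u \<le> v \<Longrightarrow> v \<le> T \<Longrightarrow> S \<inter> {u<..v} = {} \<Longrightarrow> dist (x u) (x v) \<le> 1"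
    using cadlag_partition[OF x True, of 1] by auto
  let ?R = "insert 0 (S \<inter> {0..})"
  let ?B = "Max ((\<lambda>s. norm (x s)) ` ?R) + 1"
  have B: "norm (x s) + 1 \<le> ?B" if "s \<in> ?R" for s using S that by auto
  show ?thesis
  proof (rule that[of ?B])
    show "0 \<le> ?B" using B[of 0] by (smt (verit) insertI1 norm_ge_zero)
    fix t assume t: "0 \<le> t" "t \<le> T"
    obtain s where s: "s \<in> ?R" "s \<le> t" "S \<inter> {s<..t} = {}" using partition_left_point[OF S(1) t(1)] by blast
    then have "dist (x s) (x t) \<le> 1" using t by (intro S(2)) auto
    then have "norm (x t) \<le> norm (x s) + 1"
      using norm_triangle_ineq2[of "x t" "x s"] by (simp add: dist_norm norm_minus_commute)
    then show "norm (x t) \<le> ?B" using B[OF s(1)] by linarith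
  qed
next
  case False
  then show ?thesis using that[of 0] by auto
qed

definition lu_conv :: "(nat \<Rightarrow> real \<Rightarrow> 'a::metric_space) \<Rightarrow> (real \<Rightarrow> 'a) \<Rightarrow> bool" where
  "lu_conv xs x \<longleftrightarrow> (\<forall>T. uniform_limit {0..T} xs x sequentially)"

lemma lu_convD:
  assumes "lu_conv xs x" "e > 0"
  obtains N where "\<And>n t. n \<ge> N \<Longrightarrow> 0 \<le> t \<Longrightarrow> t \<le> T \<Longrightarrow> dist (xs n t) (x t) < e"
  using assms unfolding lu_conv_def uniform_limit_sequentially_iff by (metis atLeastAtMost_iff)

lemma lu_convI:
  assumes "\<And>T e. 0 \<le> T \<Longrightarrow> e > 0 \<Longrightarrow> \<exists>N. \<forall>n\<ge>N. \<forall>t. 0 \<le> t \<longrightarrow> t \<le> T \<longrightarrow> dist (xs n t) (x t) < e"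
  shows "lu_conv xs x"
  unfolding lu_conv_def uniform_limit_sequentially_iff
proof (intro allI impI)
  fix T e :: real assume e: "e > 0"
  show "\<exists>N. \<forall>n\<ge>N. \<forall>t\<in>{0..T}. dist (xs n t) (x t) < e"
  proof (cases "T \<ge> 0")
    case True
    show ?thesis using assms[OF True e] by (meson atLeastAtMost_iff)
  qed auto
qed

lemma lu_conv_tendsto: "lu_conv xs x \<Longrightarrow> t \<ge> 0 \<Longrightarrow> (\<lambda>n. xs n t) \<longlonglongrightarrow> x t"
  unfolding lu_conv_def by (rule tendsto_uniform_limitI[where S = "{0..t}"]) auto

lemma lu_conv_subseq:
  assumes "lu_conv xs x" "strict_mono r"
  shows "lu_conv (\<lambda>n. xs (r n)) x"
proof (rule lu_convI)
  fix T e :: real assume "e > 0"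
  then obtain N where N: "\<And>n t. n \<ge> N \<Longrightarrow> 0 \<le> t \<Longrightarrow> t \<le> T \<Longrightarrow> dist (xs n t) (x t) < e"
    using lu_convD[OF assms(1), where T = T] by blast
  have "r n \<ge> N" if "n \<ge> N" for n using that seq_suble[OF assms(2), of n] by linarith
  then show "\<exists>N. \<forall>n\<ge>N. \<forall>t. 0 \<le> t \<longrightarrow> t \<le> T \<longrightarrow> dist (xs (r n) t) (x t) < e"
    using N by (intro exI[of _ N]) auto
qed

lemma lu_conv_add:
  fixes xs :: "nat \<Rightarrow> real \<Rightarrow> 'a::real_normed_vector"
  shows "lu_conv xs x \<Longrightarrow> lu_conv ys y \<Longrightarrow> lu_conv (\<lambda>n t. xs n t + ys n t) (\<lambda>t. x t + y t)"
  unfolding lu_conv_def by (auto intro: uniform_limit_add)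

lemma lu_conv_minus:
  fixes xs :: "nat \<Rightarrow> real \<Rightarrow> 'a::real_normed_vector"
  shows "lu_conv xs x \<Longrightarrow> lu_conv ys y \<Longrightarrow> lu_conv (\<lambda>n t. xs n t - ys n t) (\<lambda>t. x t - y t)"
  unfolding lu_conv_def by (auto intro: uniform_limit_minus)

lemma lu_conv_const:
  assumes "c \<longlonglongrightarrow> l"
  shows "lu_conv (\<lambda>n t. c n) (\<lambda>t. l)"
  using assms unfolding lu_conv_def uniform_limit_iff tendsto_iff by (auto elim: eventually_mono)

text \<open>The limits g n along G form a Cauchy sequence, since uniform closeness passes to limits,
  and completeness supplies l. It serves the left limits of a limit path, for which no candidate
  value is at hand.\<close>

lemma uniform_limit_tendsto:
  fixes f :: "nat \<Rightarrow> real \<Rightarrow> 'a::complete_space"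
  assumes uc: "uniform_limit S f h sequentially" and G: "\<not> trivial_limit G"
    and ev: "eventually (\<lambda>x. x \<in> S) G" and f: "\<And>n. (f n \<longlongrightarrow> g n) G"
  shows "\<exists>l. (h \<longlongrightarrow> l) G"
proof -
  have "Cauchy g"
  proof (rule metric_CauchyI)
    fix e :: real assume "e > 0"
    then obtain N where N: "\<And>n x. n \<ge> N \<Longrightarrow> x \<in> S \<Longrightarrow> dist (f n x) (h x) < e/4"
      using uc unfolding uniform_limit_sequentially_iff by (metis divide_pos_pos zero_less_numeral)
    have "dist (g m) (g n) < e" if mn: "m \<ge> N" "n \<ge> N" for m n
    proof -
      have "((\<lambda>x. dist (f m x) (f n x)) \<longlongrightarrow> dist (g m) (g n)) G" using f by (intro tendsto_intros)
      moreover have "eventually (\<lambda>x. dist (f m x) (f n x) \<le> e/2) G"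
      proof (rule eventually_mono[OF ev])
        fix x assume "x \<in> S"
        then show "dist (f m x) (f n x) \<le> e/2"
          using N[OF mn(1)] N[OF mn(2)] dist_triangle2[of "f m x" "f n x" "h x"] by force
      qed
      ultimately have "dist (g m) (g n) \<le> e/2" using G by (rule tendsto_upperbound)
      then show ?thesis using \<open>e > 0\<close> by simp
    qed
    then show "\<exists>N. \<forall>m\<ge>N. \<forall>n\<ge>N. dist (g m) (g n) < e" by blast
  qed
  then obtain l where "g \<longlonglongrightarrow> l" by (auto simp: Cauchy_convergent_iff convergent_def)
  then have "(h \<longlongrightarrow> l) G"
    using swap_uniform_limit'[of f g G sequentially l S h] f uc ev by simp
  then show ?thesis by blast
qed

lemma cadlag_lu_limit:
  fixes xs :: "nat \<Rightarrow> real \<Rightarrow> 'a::complete_space"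
  assumes "lu_conv xs x" "\<And>n. cadlag (xs n)"
  shows "cadlag x"
  unfolding cadlag_def
proof (intro conjI allI impI)
  fix t :: real assume t: "t \<ge> 0"
  have "eventually (\<lambda>r. r \<in> {0..t+1}) (at_right t)"
    using t by (subst eventually_at_right[of t "t+1"]) (auto intro!: exI[of _ "t+1"])
  then show "(x \<longlongrightarrow> x t) (at_right t)"
    using swap_uniform_limit'[of xs "\<lambda>n. xs n t" "at_right t" sequentially "x t" "{0..t+1}" x]
      assms t lu_conv_tendsto[OF assms(1) t] by (auto simp: cadlag_def lu_conv_def)
next
  fix t :: real assume t: "t > 0"
  have ev: "eventually (\<lambda>r. r \<in> {0..t}) (at_left t)"
    using t by (subst eventually_at_left[of 0 t]) auto
  have "\<forall>n. \<exists>L. (xs n \<longlongrightarrow> L) (at_left t)" using assms(2) t unfolding cadlag_def by blast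
  then obtain g where "\<And>n. (xs n \<longlongrightarrow> g n) (at_left t)" by metis
  then show "\<exists>L. (x \<longlongrightarrow> L) (at_left t)"
    using uniform_limit_tendsto[where S = "{0..t}" and f = xs and h = x and G = "at_left t" and g = g] ev assms(1) by (auto simp: lu_conv_def)
qed

section \<open>Diagonal extraction and an Ascoli theorem for regulated paths\<close>

lemma pointwise_convergent_subseq:
  fixes Y :: "nat \<Rightarrow> 'b \<Rightarrow> 'e::heine_borel"
  assumes D: "countable D" and bnd: "\<And>t. t \<in> D \<Longrightarrow> bounded (range (\<lambda>n. Y n t))"
  obtains r where "strict_mono (r :: nat \<Rightarrow> nat)" "\<And>t. t \<in> D \<Longrightarrow> convergent (\<lambda>n. Y (r n) t)"
proof (cases "D = {}")
  case True
  then show ?thesis using that[of id] by (simp add: strict_mono_id)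
next
  case False
  define d where "d = from_nat_into D"
  have d: "range d = D" using D False by (simp add: d_def range_from_nat_into)
  interpret subseqs "\<lambda>i r. convergent (\<lambda>n. Y (r n) (d i))"
  proof
    fix i and s :: "nat \<Rightarrow> nat"
    have "bounded (range (\<lambda>n. Y (s n) (d i)))"
      using bnd[of "d i"] d by (rule_tac bounded_subset) auto
    then obtain l r where "strict_mono r" "((\<lambda>n. Y (s n) (d i)) \<circ> r) \<longlonglongrightarrow> l"
      using bounded_imp_convergent_subsequence by blast
    then show "\<exists>r'. strict_mono r' \<and> convergent (\<lambda>n. Y ((s \<circ> r') n) (d i))"
      by (auto simp: convergent_def o_def)
  qed
  have "convergent (\<lambda>n. Y (diagseq n) (d i))" for i
  proof -
    \<comment> \<open>The diagonal sequence is a subsequence of the i-th extracted one only from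
      index \<open>Suc i\<close> on.\<close>
    have "convergent (\<lambda>n. Y ((diagseq \<circ> ((+) (Suc i))) n) (d i))"
    proof (rule diagseq_holds)
      fix r s :: "nat \<Rightarrow> nat" and n
      assume "strict_mono r" "convergent (\<lambda>m. Y (s m) (d n))"
      then show "convergent (\<lambda>m. Y ((s \<circ> r) m) (d n))"
        using convergent_subseq_convergent[of "\<lambda>m. Y (s m) (d n)" r] by (simp add: o_def)
    qed
    then have "convergent (\<lambda>n. Y (diagseq (n + Suc i)) (d i))" by (simp add: o_def add.commute)
    then show ?thesis by (simp only: convergent_ignore_initial_segment[of "\<lambda>n. Y (diagseq n) (d i)" "Suc i"])
  qed
  then show ?thesis using that[OF subseq_diagseq] d by blast
qed

lemma regulated_Ascoli:
  fixes Y :: "nat \<Rightarrow> real \<Rightarrow> 'e::{heine_borel,complete_space}"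
  assumes bnd: "\<And>t. t \<ge> 0 \<Longrightarrow> bounded (range (\<lambda>n. Y n t))"
    and osc: "\<And>T e. 0 \<le> T \<Longrightarrow> e > 0 \<Longrightarrow> \<exists>S N. finite S \<and> (\<forall>n\<ge>N. \<forall>u v. 0 \<le> u \<longrightarrow> u \<le> v \<longrightarrow> v \<le> T \<longrightarrow>
            S \<inter> {u<..v} = {} \<longrightarrow> dist (Y n u) (Y n v) \<le> e)"
  obtains r Y0 where "strict_mono (r :: nat \<Rightarrow> nat)" "lu_conv (\<lambda>n. Y (r n)) Y0"
proof -
  have "\<forall>k. \<exists>S N. finite S \<and> (\<forall>n\<ge>N. \<forall>u v. 0 \<le> u \<longrightarrow> u \<le> v \<longrightarrow> v \<le> real k \<longrightarrow>
            S \<inter> {u<..v} = {} \<longrightarrow> dist (Y n u) (Y n v) \<le> 1 / (real k + 1))"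
    using osc[of "real k" "1 / (real k + 1)" for k] by simp
  then obtain S N where S: "\<And>k. finite (S k)"
    and N: "\<And>k n u v. n \<ge> N k \<Longrightarrow> 0 \<le> u \<Longrightarrow> u \<le> v \<Longrightarrow> v \<le> real k \<Longrightarrow>
            S k \<inter> {u<..v} = {} \<Longrightarrow> dist (Y n u) (Y n v) \<le> 1 / (real k + 1)"
    by metis
  define D where "D = insert 0 ((\<Union>k. S k) \<inter> {0..})"
  have "countable D" unfolding D_def using S by (intro countable_insert countable_Int1 countable_UN) (auto simp: countable_finite)
  then obtain r where r: "strict_mono r" "\<And>t. t \<in> D \<Longrightarrow> convergent (\<lambda>n. Y (r n) t)"
    using pointwise_convergent_subseq[of D Y] bnd by (auto simp: D_def)
  have "uniformly_Cauchy_on {0..T} (\<lambda>n. Y (r n))" for T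
  proof (rule uniformly_Cauchy_onI)
    fix e :: real assume e: "e > 0"
    obtain k where k: "real k \<ge> T" "real k + 1 > 4 / e"
    proof -
      obtain k where "real k \<ge> max T (4/e)" using real_arch_simple by blast
      then show ?thesis using that[of k] by auto
    qed
    have ke: "1 / (real k + 1) < e / 4" using k e by (simp add: field_simps)
    let ?R = "insert 0 (S k \<inter> {0..})"
    have "\<forall>s\<in>?R. \<exists>M. \<forall>m\<ge>M. \<forall>n\<ge>M. dist (Y (r m) s) (Y (r n) s) < e/4"
    proof
      fix s assume "s \<in> ?R"
      then have "Cauchy (\<lambda>n. Y (r n) s)" using r(2)[of s] by (auto simp: D_def Cauchy_convergent_iff)
      then show "\<exists>M. \<forall>m\<ge>M. \<forall>n\<ge>M. dist (Y (r m) s) (Y (r n) s) < e/4"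
        using e by (intro metric_CauchyD) auto
    qed
    then obtain M where M: "\<And>s m n. s \<in> ?R \<Longrightarrow> m \<ge> M s \<Longrightarrow> n \<ge> M s \<Longrightarrow> dist (Y (r m) s) (Y (r n) s) < e/4"
      by metis
    define M' where "M' = max (N k) (Max (M ` ?R))"
    have M': "M s \<le> M'" if "s \<in> ?R" for s
    proof -
      have "M s \<le> Max (M ` ?R)" using that S by (intro Max_ge) auto
      then show ?thesis by (simp add: M'_def)
    qed
    have "dist (Y (r m) t) (Y (r n) t) < e" if t: "t \<in> {0..T}" and mn: "m \<ge> M'" "n \<ge> M'" for t m n
    proof -
      obtain s where s: "s \<in> ?R" "s \<le> t" "S k \<inter> {s<..t} = {}"
        using partition_left_point[OF S[of k], of t] t by auto
      have rN: "r i \<ge> N k" if "i \<ge> M'" for i using seq_suble[OF r(1), of i] that by (simp add: M'_def)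
      have 1: "dist (Y (r i) s) (Y (r i) t) \<le> 1 / (real k + 1)" if "i \<ge> M'" for i
        using N[of k "r i" s t] rN[OF that] s t k by auto
      have "dist (Y (r m) s) (Y (r n) s) < e/4"
        using M[OF s(1), of m n] M'[OF s(1)] mn by simp
      then show ?thesis
        using e 1[OF mn(1)] 1[OF mn(2)] ke dist_triangle3[of "Y (r m) t" "Y (r n) t" "Y (r m) s"]
          dist_triangle[of "Y (r m) s" "Y (r n) t" "Y (r n) s"] by linarith
    qed
    then show "\<exists>M. \<forall>x\<in>{0..T}. \<forall>m\<ge>M. \<forall>n\<ge>M. dist (Y (r m) x) (Y (r n) x) < e" by blast
  qed
  then have "uniform_limit {0..T} (\<lambda>n. Y (r n)) (\<lambda>x. lim (\<lambda>n. Y (r n) x)) sequentially" for T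
    using Cauchy_uniformly_convergent uniformly_convergent_uniform_limit_iff by blast
  then have "lu_conv (\<lambda>n. Y (r n)) (\<lambda>x. lim (\<lambda>n. Y (r n) x))" by (simp add: lu_conv_def)
  then show ?thesis using that r by blast
qed

subsection \<open>The one-dimensional Skorokhod problem\<close>

text \<open>The solution \<open>k t = max 0 (SUP s\<in>{0..t}. w s)\<close> of the Skorokhod problem with \<open>w = l - y\<close>,
  expressed without a supremum so that it passes to limits and time changes directly.\<close>

definition skor :: "(real \<Rightarrow> real) \<Rightarrow> (real \<Rightarrow> real) \<Rightarrow> bool" where
  "skor w k \<longleftrightarrow> mono_on {0..} k \<and> (\<forall>t\<ge>0. 0 \<le> k t \<and> w t \<le> k t) \<and>
     (\<forall>t\<ge>0. \<forall>e>0. k t < e \<or> (\<exists>s\<in>{0..t}. k t - e < w s))"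

lemma skorD:
  assumes "skor w k"
  shows "\<And>s t. 0 \<le> s \<Longrightarrow> s \<le> t \<Longrightarrow> k s \<le> k t"
    and "\<And>t. t \<ge> 0 \<Longrightarrow> 0 \<le> k t" "\<And>t. t \<ge> 0 \<Longrightarrow> w t \<le> k t"
    and "\<And>t e. t \<ge> 0 \<Longrightarrow> e > 0 \<Longrightarrow> k t < e \<or> (\<exists>s\<in>{0..t}. k t - e < w s)"
  using assms by (auto simp: skor_def mono_on_def)

text \<open>The running maximum with floor 0 is 1-Lipschitz in the supremum norm: where one input
  nearly attains its maximum, the other is smaller by at most d.\<close>

lemma skor_stable:
  assumes k: "skor w k" and k': "skor w' k'"
    and d: "\<And>s. 0 \<le> s \<Longrightarrow> s \<le> t \<Longrightarrow> \<bar>w s - w' s\<bar> \<le> d" and t: "t \<ge> 0"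
  shows "\<bar>k t - k' t\<bar> \<le> d"
proof -
  have d0: "d \<ge> 0" using d[of t] t by linarith
  have *: "a t \<le> b t + d" if su: "skor u a" and sv: "skor v b"
      and uv: "\<And>s. 0 \<le> s \<Longrightarrow> s \<le> t \<Longrightarrow> \<bar>u s - v s\<bar> \<le> d" for u v a b
  proof (rule field_le_epsilon)
    fix e :: real assume e: "e > 0"
    consider "a t < e" | s where "0 \<le> s" "s \<le> t" "a t - e < u s"
      using skorD(4)[OF su t e] by auto
    then show "a t \<le> b t + d + e"
    proof cases
      case 1 then show ?thesis using skorD(2)[OF sv t] d0 by linarith
    next
      case 2
      have "u s \<le> v s + d" using uv[OF 2(1,2)] by linarith
      also have "v s \<le> b s" using skorD(3)[OF sv 2(1)] .
      also have "b s \<le> b t" using skorD(1)[OF sv 2(1,2)] .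
      finally show ?thesis using 2(3) by linarith
    qed
  qed
  have "\<bar>w' s - w s\<bar> \<le> d" if "0 \<le> s" "s \<le> t" for s using d[OF that] by linarith
  from *[OF k k' d] *[OF k' k this] show ?thesis by linarith
qed

text \<open>k grows on [u,v] only by what w rises above the level k u already reached, however often
  w oscillates in between.\<close>

lemma skor_increment:
  assumes k: "skor w k" and u: "0 \<le> u" "u \<le> v" and d: "d \<ge> 0"
    "\<And>s. u \<le> s \<Longrightarrow> s \<le> v \<Longrightarrow> w s - k u \<le> d"
  shows "k v - k u \<le> d"
proof -
  have "k v \<le> k u + d"
  proof (rule field_le_epsilon)
    fix e :: real assume e: "e > 0"
    consider "k v < e" | s where "0 \<le> s" "s \<le> v" "k v - e < w s"
      using skorD(4)[OF k _ e, of v] u by auto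
    then show "k v \<le> k u + d + e"
    proof cases
      case 1 then show ?thesis using skorD(2)[OF k u(1)] d by linarith
    next
      case 2
      show ?thesis
      proof (cases "s \<le> u")
        case True
        then have "w s \<le> k u" using skorD(3)[OF k 2(1)] skorD(1)[OF k 2(1) True] by linarith
        then show ?thesis using 2 d by linarith
      next
        case False
        then show ?thesis using d(2)[of s] 2 by auto
      qed
    qed
  qed
  then show ?thesis by linarith
qed

text \<open>{0..lam t} is the image of {0..t}, so points where w nearly attains its maximum can be
  pulled back.\<close>

lemma skor_compose:
  assumes "skor w k" "time_change lam"
  shows "skor (w \<circ> lam) (k \<circ> lam)"
proof -
  have sm: "strict_mono_on {0..} lam" and im: "lam ` {0..} = {0..}"
    using assms(2) by (auto simp: time_change_def)
  have pos: "lam t \<ge> 0" if "t \<ge> 0" for t using im that by auto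
  have mono: "lam s \<le> lam t" if "0 \<le> s" "s \<le> t" for s t
    using strict_mono_on_leD[OF sm, of s t] that by auto
  have *: "\<exists>r\<in>{0..t}. lam r = s" if "0 \<le> s" "s \<le> lam t" "t \<ge> 0" for s t
  proof -
    have "s \<in> lam ` {0..}" using im that by simp
    then obtain r where r: "r \<ge> 0" "lam r = s" by auto
    have "r \<le> t"
    proof (rule ccontr)
      assume "\<not> r \<le> t"
      then have "lam t < lam r" using strict_mono_onD[OF sm, of t r] that r by auto
      then show False using r that by linarith
    qed
    then show ?thesis using r by auto
  qed
  show ?thesis
    unfolding skor_def
  proof (intro conjI allI impI mono_onI)
    fix t e :: real assume t: "0 \<le> t" and e: "0 < e"
    show "(k \<circ> lam) t < e \<or> (\<exists>s\<in>{0..t}. (k \<circ> lam) t - e < (w \<circ> lam) s)"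
      using skorD(4)[OF assms(1) pos[OF t] e] *[of _ t] t by fastforce
  qed (use skorD[OF assms(1)] pos mono in auto)
qed

text \<open>By \<open>skor_stable\<close> the k n are locally uniformly Cauchy: the reflection terms
  converge as soon as their inputs do.\<close>

lemma skor_limit:
  assumes k: "\<And>n. skor (w n) (k n)" and w: "lu_conv w w0"
  obtains k0 where "lu_conv k k0" "skor w0 k0"
proof -
  have "uniformly_Cauchy_on {0..T} k" for T
  proof (rule uniformly_Cauchy_onI)
    fix e :: real assume "e > 0"
    then obtain N where N: "\<And>n t. n \<ge> N \<Longrightarrow> 0 \<le> t \<Longrightarrow> t \<le> T \<Longrightarrow> dist (w n t) (w0 t) < e/3"
      using lu_convD[OF w, of "e/3" T] by auto
    have "dist (k m t) (k n t) < e" if "t \<in> {0..T}" "m \<ge> N" "n \<ge> N" for t m n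
    proof -
      have "\<bar>k m t - k n t\<bar> \<le> 2 * e / 3"
      proof (rule skor_stable[OF k k])
        fix s assume "0 \<le> s" "s \<le> t"
        then show "\<bar>w m s - w n s\<bar> \<le> 2 * e / 3"
          using N[of m s] N[of n s] that unfolding dist_real_def atLeastAtMost_iff by argo
      qed (use that in auto)
      then show ?thesis using \<open>e > 0\<close> by (simp add: dist_real_def)
    qed
    then show "\<exists>M. \<forall>x\<in>{0..T}. \<forall>m\<ge>M. \<forall>n\<ge>M. dist (k m x) (k n x) < e" by blast
  qed
  then have "uniform_limit {0..T} k (\<lambda>x. lim (\<lambda>n. k n x)) sequentially" for T
    using Cauchy_uniformly_convergent uniformly_convergent_uniform_limit_iff by blast
  then obtain k0 where k0: "lu_conv k k0" using lu_conv_def by blast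
  have lim: "(\<lambda>n. k n t) \<longlonglongrightarrow> k0 t" "(\<lambda>n. w n t) \<longlonglongrightarrow> w0 t" if "t \<ge> 0" for t
    using lu_conv_tendsto[OF k0 that] lu_conv_tendsto[OF w that] by auto
  have "skor w0 k0"
    unfolding skor_def
  proof (intro conjI allI impI mono_onI)
    show "0 \<le> k0 t" if "0 \<le> t" for t
      using LIMSEQ_le_const[OF lim(1)[OF that]] skorD(2)[OF k that] by auto
    show "w0 t \<le> k0 t" if "0 \<le> t" for t
      using LIMSEQ_le[OF lim(2)[OF that] lim(1)[OF that]] skorD(3)[OF k that] by auto
    show "k0 s \<le> k0 t" if "s \<in> {0..}" "t \<in> {0..}" "s \<le> t" for s t
      using LIMSEQ_le[OF lim(1)[of s] lim(1)[of t]] skorD(1)[OF k, of s t] that by auto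
    fix t e :: real assume t: "0 \<le> t" and e: "0 < e"
    obtain N1 where N1: "\<And>n s. n \<ge> N1 \<Longrightarrow> 0 \<le> s \<Longrightarrow> s \<le> t \<Longrightarrow> dist (w n s) (w0 s) < e/3"
      using lu_convD[OF w, of "e/3" t] e by auto
    obtain N2 where N2: "\<And>n s. n \<ge> N2 \<Longrightarrow> 0 \<le> s \<Longrightarrow> s \<le> t \<Longrightarrow> dist (k n s) (k0 s) < e/3"
      using lu_convD[OF k0, of "e/3" t] e by auto
    define n where "n = max N1 N2"
    have kn: "\<bar>k n t - k0 t\<bar> < e/3" using N2[of n t] t by (auto simp: n_def dist_real_def)
    consider "k n t < e/3" | s where "0 \<le> s" "s \<le> t" "k n t - e/3 < w n s"
      using skorD(4)[OF k t, of "e/3" n] e by auto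
    then show "k0 t < e \<or> (\<exists>s\<in>{0..t}. k0 t - e < w0 s)"
    proof cases
      case 1 then show ?thesis using kn by linarith
    next
      case 2
      have "\<bar>w n s - w0 s\<bar> < e/3" using N1[of n s] 2 by (auto simp: n_def dist_real_def)
      then have "k0 t - e < w0 s" using 2 kn by linarith
      then show ?thesis using 2 by auto
    qed
  qed
  then show ?thesis using that k0 by blast
qed

section \<open>Complementarity as a condition on the Stieltjes measure dk\<close>

context
  fixes k :: "real \<Rightarrow> real"
  assumes k: "mono_on {0..} k" and kr: "\<And>t. t \<ge> 0 \<Longrightarrow> (k \<longlongrightarrow> k t) (at_right t)"
begin

lemma emeasure_Ioc_k:
  assumes "0 \<le> u" "u \<le> v"
  shows "emeasure (interval_measure (\<lambda>s. k (max 0 s))) {u<..v} = ennreal (k v - k u)"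
proof -
  \<comment> \<open>The extension of k by the constant k 0 to negative times has to be
    right-continuous on the whole line before \<open>interval_measure\<close> has the expected
    values.\<close>
  have "continuous (at_right a) (\<lambda>s. k (max 0 s))" for a
  proof (cases "a \<ge> 0")
    case True
    have "eventually (\<lambda>s. k s = k (max 0 s)) (at_right a)"
      using True by (subst eventually_at_right[OF less_add_one]) (auto intro!: exI[of _ "a+1"] simp: max_def)
    then show ?thesis using Lim_transform_eventually[OF kr[OF True]] True
      by (simp add: continuous_within max_def)
  next
    case False
    have "eventually (\<lambda>s. k 0 = k (max 0 s)) (at_right a)"
      using False by (subst eventually_at_right[of a 0]) (auto intro!: exI[of _ 0] simp: max_def)
    then show ?thesis using Lim_transform_eventually[OF tendsto_const[of "k 0"]] False
      by (simp add: continuous_within max_def)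
  qed
  then show ?thesis using emeasure_interval_measure_Ioc[of u v "\<lambda>s. k (max 0 s)"] k assms
    by (auto simp: mono_on_def max_def)
qed

text \<open>Suppose k t exceeds 0 and every w s with s \<le> t by at least e. Where k is above the
  level c = k t - e/2, the gap k - w is above e/2, so dk has no mass there. Below that level dk has
  mass at most c, as k starts at 0. Hence the whole mass k t is at most c, which is absurd.\<close>

lemma interval_measure_imp_skor:
  assumes k0: "k 0 = 0" and w: "\<And>t. t \<ge> 0 \<Longrightarrow> w t \<le> k t"
    and z: "\<And>t. t \<ge> 0 \<Longrightarrow> (\<integral>\<^sup>+ s. ennreal (k s - w s) * indicator {0<..t} s
                    \<partial>interval_measure (\<lambda>s. k (max 0 s))) = 0"
  shows "skor w k"
  unfolding skor_def
proof (intro conjI allI impI)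
  let ?M = "interval_measure (\<lambda>s. k (max 0 s))"
  show "0 \<le> k t" if "0 \<le> t" for t using mono_onD[OF k, of 0 t] k0 that by simp
  fix t e :: real assume t: "0 \<le> t" and e: "0 < e"
  show "k t < e \<or> (\<exists>s\<in>{0..t}. k t - e < w s)"
  proof (rule ccontr)
    assume "\<not> (k t < e \<or> (\<exists>s\<in>{0..t}. k t - e < w s))"
    then have kt: "k t \<ge> e" and ws: "\<And>s. 0 \<le> s \<Longrightarrow> s \<le> t \<Longrightarrow> w s \<le> k t - e" by (auto simp: not_less)
    define c where "c = k t - e/2"
    define D where "D = {s\<in>{0<..t}. k s \<le> c}"
    have c: "c \<ge> 0" using kt e by (simp add: c_def)
    \<comment> \<open>By monotonicity D is an interval starting at 0, with or without its right end
      \<open>\<sigma>\<close>; without it, its mass is found by exhausting it with half-open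
      intervals.\<close>
    have D: "D \<in> sets ?M \<and> emeasure ?M D \<le> ennreal c"
    proof (cases "D = {}")
      case True
      then show ?thesis using c by simp
    next
      case False
      define \<sigma> where "\<sigma> = Sup D"
      have bdd: "bdd_above D" by (auto simp: D_def intro!: bdd_aboveI[of _ t])
      have up: "s \<le> \<sigma>" if "s \<in> D" for s using cSup_upper[OF that bdd] by (simp add: \<sigma>_def)
      have lo: "s \<in> D" if s: "0 < s" "s < \<sigma>" for s
      proof -
        obtain r where r: "r \<in> D" "s < r" using less_cSup_iff[OF False bdd, of s] s unfolding \<sigma>_def by blast
        then have "k s \<le> k r" using mono_onD[OF k, of s r] s by auto
        then show ?thesis using r s by (auto simp: D_def)
      qed
      have s0: "0 < \<sigma>" using False up by (force simp: D_def)
      show ?thesis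
      proof (cases "\<sigma> \<in> D")
        case True
        then have "D = {0<..\<sigma>}" using up lo by (fastforce simp: D_def)
        moreover have "k \<sigma> \<le> c" using True by (simp add: D_def)
        ultimately show ?thesis using emeasure_Ioc_k[of 0 \<sigma>] s0 k0 c by (simp add: ennreal_leI)
      next
        case False
        have De: "D = {0<..<\<sigma>}"
        proof (intro equalityI subsetI)
          fix s assume s: "s \<in> D"
          then have "s \<noteq> \<sigma>" "0 < s" using False by (auto simp: D_def)
          then show "s \<in> {0<..<\<sigma>}" using up[OF s] by simp
        qed (use lo in auto)
        \<comment> \<open>Points increasing to \<open>\<sigma>\<close> but strictly below it; with n
          + 2 in the denominator already v 0 is positive.\<close>
        define v where "v n = \<sigma> * (1 - 1 / (real n + 2))" for n
        have v: "0 < v n" "v n < \<sigma>" for n using s0 by (simp_all add: v_def field_simps add_pos_nonneg)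
        have "incseq (\<lambda>n. {0<..v n})"
        proof (rule incseq_SucI)
          fix n
          have "v n \<le> v (Suc n)"
            unfolding v_def using s0 by (intro mult_left_mono diff_left_mono divide_left_mono) auto
          then show "{0<..v n} \<subseteq> {0<..v (Suc n)}" by auto
        qed
        moreover have "(\<Union>n. {0<..v n}) = {0<..<\<sigma>}"
        proof (intro equalityI subsetI)
          fix s assume s: "s \<in> {0<..<\<sigma>}"
          then obtain n where n: "\<sigma> / (\<sigma> - s) < real n" using reals_Archimedean2 by blast
          have "\<sigma> < real n * (\<sigma> - s)" using n s by (simp add: field_simps)
          also have "\<dots> \<le> (real n + 2) * (\<sigma> - s)" using s by (intro mult_right_mono) auto
          finally have "\<sigma> / (real n + 2) \<le> \<sigma> - s" by (simp add: field_simps)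
          then have "s \<le> v n" by (simp add: v_def right_diff_distrib)
          then show "s \<in> (\<Union>n. {0<..v n})" using s by auto
        qed (use v in \<open>auto intro: le_less_trans\<close>)
        moreover have "range (\<lambda>n. {0<..v n}) \<subseteq> sets ?M" by auto
        ultimately have "emeasure ?M D = (SUP n. emeasure ?M {0<..v n})"
          using SUP_emeasure_incseq[of "\<lambda>n. {0<..v n}" ?M] De by simp
        also have "\<dots> \<le> ennreal c"
        proof (rule SUP_least)
          fix n
          have "v n \<in> D" using v[of n] De by auto
          then show "emeasure ?M {0<..v n} \<le> ennreal c"
            using emeasure_Ioc_k[of 0 "v n"] v(1)[of n] k0 by (auto simp: D_def intro!: ennreal_leI)
        qed
        finally show ?thesis using De by simp
      qed
    qed
    let ?E = "{0<..t} - D"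
    have E: "?E \<in> sets ?M" using D by auto
    have "ennreal (e/2) * emeasure ?M ?E = (\<integral>\<^sup>+ s. ennreal (e/2) * indicator ?E s \<partial>?M)"
      using E by (simp add: nn_integral_cmult_indicator)
    also have "\<dots> \<le> (\<integral>\<^sup>+ s. ennreal (k s - w s) * indicator {0<..t} s \<partial>?M)"
    proof (rule nn_integral_mono)
      fix s
      show "ennreal (e/2) * indicator ?E s \<le> ennreal (k s - w s) * indicator {0<..t} s"
        using ws[of s] by (auto simp: D_def c_def indicator_def intro!: ennreal_leI)
    qed
    also have "\<dots> = 0" using z t by simp
    finally have "emeasure ?M ?E = 0" using e by (simp add: ennreal_eq_0_iff)
    then have "emeasure ?M (D \<union> ?E) \<le> ennreal c + 0"
      using D E emeasure_subadditive[of D ?M ?E] by (metis add_right_mono order_trans)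
    moreover have "D \<union> ?E = {0<..t}" by (auto simp: D_def)
    ultimately have "ennreal (k t) \<le> ennreal c" using emeasure_Ioc_k[of 0 t] t k0 by simp
    then show False using c e by (simp add: c_def)
  qed
qed (use k w in auto)

text \<open>If the gap k - w is positive at s, right-continuity keeps it positive up to some
  rational q > s. The maximum recorded by k q was then attained before s, so k is constant from just
  before s up to q. For fixed q the set of such s is dk-null, and there are countably many
  q.\<close>

lemma skor_imp_interval_measure:
  assumes sk: "skor w k" and w: "\<And>t. t \<ge> 0 \<Longrightarrow> ((\<lambda>s. k s - w s) \<longlongrightarrow> k t - w t) (at_right t)"
  shows "(\<integral>\<^sup>+ s. ennreal (k s - w s) * indicator {0<..t} s \<partial>interval_measure (\<lambda>s. k (max 0 s))) = 0"
proof -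
  let ?M = "interval_measure (\<lambda>s. k (max 0 s))"
  \<comment> \<open>The times s \<le> q at which the left limit of k already equals k q: from s to q
    there is no growth, not even a jump at s.\<close>
  define S where "S q = {s. 0 < s \<and> s \<le> q \<and> (\<forall>e>0. \<exists>u. 0 \<le> u \<and> u < s \<and> k q - e < k u)}" for q
  note K = skorD[OF sk]
  have null: "\<exists>N\<in>null_sets ?M. S q \<subseteq> N" for q
  proof (cases "S q = {}")
    case True then show ?thesis by (intro bexI[of _ "{}"]) auto
  next
    case False
    define \<sigma> where "\<sigma> = Inf (S q)"
    have bdd: "bdd_below (S q)" by (auto simp: S_def intro!: bdd_belowI[of _ 0])
    have lo: "\<sigma> \<le> s" if "s \<in> S q" for s using cInf_lower[OF that bdd] by (simp add: \<sigma>_def)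
    have \<sigma>0: "0 \<le> \<sigma>" unfolding \<sigma>_def using False by (intro cInf_greatest) (auto simp: S_def)
    \<comment> \<open>The interval from u to q covers \<open>S q\<close> and has dk-mass below e;
      shrinking e makes the cover null.\<close>
    have *: "\<exists>u. 0 \<le> u \<and> S q \<subseteq> {u<..q} \<and> k q - e < k u" if e: "e > 0" for e
    proof (cases "\<sigma> \<in> S q")
      case True
      then obtain u where "0 \<le> u" "u < \<sigma>" "k q - e < k u" using e by (auto simp: S_def)
      then show ?thesis using lo by (intro exI[of _ u]) (force simp: S_def)
    next
      \<comment> \<open>If the infimum is not attained, points of \<open>S q\<close> accumulate at
        \<open>\<sigma>\<close> from the right, and right-continuity of k brings k \<sigma> close to
        k q; so \<open>\<sigma>\<close> itself serves as u.\<close>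
      case False
      have "eventually (\<lambda>r. dist (k r) (k \<sigma>) < e/2) (at_right \<sigma>)"
        by (rule tendstoD[OF kr[OF \<sigma>0]]) (use e in simp)
      then obtain b where b: "b > \<sigma>" "\<And>r. \<sigma> < r \<Longrightarrow> r < b \<Longrightarrow> dist (k r) (k \<sigma>) < e/2"
        by (auto simp: eventually_at_right[OF less_add_one])
      obtain s where s: "s \<in> S q" "s < b" using cInf_lessD[OF \<open>S q \<noteq> {}\<close>, of b] b by (auto simp: \<sigma>_def)
      have "\<sigma> < s" using lo[OF s(1)] s(1) False by (cases "s = \<sigma>") auto
      obtain u where u: "0 \<le> u" "u < s" "k q - e/2 < k u" using s(1) half_gt_zero[OF e] unfolding S_def by blast
      have "k u \<le> k s" using K(1)[of u s] u by simp
      then have "k q - e < k \<sigma>" using b(2)[OF \<open>\<sigma> < s\<close> s(2)] u(3) unfolding dist_real_def by linarith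
      moreover have "S q \<subseteq> {\<sigma><..q}"
      proof
        fix r assume r: "r \<in> S q"
        then have "\<sigma> \<noteq> r" "r \<le> q" using False by (auto simp: S_def)
        then show "r \<in> {\<sigma><..q}" using lo[OF r] by simp
      qed
      ultimately show ?thesis using \<sigma>0 by blast
    qed
    have "\<forall>n. \<exists>u. 0 \<le> u \<and> S q \<subseteq> {u<..q} \<and> k q - 1 / real (Suc n) < k u" using * by simp
    then obtain u where u: "\<And>n. 0 \<le> u n" "\<And>n. S q \<subseteq> {u n<..q}" "\<And>n. k q - 1 / real (Suc n) < k (u n)"
      by metis
    let ?N = "\<Inter>n. {u n<..q}"
    have "emeasure ?M ?N \<le> ennreal (1 / real (Suc n))" for n
    proof -
      have uq: "u n \<le> q" using False u(2)[of n] by fastforce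
      have "emeasure ?M ?N \<le> emeasure ?M {u n<..q}" by (intro emeasure_mono) auto
      also have "\<dots> \<le> ennreal (1 / real (Suc n))"
        using emeasure_Ioc_k[OF u(1) uq] u(3)[of n] by (auto intro!: ennreal_leI)
      finally show ?thesis .
    qed
    moreover have "(\<lambda>n. ennreal (1 / real (Suc n))) \<longlonglongrightarrow> ennreal 0"
      by (intro tendsto_ennrealI) (rule LIMSEQ_Suc[OF lim_1_over_n])
    ultimately have "emeasure ?M ?N \<le> ennreal 0" by (intro LIMSEQ_le_const) auto
    then have "?N \<in> null_sets ?M" by (intro null_setsI) auto
    then show ?thesis using u(2) by (intro bexI[of _ ?N]) auto
  qed
  then obtain N where N: "\<And>q. N q \<in> null_sets ?M" "\<And>q. S q \<subseteq> N q" by metis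
  have "(\<Union>q\<in>\<rat>. N q) \<in> null_sets ?M" using N by (intro null_sets_UN') (auto simp: countable_rat)
  moreover have "{s \<in> space ?M. ennreal (k s - w s) * indicator {0<..t} s \<noteq> 0} \<subseteq> (\<Union>q\<in>\<rat>. N q)"
  proof
    fix s assume "s \<in> {s \<in> space ?M. ennreal (k s - w s) * indicator {0<..t} s \<noteq> 0}"
    then have s: "0 < s" "w s < k s" by (auto simp: indicator_def ennreal_eq_0_iff split: if_splits)
    define g where "g = (k s - w s) / 2"
    have g: "g > 0" using s by (simp add: g_def)
    have "eventually (\<lambda>r. dist (k r - w r) (k s - w s) < g) (at_right s)"
      using w[of s] s g by (intro tendstoD) auto
    then obtain b where b: "b > s" "\<And>r. s < r \<Longrightarrow> r < b \<Longrightarrow> dist (k r - w r) (k s - w s) < g"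
      by (auto simp: eventually_at_right[OF less_add_one])
    obtain q where q: "q \<in> \<rat>" "s < q" "q < b" using Rats_dense_in_real[OF b(1)] by auto
    have gap: "w r \<le> k r - g" if "s \<le> r" "r \<le> q" for r
    proof (cases "r = s")
      case True
      have "k s - w s = 2 * g" by (simp add: g_def)
      then have "w s \<le> k s - g" using g by linarith
      then show ?thesis using True by simp
    next
      case False
      have "k s - w s = 2 * g" by (simp add: g_def)
      moreover have "\<bar>(k r - w r) - (k s - w s)\<bar> < g" using b(2)[of r] False that q by (auto simp: dist_real_def)
      ultimately show ?thesis by linarith
    qed
    have "\<exists>u. 0 \<le> u \<and> u < s \<and> k q - e < k u" if e: "e > 0" for e
    proof -
      \<comment> \<open>With d \<le> g a point r with k q - d < w r cannot lie in [s,q], where w r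
        \<le> k r - g \<le> k q - g; so it precedes s.\<close>
      define d where "d = min e g"
      have d: "d > 0" "d \<le> e" "d \<le> g" using e g by (auto simp: d_def)
      consider "k q < d" | r where "0 \<le> r" "r \<le> q" "k q - d < w r"
        using K(4)[of q d] d q s by auto
      then show ?thesis
      proof cases
        case 1
        then show ?thesis using K(2)[of 0] s d by (intro exI[of _ 0]) auto
      next
        case 2
        have "r < s"
        proof (rule ccontr)
          assume "\<not> r < s"
          then have "w r \<le> k r - g" "k r \<le> k q" using gap[of r] K(1)[of r q] 2 by auto
          then show False using 2 d by linarith
        qed
        then show ?thesis using 2 K(3)[of r] d by (intro exI[of _ r]) auto
      qed
    qed
    then have "s \<in> S q" using s q by (auto simp: S_def)
    then show "s \<in> (\<Union>q\<in>\<rat>. N q)" using N(2) q by blast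
  qed
  ultimately have "AE s in ?M. ennreal (k s - w s) * indicator {0<..t} s = 0"
    using AE_I'[of "\<Union>q\<in>\<rat>. N q" ?M "\<lambda>s. ennreal (k s - w s) * indicator {0<..t} s = 0"] by simp
  then have "(\<integral>\<^sup>+ s. ennreal (k s - w s) * indicator {0<..t} s \<partial>?M) = (\<integral>\<^sup>+ s. 0 \<partial>?M)"
    by (rule nn_integral_cong_AE)
  then show ?thesis by simp
qed

end

subsection \<open>A priori bounds\<close>

lemma norm_add3_le:
  fixes a b c :: "'a::real_normed_vector"
  shows "norm (a + b + c) \<le> norm a + norm b + norm c"
  using norm_triangle_ineq[of "a + b" c] norm_triangle_ineq[of a b] by linarith

locale young_sde =
  fixes p L \<alpha> C :: real
    and f :: "real^'d \<Rightarrow> real^'d" and g :: "real^'d \<Rightarrow> real^'d^'d"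
  assumes p1: "p \<ge> 1" and f_cont: "continuous_on UNIV f" and L0: "L > 0"
    and f_lin: "\<And>x. norm (f x) \<le> L * (1 + norm x)"
    and \<alpha>: "p - 1 < \<alpha>" "\<alpha> \<le> 1" and C0: "C > 0"
    and g_holder: "\<And>x y v. norm ((g x - g y) *v v) \<le> C * norm (x - y) powr \<alpha> * norm v"
begin

abbreviation Mf :: "real^'d \<Rightarrow> real \<Rightarrow> real^'d" where "Mf y r \<equiv> r *\<^sub>R f y"
abbreviation Mg :: "real^'d \<Rightarrow> real^'d \<Rightarrow> real^'d" where "Mg y v \<equiv> g y *v v"

text \<open>The form of the equation that composes with time changes. \<open>Lint\<close> constrains
  increments only, so I and J are normalised at 0, and the Skorokhod condition is replaced by
  \<open>skor\<close> for the coordinates of l - y.\<close>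

definition sol :: "real^'d \<Rightarrow> (real \<Rightarrow> real) \<Rightarrow> (real \<Rightarrow> real^'d) \<Rightarrow> (real \<Rightarrow> real^'d) \<Rightarrow>
    (real \<Rightarrow> real^'d) \<Rightarrow> (real \<Rightarrow> real^'d) \<Rightarrow> (real \<Rightarrow> real^'d) \<Rightarrow> (real \<Rightarrow> real^'d) \<Rightarrow> bool" where
  "sol c a z l x k I J \<longleftrightarrow> Lint Mf x a I \<and> Lint Mg x z J \<and> I 0 = 0 \<and> J 0 = 0 \<and> k 0 = 0 \<and>
     (\<forall>t\<ge>0. x t = c + I t + J t + k t) \<and>
     (\<forall>i. skor (\<lambda>t. l t $ i - (c + I t + J t) $ i) (\<lambda>t. k t $ i))"

text \<open>One F for both drivers, whatever their exponents. Strict monotonicity allows division by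
  increments of F, and it makes an interval with no gain of control a single point.\<close>

definition driver_control :: "real set \<Rightarrow> (real \<Rightarrow> real) \<Rightarrow> (real \<Rightarrow> real^'d) \<Rightarrow> (real \<Rightarrow> real) \<Rightarrow> bool" where
  "driver_control S a z F \<longleftrightarrow> pcontrol 1 S a F \<and> pcontrol p S z F \<and> strict_mono_on S F"

text \<open>\<alpha> / p comes from g along x and 1 / p from z; the sum exceeds 1 exactly when
  \<alpha> > p - 1.\<close>

definition \<theta> :: real where "\<theta> = (1 + \<alpha>) / p"
definition G0 :: real where "G0 = onorm ((*v) (g 0))"
text \<open>The factor 2 powr \<theta> appears because the normalised control in
  \<open>J_young\<close> increases by at most 2.\<close>

definition K1 :: real where "K1 = sew_const \<theta> * 2 powr \<theta>"
text \<open>Sum of the coefficients in the increment bounds: L for I, G0 and C for g at the left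
  endpoint, K1 * C for the Young remainder.\<close>

definition c1 :: real where "c1 = L + G0 + C + K1 * C"
definition dd :: real where "dd = real CARD('d)"

lemma p0: "p > 0" using p1 by simp
lemma \<alpha>0: "\<alpha> > 0" using p1 \<alpha> by simp
lemma \<theta>1: "\<theta> > 1" using p1 \<alpha> by (simp add: \<theta>_def)
lemma K1_nonneg: "K1 \<ge> 0" using sew_const_props(1)[OF \<theta>1] by (simp add: K1_def)

lemma G0_bound: "norm (g 0 *v v) \<le> G0 * norm v"
  unfolding G0_def by (rule onorm) (rule matrix_vector_mul_bounded_linear)

lemma G0_nonneg: "G0 \<ge> 0"
  unfolding G0_def by (rule onorm_pos_le) (rule matrix_vector_mul_bounded_linear)

lemma c1_pos: "c1 > 0"
proof -
  have "K1 * C \<ge> 0" using K1_nonneg C0 by simp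
  then show ?thesis using L0 G0_nonneg C0 unfolding c1_def by linarith
qed

lemma dd1: "dd \<ge> 1"
  unfolding dd_def by (simp add: Suc_leI)

lemma Mg_bound: "norm (Mg y v) \<le> (G0 + C * norm y powr \<alpha>) * norm v"
proof -
  have "Mg y v = (g y - g 0) *v v + g 0 *v v" by (simp add: matrix_vector_mult_diff_rdistrib)
  then have "norm (Mg y v) \<le> norm ((g y - g 0) *v v) + norm (g 0 *v v)" by (metis norm_triangle_ineq)
  also have "\<dots> \<le> C * norm y powr \<alpha> * norm v + G0 * norm v"
    using g_holder[of y 0 v] G0_bound[of v] by simp
  finally show ?thesis by (simp add: algebra_simps)
qed

lemma Mg_diff: "Mg y (a - b) = Mg y a - Mg y b"
  by (simp add: matrix_vector_mult_diff_distrib)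

lemma Mf_diff: "Mf y (a - b) = Mf y a - Mf y b"
  by (simp add: scaleR_diff_left)

lemma Mg_holder: "norm (Mg x v - Mg y v) \<le> C * norm (x - y) powr \<alpha> * norm v"
  using g_holder[of x y v] by (simp add: matrix_vector_mult_diff_rdistrib)

lemma powr_alpha_le: "0 \<le> r \<Longrightarrow> r powr \<alpha> \<le> 1 + r"
proof -
  assume r: "0 \<le> r"
  have "r powr \<alpha> \<le> (1 + r) powr \<alpha>" using r \<alpha>0 by (intro powr_mono2) auto
  also have "\<dots> \<le> (1 + r) powr 1" using r \<alpha> by (intro powr_mono) auto
  finally show ?thesis using r by simp
qed

text \<open>Left-point sums never evaluate x at v. So R bounds x on [u,v) only, and the estimate
  holds across any jump of x at v.\<close>

lemma I_increment:
  assumes I: "Lint Mf x a I" and uv: "0 \<le> u" "u \<le> v"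
    and R: "\<And>r. u \<le> r \<Longrightarrow> r < v \<Longrightarrow> norm (x r) \<le> R"
    and a: "pcontrol 1 {u..v} a F"
  shows "norm (I v - I u) \<le> L * (1 + R) * (F v - F u)"
proof (cases "u = v")
  case False
  then have lt: "u < v" using uv by simp
  have "norm (I v - I u - (\<lambda>_. 0) (a v - a u)) \<le> L * (1 + R) * F v - L * (1 + R) * F u"
  proof (rule Lint_telescope[OF I uv(1) lt])
    fix s t assume st: "u \<le> s" "s < t" "t \<le> v"
    have "norm (f (x s)) \<le> L * (1 + R)"
    proof -
      have "norm (f (x s)) \<le> L * (1 + norm (x s))" by (rule f_lin)
      also have "\<dots> \<le> L * (1 + R)" using R[of s] st L0 by simp
      finally show ?thesis .
    qed
    moreover have "\<bar>a t - a s\<bar> \<le> F t - F s" using pcontrol_1_norm[OF a, of s t] st by simp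
    ultimately have "\<bar>a t - a s\<bar> * norm (f (x s)) \<le> (F t - F s) * (L * (1 + R))"
      by (intro mult_mono) auto
    then show "norm ((a t - a s) *\<^sub>R f (x s) - 0) \<le> L * (1 + R) * F t - L * (1 + R) * F s"
      by (simp only: norm_scaleR diff_zero) (simp add: algebra_simps)
  qed simp
  then show ?thesis by (simp add: algebra_simps)
qed simp

text \<open>Scaling both controls to total increase at most 1 before adding them yields a product
  bound: the increment of F keeps the exponent 1 / p of a p-control, and W enters with the exponent
  \<alpha> / p, which is sublinear in W powr (1 / p) up to \<alpha> = 1. As in
  \<open>I_increment\<close>, x is controlled on [u,v) only.\<close>

lemma J_young:
  assumes J: "Lint Mg x z J" and uv: "0 \<le> u" "u < v"
    and W: "W > 0" and Fx: "pcontrol p {u..<v} x Fx" "\<And>r. u \<le> r \<Longrightarrow> r < v \<Longrightarrow> Fx r - Fx u \<le> W"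
    and z: "pcontrol p {u..v} z F" and F: "F u < F v"
  shows "norm (J v - J u - Mg (x u) (z v - z u)) \<le> K1 * C * W powr (\<alpha> / p) * (F v - F u) powr (1 / p)"
proof -
  define B where "B = F v - F u"
  have B: "B > 0" using F by (simp add: B_def)
  \<comment> \<open>The control of x is extended to v by the largest value it may approach, which
    keeps it monotone; its increase over [u,v] is then W.\<close>
  define X where "X r = (if r < v then Fx r else Fx u + W)" for r
  define H where "H r = X r / W + F r / B" for r
  have Xm: "X s \<le> X t" if "u \<le> s" "s \<le> t" "t \<le> v" for s t
    using pcontrol_mono[OF Fx(1), of s t] Fx(2)[of s] that by (auto simp: X_def)
  have Fm: "F s \<le> F t" if "u \<le> s" "s \<le> t" "t \<le> v" for s t
    using pcontrol_mono[OF z, of s t] that by auto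
  have Hd: "H t - H s = (X t - X s) / W + (F t - F s) / B" for s t
    by (simp add: H_def diff_divide_distrib)
  have Hx: "X t - X s \<le> W * (H t - H s)" and Hz: "F t - F s \<le> B * (H t - H s)"
    if "u \<le> s" "s \<le> t" "t \<le> v" for s t
    using Xm[OF that] Fm[OF that] W B unfolding Hd by (auto simp: field_simps)
  have "norm (J v - J u - Mg (x u) (z v - z u))
      \<le> sew_const \<theta> * (C * W powr (\<alpha>/p) * B powr (1/p)) * (H v - H u) powr \<theta>"
  proof (rule Lint_young[OF J uv Mg_diff \<theta>1])
    show "0 \<le> C * W powr (\<alpha>/p) * B powr (1/p)" using C0 by simp
    show "H s \<le> H t" if "u \<le> s" "s \<le> t" "t \<le> v" for s t
      using Xm[OF that] Fm[OF that] W B by (auto simp: H_def intro!: add_mono divide_right_mono)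
    fix r s t assume rst: "u \<le> r" "r \<le> s" "s < t" "t \<le> v"
    have H0: "0 \<le> H t - H r"
      using Xm[of r t] Fm[of r t] rst W B unfolding Hd by auto
    have "norm (x s - x r) \<le> (Fx s - Fx r) powr (1/p)"
      using rst by (intro pcontrol_norm[OF Fx(1) p0]) auto
    also have "Fx s - Fx r \<le> X t - X r" using Xm[of s t] rst by (auto simp: X_def)
    then have "(Fx s - Fx r) powr (1/p) \<le> (W * (H t - H r)) powr (1/p)"
      using Hx[of r t] rst p0 pcontrol_mono[OF Fx(1), of r s] by (intro powr_mono2) auto
    finally have "norm (x s - x r) powr \<alpha> \<le> ((W * (H t - H r)) powr (1/p)) powr \<alpha>"
      using \<alpha>0 by (intro powr_mono2) auto
    also have "\<dots> = W powr (\<alpha>/p) * (H t - H r) powr (\<alpha>/p)"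
      using W H0 by (simp add: powr_powr powr_mult)
    finally have 1: "norm (x s - x r) powr \<alpha> \<le> W powr (\<alpha>/p) * (H t - H r) powr (\<alpha>/p)" .
    have "norm (z t - z s) \<le> (F t - F s) powr (1/p)"
      using rst by (intro pcontrol_norm[OF z p0]) auto
    also have "\<dots> \<le> (B * (H t - H r)) powr (1/p)"
      using Hz[of r t] Fm[of r s] Fm[of s t] rst p0 by (intro powr_mono2) auto
    also have "\<dots> = B powr (1/p) * (H t - H r) powr (1/p)"
      using B H0 by (simp add: powr_mult)
    finally have 2: "norm (z t - z s) \<le> B powr (1/p) * (H t - H r) powr (1/p)" .
    have "norm (Mg (x s) (z t - z s) - Mg (x r) (z t - z s)) \<le> C * norm (x s - x r) powr \<alpha> * norm (z t - z s)"
      by (rule Mg_holder)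
    also have "\<dots> \<le> C * (W powr (\<alpha>/p) * (H t - H r) powr (\<alpha>/p)) * (B powr (1/p) * (H t - H r) powr (1/p))"
      using 1 2 C0 by (intro mult_mono) auto
    also have "\<dots> = C * W powr (\<alpha>/p) * B powr (1/p) * (H t - H r) powr \<theta>"
      by (simp add: \<theta>_def add_divide_distrib powr_add algebra_simps)
    finally show "norm (Mg (x s) (z t - z s) - Mg (x r) (z t - z s)) \<le> C * W powr (\<alpha>/p) * B powr (1/p) * (H t - H r) powr \<theta>" .
  qed
  also have "\<dots> \<le> sew_const \<theta> * (C * W powr (\<alpha>/p) * B powr (1/p)) * 2 powr \<theta>"
  proof -
    have "H v - H u \<le> 2"
      unfolding Hd using W B uv by (simp add: X_def B_def)
    moreover have "0 \<le> H v - H u" using Xm[of u v] Fm[of u v] uv W B unfolding Hd by auto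
    ultimately show ?thesis
      using \<theta>1 C0 sew_const_props(1)[OF \<theta>1] by (intro mult_left_mono powr_mono2) auto
  qed
  finally show ?thesis by (simp add: K1_def B_def algebra_simps)
qed

lemma J_increment:
  assumes J: "Lint Mg x z J" and uv: "0 \<le> u" "u \<le> v"
    and W: "W > 0" and Fx: "pcontrol p {u..<v} x Fx" "\<And>r. u \<le> r \<Longrightarrow> r < v \<Longrightarrow> Fx r - Fx u \<le> W"
    and R: "u < v \<Longrightarrow> norm (x u) \<le> R" and R0: "R \<ge> 0"
    and z: "pcontrol p {u..v} z F" and F: "u < v \<Longrightarrow> F u < F v"
  shows "norm (J v - J u) \<le> (G0 + C * R powr \<alpha> + K1 * C * W powr (\<alpha> / p)) * (F v - F u) powr (1 / p)"
proof (cases "u = v")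
  case False
  then have lt: "u < v" using uv by simp
  have "norm (Mg (x u) (z v - z u)) \<le> (G0 + C * norm (x u) powr \<alpha>) * norm (z v - z u)"
    by (rule Mg_bound)
  also have "\<dots> \<le> (G0 + C * R powr \<alpha>) * (F v - F u) powr (1/p)"
    using R[OF lt] \<alpha>0 C0 G0_nonneg pcontrol_norm[OF z p0, of u v] uv R0
    by (intro mult_mono add_left_mono mult_left_mono powr_mono2 add_nonneg_nonneg) auto
  finally have "norm (Mg (x u) (z v - z u)) \<le> (G0 + C * R powr \<alpha>) * (F v - F u) powr (1/p)" .
  moreover have "norm (J v - J u) \<le> norm (J v - J u - Mg (x u) (z v - z u)) + norm (Mg (x u) (z v - z u))"
    using norm_triangle_sub[of "J v - J u" "Mg (x u) (z v - z u)"] by simp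
  ultimately show ?thesis
    using J_young[OF J uv(1) lt W Fx z F[OF lt]] by (simp add: algebra_simps)
qed simp

text \<open>The input l - y rises above k u by at most the oscillation of l, here 2 * Ml, plus that
  of the integrals. Since all coordinates are nondecreasing, their sum is a monotone function that
  controls k in 1-variation; this is the only place where the size of l matters.\<close>

lemma k_increment:
  assumes sol: "sol c a z l x k I J" and uv: "0 \<le> u" "u \<le> v"
    and l: "\<And>r. u \<le> r \<Longrightarrow> r \<le> v \<Longrightarrow> norm (l r) \<le> Ml"
    and E: "\<And>r. u \<le> r \<Longrightarrow> r \<le> v \<Longrightarrow> norm (I r - I u) + norm (J r - J u) \<le> E"
  shows "norm (k v - k u) \<le> (\<Sum>i\<in>UNIV. k v $ i) - (\<Sum>i\<in>UNIV. k u $ i)"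
    and "(\<Sum>i\<in>UNIV. k v $ i) - (\<Sum>i\<in>UNIV. k u $ i) \<le> dd * (2 * Ml + E)"
proof -
  have sk: "skor (\<lambda>t. l t $ i - (c + I t + J t) $ i) (\<lambda>t. k t $ i)" for i
    using sol by (simp add: sol_def)
  have mono: "k u $ i \<le> k v $ i" for i using skorD(1)[OF sk uv] .
  have "norm (k v - k u) \<le> (\<Sum>i\<in>UNIV. \<bar>(k v - k u) $ i\<bar>)" by (rule norm_le_l1_cart)
  also have "\<dots> = (\<Sum>i\<in>UNIV. k v $ i) - (\<Sum>i\<in>UNIV. k u $ i)"
    using mono by (simp add: sum_subtractf)
  finally show "norm (k v - k u) \<le> (\<Sum>i\<in>UNIV. k v $ i) - (\<Sum>i\<in>UNIV. k u $ i)" .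
  have E0: "E \<ge> 0" using E[of u] uv by simp
  have Ml0: "Ml \<ge> 0" using l[of u] uv norm_ge_zero[of "l u"] by linarith
  have "k v $ i - k u $ i \<le> 2 * Ml + E" for i
  proof (rule skor_increment[OF sk uv])
    fix s assume s: "u \<le> s" "s \<le> v"
    have lu: "l u $ i - (c + I u + J u) $ i \<le> k u $ i" using skorD(3)[OF sk uv(1)] .
    have comp: "\<bar>b $ i\<bar> \<le> norm b" for b :: "real^'d" by (rule component_le_norm_cart)
    show "l s $ i - (c + I s + J s) $ i - k u $ i \<le> 2 * Ml + E"
      using lu comp[of "l s"] comp[of "l u"] comp[of "I s - I u"] comp[of "J s - J u"] l[of s] l[of u] E[of s] s uv
      by simp
  qed (use E0 Ml0 in auto)
  then have "(\<Sum>i\<in>UNIV. k v $ i - k u $ i) \<le> (\<Sum>i\<in>(UNIV::'d set). 2 * Ml + E)" by (intro sum_mono)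
  then show "(\<Sum>i\<in>UNIV. k v $ i) - (\<Sum>i\<in>UNIV. k u $ i) \<le> dd * (2 * Ml + E)"
    by (simp add: sum_subtractf dd_def)
qed

text \<open>Chosen so that the coefficient 4 * (1 + dd) * c1 * \<epsilon>0 powr (1/p) at the end of
  \<open>small_step\<close> is at most 1/2; the cap 1 makes an increment of F at most its own power
  1/p.\<close>

definition \<epsilon>0 :: real where "\<epsilon>0 = (min 1 (1 / (8 * (1 + dd) * c1))) powr p"

lemma \<epsilon>0: "0 < \<epsilon>0" "\<epsilon>0 \<le> 1" "8 * (1 + dd) * c1 * \<epsilon>0 powr (1/p) \<le> 1"
proof -
  define m where "m = min 1 (1 / (8 * (1 + dd) * c1))"
  have pos: "8 * (1 + dd) * c1 > 0" using dd1 c1_pos by simp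
  have m: "0 < m" "m \<le> 1" "m \<le> 1 / (8 * (1 + dd) * c1)" using pos by (auto simp: m_def)
  have e: "\<epsilon>0 = m powr p" by (simp add: \<epsilon>0_def m_def)
  show "0 < \<epsilon>0" using m e by simp
  show "\<epsilon>0 \<le> 1" using m e p0 by (simp add: powr_le1)
  have "\<epsilon>0 powr (1/p) = m" using m p0 by (simp add: e powr_powr)
  then show "8 * (1 + dd) * c1 * \<epsilon>0 powr (1/p) \<le> 1" using m(3) pos by (simp add: field_simps)
qed

lemma add_powr_le:
  fixes a b :: real
  assumes "0 \<le> a" "0 \<le> b"
  shows "(a + b) powr p \<le> 2 powr p * (a powr p + b powr p)"
proof -
  have "(a + b) powr p \<le> (2 * max a b) powr p" using assms p0 by (intro powr_mono2) auto
  also have "\<dots> = 2 powr p * max a b powr p" using assms by (simp add: powr_mult)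
  also have "max a b powr p \<le> a powr p + b powr p" by (simp add: max_def)
  finally show ?thesis by simp
qed

text \<open>On an interval where the driver moves little, the variation \<open>w\<close> of the solution is
  bounded by an affine function of \<open>w\<close> itself with slope \<open>1/2\<close>; since \<open>w\<close> is finite this
  bounds \<open>w\<close>. The reflection term enters only through its total increase.\<close>

lemma small_step:
  assumes sol: "sol c a z l x k I J" and st: "0 \<le> s" "s \<le> t"
    and F: "driver_control {s..t} a z F" "F t - F s \<le> \<epsilon>0"
    and R: "norm (x s) \<le> R" and l: "\<And>r. s \<le> r \<Longrightarrow> r \<le> t \<Longrightarrow> norm (l r) \<le> Ml"
    and fin: "v_var p x s t < \<infinity>"
  shows "v_var p x s t \<le> ereal ((1 + R + 8 * dd * (2 * Ml + 1)) powr p)"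
proof -
  have I: "Lint Mf x a I" and J: "Lint Mg x z J" and x: "\<And>t. t \<ge> 0 \<Longrightarrow> x t = c + I t + J t + k t"
    using sol by (auto simp: sol_def)
  have Fa: "pcontrol 1 {s..t} a F" and Fz: "pcontrol p {s..t} z F" and Fs: "strict_mono_on {s..t} F"
    using F(1) by (auto simp: driver_control_def)
  have Ml0: "Ml \<ge> 0" using l[of s] st norm_ge_zero[of "l s"] by linarith
  have R0: "R \<ge> 0" using R norm_ge_zero[of "x s"] by linarith
  have Fmono: "F u \<le> F v" if "s \<le> u" "u \<le> v" "v \<le> t" for u v
    using pcontrol_mono[OF Fa, of u v] that by auto
  define V where "V u = real_of_ereal (v_var p x s u)" for u
  have finu: "v_var p x s u < \<infinity>" if "u \<in> {s..t}" for u
    using v_var_mono[of s u t p x] that fin by (auto intro: le_less_trans)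
  have V: "pcontrol p {s..t} x V"
    unfolding V_def by (rule v_var_pcontrol) (use finu in auto)
  have V0: "V u \<ge> 0" if "s \<le> u" for u unfolding V_def using v_var_nonneg[OF that, of p x] by (rule real_of_ereal_pos)
  have Vs: "V s = 0"
  proof -
    have "v_var p x s s \<le> ereal ((\<lambda>_. 0) s - (\<lambda>_. 0) s)" by (rule v_var_le) (simp add: pcontrol_def)
    then have "v_var p x s s = 0" using v_var_nonneg[of s s p x] by (intro antisym) (auto simp: zero_ereal_def)
    then show ?thesis by (simp add: V_def)
  qed
  define w where "w = V t powr (1/p)"
  have w0: "w \<ge> 0" by (simp add: w_def)
  have wp: "w powr p = V t" using V0[of t] st p0 by (simp add: w_def powr_powr)
  have xR: "norm (x r) \<le> R + w" if "s \<le> r" "r \<le> t" for r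
  proof -
    have "norm (x r - x s) \<le> (V r - V s) powr (1/p)" using that by (intro pcontrol_norm[OF V p0]) auto
    also have "\<dots> \<le> w" unfolding w_def Vs using V0[of r] that pcontrol_mono[OF V, of r t] p0
      by (intro powr_mono2) auto
    finally show ?thesis using R norm_triangle_sub[of "x r" "x s"] by linarith
  qed
  \<comment> \<open>Adding 1 makes W positive, as \<open>J_increment\<close> demands, and W powr
    (\<alpha>/p) = (1 + w) powr \<alpha> is at most 1 + w, so that all bounds stay affine in
    w.\<close>
  define W where "W = (1 + w) powr p"
  have W: "W > 0" using w0 by (simp add: W_def)
  have VW: "V r - V u \<le> W" if "s \<le> u" "r \<le> t" "s \<le> r" for u r
  proof -
    have "V r - V u \<le> V t" using V0[of u] pcontrol_mono[OF V, of r t] that by auto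
    also have "\<dots> \<le> W" unfolding wp[symmetric] W_def using w0 p0 by (intro powr_mono2) auto
    finally show ?thesis .
  qed
  define \<Lambda> where "\<Lambda> = c1 * (1 + R + w)"
  have \<Lambda>0: "\<Lambda> \<ge> 0" using c1_pos R0 w0 by (simp add: \<Lambda>_def)
  have y: "norm (I v - I u) + norm (J v - J u) \<le> \<Lambda> * (F v - F u) powr (1/p)"
    if uv: "s \<le> u" "u \<le> v" "v \<le> t" for u v
  proof -
    have 1: "norm (I v - I u) \<le> L * (1 + (R + w)) * (F v - F u)"
      using uv st xR by (intro I_increment[OF I]) (auto intro: pcontrol_subset[OF Fa])
    have 2: "norm (J v - J u) \<le> (G0 + C * (R + w) powr \<alpha> + K1 * C * W powr (\<alpha>/p)) * (F v - F u) powr (1/p)"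
    proof (rule J_increment[OF J _ _ W])
      show "pcontrol p {u..<v} x V" using uv by (intro pcontrol_subset[OF V]) auto
      show "pcontrol p {u..v} z F" using uv by (intro pcontrol_subset[OF Fz]) auto
      show "F u < F v" if "u < v" using strict_mono_onD[OF Fs, of u v] uv that by auto
    qed (use uv st xR VW R0 w0 in auto)
    have d: "0 \<le> F v - F u" "F v - F u \<le> 1"
      using Fmono[of u v] Fmono[of s u] Fmono[of v t] F(2) \<epsilon>0(2) uv by auto
    have "F v - F u = (F v - F u) powr 1" using d by simp
    also have "\<dots> \<le> (F v - F u) powr (1/p)"
    proof (cases "F v - F u = 0")
      case False
      then show ?thesis using d p1 by (intro powr_mono') auto
    qed simp
    finally have "L * (1 + (R + w)) * (F v - F u) \<le> L * (1 + (R + w)) * (F v - F u) powr (1/p)"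
      using L0 R0 w0 by (intro mult_left_mono) auto
    then have 3: "norm (I v - I u) + norm (J v - J u) \<le>
       (L * (1 + (R + w)) + (G0 + C * (R + w) powr \<alpha> + K1 * C * W powr (\<alpha>/p))) * (F v - F u) powr (1/p)"
      using 1 2 by (simp add: algebra_simps)
    have "W powr (\<alpha>/p) = (1 + w) powr \<alpha>" using w0 p0 by (simp add: W_def powr_powr)
    also have "\<dots> \<le> (1 + w) powr 1" using \<alpha> w0 by (intro powr_mono) auto
    also have "\<dots> \<le> 1 + R + w" using w0 R0 by simp
    finally have "K1 * C * W powr (\<alpha>/p) \<le> K1 * C * (1 + R + w)" using K1_nonneg C0 by (intro mult_left_mono) auto
    moreover have "C * (R + w) powr \<alpha> \<le> C * (1 + R + w)"
      using powr_alpha_le[of "R + w"] C0 R0 w0 by (simp add: add.assoc)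
    moreover have "G0 * 1 \<le> G0 * (1 + R + w)" using G0_nonneg R0 w0 by (intro mult_left_mono) auto
    ultimately have "L * (1 + (R + w)) + (G0 + C * (R + w) powr \<alpha> + K1 * C * W powr (\<alpha>/p)) \<le> \<Lambda>"
      unfolding \<Lambda>_def c1_def by (simp add: algebra_simps)
    then show ?thesis using 3 by (meson mult_right_mono order_trans powr_ge_zero)
  qed
  define \<eta> where "\<eta> = \<epsilon>0 powr (1/p)"
  have \<eta>0: "\<eta> \<ge> 0" by (simp add: \<eta>_def)
  have y': "norm (I v - I u) + norm (J v - J u) \<le> \<Lambda> * \<eta>"
    if uv: "s \<le> u" "u \<le> v" "v \<le> t" for u v
  proof -
    have "(F v - F u) powr (1/p) \<le> \<eta>"
      unfolding \<eta>_def using Fmono[of u v] Fmono[of s u] Fmono[of v t] F(2) uv p0 by (intro powr_mono2) auto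
    then show ?thesis using y[OF uv] \<Lambda>0 by (meson mult_left_mono order_trans)
  qed
  \<comment> \<open>Bound from \<open>k_increment\<close> for the total increase of the sum of the
    coordinates of k; the summand 1 makes S positive, so that S powr (p - 1) * S may be written as S
    powr p.\<close>
  define S where "S = dd * (2 * Ml + 1 + \<Lambda> * \<eta>)"
  define \<kappa> where "\<kappa> u = (\<Sum>i\<in>UNIV. k u $ i)" for u
  have "0 \<le> \<Lambda> * \<eta>" using \<Lambda>0 \<eta>0 by simp
  then have S0: "S > 0" unfolding S_def using dd1 Ml0 by (intro mult_pos_pos) linarith+
  have kk: "norm (k v - k u) \<le> \<kappa> v - \<kappa> u" "\<kappa> v - \<kappa> u \<le> S" if uv: "s \<le> u" "u \<le> v" "v \<le> t" for u v
  proof -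
    have b: "\<And>r. u \<le> r \<Longrightarrow> r \<le> v \<Longrightarrow> norm (I r - I u) + norm (J r - J u) \<le> 1 + \<Lambda> * \<eta>"
      using y'[of u] uv by (smt (verit))
    have l': "\<And>r. u \<le> r \<Longrightarrow> r \<le> v \<Longrightarrow> norm (l r) \<le> Ml" using l uv by auto
    show "norm (k v - k u) \<le> \<kappa> v - \<kappa> u" "\<kappa> v - \<kappa> u \<le> S"
      unfolding \<kappa>_def S_def using k_increment[OF sol _ uv(2) l' b] st uv by (auto simp: add.assoc)
  qed
  \<comment> \<open>The p-th power of an increment of k is at most S powr (p - 1) times that of the
    monotone \<open>\<kappa>\<close>. Hence the variation of k is paid for once by its total
    increase, independently of the subdivision.\<close>
  have ctrl: "pcontrol p {s..t} x (\<lambda>r. 2 powr p * (\<Lambda> powr p * F r + S powr (p - 1) * \<kappa> r))"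
    unfolding pcontrol_def
  proof (intro ballI impI)
    fix u v assume "u \<in> {s..t}" "v \<in> {s..t}" "u \<le> v"
    then have uv: "s \<le> u" "u \<le> v" "v \<le> t" by auto
    let ?dy = "norm (I v - I u) + norm (J v - J u)" and ?dk = "norm (k v - k u)"
    have "x v - x u = (I v - I u) + (J v - J u) + (k v - k u)" using x[of u] x[of v] uv st by simp
    then have "norm (x v - x u) \<le> ?dy + ?dk"
      using norm_add3_le[of "I v - I u" "J v - J u" "k v - k u"] by simp
    then have "norm (x v - x u) powr p \<le> (?dy + ?dk) powr p" using p0 by (intro powr_mono2) auto
    also have "\<dots> \<le> 2 powr p * (?dy powr p + ?dk powr p)" by (intro add_powr_le) auto
    also have "\<dots> \<le> 2 powr p * (\<Lambda> powr p * (F v - F u) + S powr (p - 1) * (\<kappa> v - \<kappa> u))"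
    proof (intro mult_left_mono add_mono)
      have "?dy powr p \<le> (\<Lambda> * (F v - F u) powr (1/p)) powr p"
        using y[OF uv] p0 by (intro powr_mono2) auto
      also have "\<dots> = \<Lambda> powr p * (F v - F u)"
        using \<Lambda>0 Fmono[OF uv] p0 by (simp add: powr_mult powr_powr)
      finally show "?dy powr p \<le> \<Lambda> powr p * (F v - F u)" .
      show "?dk powr p \<le> S powr (p - 1) * (\<kappa> v - \<kappa> u)"
      proof (cases "?dk = 0")
        case True
        then show ?thesis using kk(1)[OF uv] by simp
      next
        case False
        then have "?dk powr p = ?dk powr (p - 1) * ?dk" by (simp add: powr_diff)
        also have "\<dots> \<le> S powr (p - 1) * (\<kappa> v - \<kappa> u)"
          using kk[OF uv] p1 by (intro mult_mono powr_mono2) auto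
        finally show ?thesis .
      qed
    qed simp
    finally show "norm (x v - x u) powr p \<le> 2 powr p * (\<Lambda> powr p * F v + S powr (p - 1) * \<kappa> v)
      - 2 powr p * (\<Lambda> powr p * F u + S powr (p - 1) * \<kappa> u)"
      by (simp add: algebra_simps)
  qed
  have Vt: "v_var p x s t = ereal (V t)"
    unfolding V_def using fin v_var_nonneg[OF st(2), of p x] by (cases "v_var p x s t") auto
  have "V t \<le> 2 powr p * (\<Lambda> powr p * (F t - F s) + S powr (p - 1) * (\<kappa> t - \<kappa> s))"
    using v_var_le[OF ctrl] unfolding Vt by (simp add: algebra_simps)
  also have "\<dots> \<le> 2 powr p * (\<Lambda> powr p * \<epsilon>0 + S powr (p - 1) * S)"
    using F(2) kk(2)[of s t] st by (intro mult_left_mono add_mono) auto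
  also have "\<dots> = 2 powr p * ((\<Lambda> * \<eta>) powr p + S powr p)"
    using \<Lambda>0 \<eta>0 \<epsilon>0(1) S0 p0 by (simp add: \<eta>_def powr_mult powr_powr powr_diff)
  also have "\<dots> \<le> 2 powr p * (2 * (\<Lambda> * \<eta> + S) powr p)"
  proof -
    have "(\<Lambda> * \<eta>) powr p \<le> (\<Lambda> * \<eta> + S) powr p" "S powr p \<le> (\<Lambda> * \<eta> + S) powr p"
      using \<Lambda>0 \<eta>0 S0 p0 by (auto intro!: powr_mono2)
    then show ?thesis by simp
  qed
  also have "\<dots> \<le> (4 * (\<Lambda> * \<eta> + S)) powr p"
  proof -
    have "(2::real) = 2 powr 1" by simp
    also have "\<dots> \<le> 2 powr p" using p1 by (intro powr_mono) auto
    finally have "2 powr p * 2 \<le> (2::real) powr p * 2 powr p" by simp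
    also have "\<dots> = 4 powr p" by (simp add: powr_mult[symmetric])
    finally have "2 powr p * 2 * (\<Lambda> * \<eta> + S) powr p \<le> 4 powr p * (\<Lambda> * \<eta> + S) powr p"
      by (intro mult_right_mono) auto
    moreover have "(4 * q) powr p = 4 powr p * q powr p" if "q \<ge> 0" for q :: real
      using that by (simp add: powr_mult)
    moreover have "0 \<le> \<Lambda> * \<eta> + S" using \<Lambda>0 \<eta>0 S0 by simp
    ultimately show ?thesis by (simp only: mult.assoc)
  qed
  finally have "w \<le> ((4 * (\<Lambda> * \<eta> + S)) powr p) powr (1/p)"
    unfolding w_def using V0[of t] st p0 by (intro powr_mono2) auto
  also have "\<dots> = 4 * (\<Lambda> * \<eta> + S)" using \<Lambda>0 \<eta>0 S0 p0 by (simp add: powr_powr)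
  also have "\<dots> = 4 * (1 + dd) * c1 * \<eta> * (1 + R + w) + 4 * dd * (2 * Ml + 1)"
    by (simp add: S_def \<Lambda>_def algebra_simps)
  also have "\<dots> \<le> 1/2 * (1 + R + w) + 4 * dd * (2 * Ml + 1)"
  proof -
    have "8 * (1 + dd) * c1 * \<eta> = 2 * (4 * (1 + dd) * c1 * \<eta>)" by simp
    then have "4 * (1 + dd) * c1 * \<eta> \<le> 1/2" using \<epsilon>0(3) unfolding \<eta>_def by linarith
    then show ?thesis using R0 w0 by (intro add_right_mono mult_right_mono) auto
  qed
  finally have "w \<le> 1/2 * (1 + R + w) + 4 * dd * (2 * Ml + 1)" .
  \<comment> \<open>w is a real number by the finiteness of the variation, so its half can be moved
    to the left side.\<close>
  moreover have "w \<le> 1 + R + 2 * q" if "w \<le> 1/2 * (1 + R + w) + q" for q :: real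
    using that by (simp add: field_simps)
  ultimately have "w \<le> 1 + R + 2 * (4 * dd * (2 * Ml + 1))" by blast
  also have "2 * (4 * dd * (2 * Ml + 1)) = 8 * dd * (2 * Ml + 1)" by simp
  finally have "w \<le> 1 + R + 8 * dd * (2 * Ml + 1)" .
  then have "w powr p \<le> (1 + R + 8 * dd * (2 * Ml + 1)) powr p" using w0 p0 by (intro powr_mono2) auto
  then show ?thesis using Vt wp by simp
qed

text \<open>The condition on \<open>F t < c\<close> is right-continuity of the monotone function \<open>F\<close>.\<close>

definition bounded_sol :: "real \<Rightarrow> real \<Rightarrow> real \<Rightarrow> real \<Rightarrow> real \<Rightarrow> real^'d \<Rightarrow> (real \<Rightarrow> real) \<Rightarrow>
    (real \<Rightarrow> real^'d) \<Rightarrow> (real \<Rightarrow> real^'d) \<Rightarrow> (real \<Rightarrow> real^'d) \<Rightarrow> (real \<Rightarrow> real^'d) \<Rightarrow>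
    (real \<Rightarrow> real^'d) \<Rightarrow> (real \<Rightarrow> real^'d) \<Rightarrow> (real \<Rightarrow> real) \<Rightarrow> bool" where
  "bounded_sol s T b R Ml c a z l x k I J F \<longleftrightarrow> sol c a z l x k I J \<and> 0 \<le> s \<and> s \<le> T \<and>
     driver_control {s..T} a z F \<and>
     (\<forall>t c. s \<le> t \<longrightarrow> t < T \<longrightarrow> F t < c \<longrightarrow> (\<exists>u. t < u \<and> u \<le> T \<and> F u < c)) \<and> F T - F s \<le> b \<and>
     norm (x s) \<le> R \<and> (\<forall>r\<in>{s..T}. norm (l r) \<le> Ml) \<and> v_var p x s T < \<infinity>"

text \<open>Induction on the number of portions \<open>\<epsilon>0\<close> of control that the
  drivers use. Up to the first time \<tau> at which one portion is used, \<open>small_step\<close>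
  applies on every [s,r] with r < \<tau>. The jump at \<tau> is bounded through the half-open
  estimates, and the induction hypothesis covers [\<tau>,T] from the larger starting bound R2,
  whence the generalisation over R. B is chosen before all paths.\<close>

lemma a_priori_steps:
  "\<exists>B. \<forall>c a z l x k I J F s T. bounded_sol s T (real n * \<epsilon>0) R Ml c a z l x k I J F \<longrightarrow>
     (\<exists>G. pcontrol p {s..T} x G \<and> (\<forall>t\<in>{s..T}. 0 \<le> G t \<and> G t \<le> B))"
proof (induction n arbitrary: R)
  case 0
  have "\<exists>G. pcontrol p {s..T} x G \<and> (\<forall>t\<in>{s..T}. 0 \<le> G t \<and> G t \<le> 0)"
    if "bounded_sol s T (real 0 * \<epsilon>0) R Ml c a z l x k I J F" for c a z l x k I J F s T
  proof -
    note that = that[unfolded bounded_sol_def]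
    \<comment> \<open>Without any gain of control the interval is a point, because F is strictly
      increasing.\<close>
    have "s = T"
    proof (rule ccontr)
      assume "s \<noteq> T"
      then have "F s < F T" using that strict_mono_onD[of "{s..T}" F s T] by (auto simp: driver_control_def)
      then show False using that by simp
    qed
    then show ?thesis by (intro exI[of _ "\<lambda>_. 0"]) (auto simp: pcontrol_def)
  qed
  then show ?case by (intro exI[of _ 0]) blast
next
  case (Suc n)
  define w where "w = 1 + R + 8 * dd * (2 * Ml + 1)"
  define W where "W = w powr p"
  define b where "b = real (Suc n) * \<epsilon>0"
  \<comment> \<open>Y bounds the increments of the integrals over [s,\<tau>], jump at \<tau>
    included; R2 adds the push of the reflection and bounds x at \<tau>. The constant
    \<open>b'\<close> below bounds the p-th power of any increment of x across \<tau>.\<close>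
  define Y where "Y = L * (1 + (R + w)) * b + (G0 + C * R powr \<alpha> + K1 * C * W powr (\<alpha>/p)) * b powr (1/p)"
  define R2 where "R2 = R + Y + dd * (2 * Ml + Y)"
  obtain B2 where B2: "\<And>c a z l x k I J F s T. bounded_sol s T (real n * \<epsilon>0) R2 Ml c a z l x k I J F \<Longrightarrow>
     (\<exists>G. pcontrol p {s..T} x G \<and> (\<forall>t\<in>{s..T}. 0 \<le> G t \<and> G t \<le> B2))"
    using Suc.IH[of R2] by blast
  define b' where "b' = (R + w + R2 + B2 powr (1/p)) powr p"
  have "\<exists>G. pcontrol p {s..T} x G \<and> (\<forall>t\<in>{s..T}. 0 \<le> G t \<and> G t \<le> W + b' + \<bar>B2\<bar>)"
    if bs: "bounded_sol s T (real (Suc n) * \<epsilon>0) R Ml c a z l x k I J F" for c a z l x k I J F s T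
  proof -
    have sol: "sol c a z l x k I J" and sT: "0 \<le> s" "s \<le> T" and dr: "driver_control {s..T} a z F"
      and rc: "\<forall>t c. s \<le> t \<longrightarrow> t < T \<longrightarrow> F t < c \<longrightarrow> (\<exists>u. t < u \<and> u \<le> T \<and> F u < c)"
      and Fb: "F T - F s \<le> real (Suc n) * \<epsilon>0" and R: "norm (x s) \<le> R"
      and l: "\<forall>r\<in>{s..T}. norm (l r) \<le> Ml" and fin: "v_var p x s T < \<infinity>"
      using bs unfolding bounded_sol_def by blast+
    have I: "Lint Mf x a I" and J: "Lint Mg x z J" and x: "\<And>t. t \<ge> 0 \<Longrightarrow> x t = c + I t + J t + k t"
      using sol by (auto simp: sol_def)
    have Fa: "pcontrol 1 {s..T} a F" and Fz: "pcontrol p {s..T} z F" and Fs: "strict_mono_on {s..T} F"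
      using dr by (auto simp: driver_control_def)
    have "norm (l s) \<le> Ml" using l sT by simp
    then have Ml0: "Ml \<ge> 0" using norm_ge_zero[of "l s"] by linarith
    have R0: "R \<ge> 0" using R norm_ge_zero[of "x s"] by linarith
    have w1: "w \<ge> 1" using R0 Ml0 dd1 by (simp add: w_def)
    have W0: "W > 0" using w1 by (simp add: W_def)
    have Fmono: "F u \<le> F v" if "s \<le> u" "u \<le> v" "v \<le> T" for u v
      using pcontrol_mono[OF Fa, of u v] that by auto
    have finu: "v_var p x s u < \<infinity>" if "u \<in> {s..T}" for u
      using v_var_mono[of s u T p x] that fin by (auto intro: le_less_trans)
    define V where "V u = real_of_ereal (v_var p x s u)" for u
    have V: "pcontrol p {s..T} x V"
      unfolding V_def by (rule v_var_pcontrol) (use finu in auto)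
    have V0: "V u \<ge> 0" if "s \<le> u" for u unfolding V_def using v_var_nonneg[OF that, of p x] by (rule real_of_ereal_pos)
    have small: "V u \<le> W" if u: "s \<le> u" "u \<le> T" "F u - F s \<le> \<epsilon>0" for u
    proof -
      have "v_var p x s u \<le> ereal W"
        unfolding W_def w_def
      proof (rule small_step[OF sol sT(1) u(1) _ u(3) R])
        show "driver_control {s..u} a z F"
          using dr u unfolding driver_control_def by (auto intro: pcontrol_subset monotone_on_subset)
      qed (use l u finu in auto)
      then show ?thesis unfolding V_def using v_var_nonneg[OF u(1), of p x]
        by (cases "v_var p x s u") auto
    qed
    show ?thesis
    proof (cases "F T - F s \<le> \<epsilon>0")
      case True
      have "V u \<le> W + b' + \<bar>B2\<bar>" if "u \<in> {s..T}" for u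
      proof -
        have "V u \<le> W" using small[of u] Fmono[of u T] that True by auto
        moreover have "b' \<ge> 0" by (simp add: b'_def)
        ultimately show ?thesis by linarith
      qed
      then show ?thesis using V V0 by (intro exI[of _ V]) auto
    next
      case False
      define D where "D = {t\<in>{s..T}. \<epsilon>0 \<le> F t - F s}"
      define \<tau> where "\<tau> = Inf D"
      have TD: "T \<in> D" using False sT by (auto simp: D_def)
      have bdd: "bdd_below D" by (auto simp: D_def intro!: bdd_belowI[of _ s])
      have \<tau>: "s \<le> \<tau>" "\<tau> \<le> T"
      proof -
        have "D \<noteq> {}" using TD by blast
        then show "s \<le> \<tau>" unfolding \<tau>_def by (rule cInf_greatest) (simp add: D_def)
        show "\<tau> \<le> T" unfolding \<tau>_def by (rule cInf_lower[OF TD bdd])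
      qed
      have \<tau>l: "F t - F s < \<epsilon>0" if "s \<le> t" "t < \<tau>" for t
      proof (rule ccontr)
        assume "\<not> F t - F s < \<epsilon>0"
        then have "t \<in> D" using that \<tau> by (auto simp: D_def)
        then have "\<tau> \<le> t" unfolding \<tau>_def using bdd by (rule cInf_lower)
        then show False using that by simp
      qed
      \<comment> \<open>The infimum belongs to D by right-continuity of F. So a full portion of
        control is used up at \<tau>, leaving at most n portions for the rest.\<close>
      have \<tau>D: "\<epsilon>0 \<le> F \<tau> - F s"
      proof (rule ccontr)
        assume "\<not> \<epsilon>0 \<le> F \<tau> - F s"
        then have lt: "F \<tau> < F s + \<epsilon>0" by simp
        have "\<tau> < T" using lt TD \<tau> by (cases "\<tau> = T") (auto simp: D_def)
        then obtain u where u: "u > \<tau>" "u \<le> T" "F u < F s + \<epsilon>0" using rc lt \<tau> by blast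
        obtain t where t: "t \<in> D" "t < u" using cInf_lessD[of D u] TD u by (auto simp: \<tau>_def)
        have "F t \<ge> F s + \<epsilon>0" using t by (auto simp: D_def)
        moreover have "F t \<le> F u" using Fmono[of t u] t u by (auto simp: D_def)
        ultimately show False using u by linarith
      qed
      have st: "s < \<tau>" using \<tau>D \<epsilon>0(1) \<tau> by (cases "s = \<tau>") auto
      have VW: "V r \<le> W" if "s \<le> r" "r < \<tau>" for r
        using small[of r] \<tau>l[of r] that \<tau> by auto
      have xR: "norm (x r) \<le> R + w" if "s \<le> r" "r < \<tau>" for r
      proof -
        have "norm (x r - x s) \<le> (V r - V s) powr (1/p)" using that \<tau> by (intro pcontrol_norm[OF V p0]) auto
        also have "\<dots> \<le> W powr (1/p)"
          using VW[OF that] V0[of s] pcontrol_mono[OF V, of s r] that \<tau> p0 by (intro powr_mono2) auto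
        also have "\<dots> = w" using w1 p0 by (simp add: W_def powr_powr)
        finally show ?thesis using R norm_triangle_sub[of "x r" "x s"] by linarith
      qed
      have Fb': "0 \<le> F r - F s" "F r - F s \<le> b" if "s \<le> r" "r \<le> \<tau>" for r
        using Fmono[of s r] Fmono[of r T] Fb that \<tau> by (auto simp: b_def)
      have Y: "norm (I r - I s) + norm (J r - J s) \<le> Y" if r: "s \<le> r" "r \<le> \<tau>" for r
      proof -
        have "norm (I r - I s) \<le> L * (1 + (R + w)) * (F r - F s)"
          using xR r \<tau> by (intro I_increment[OF I sT(1) r(1)]) (auto intro: pcontrol_subset[OF Fa])
        also have "\<dots> \<le> L * (1 + (R + w)) * b"
          using Fb'[OF r] L0 R0 w1 by (intro mult_left_mono) auto
        finally have 1: "norm (I r - I s) \<le> L * (1 + (R + w)) * b" .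
        have "norm (J r - J s) \<le> (G0 + C * R powr \<alpha> + K1 * C * W powr (\<alpha>/p)) * (F r - F s) powr (1/p)"
        proof (rule J_increment[OF J sT(1) r(1) W0])
          show "pcontrol p {s..<r} x V" using r \<tau> by (intro pcontrol_subset[OF V]) auto
          show "pcontrol p {s..r} z F" using r \<tau> by (intro pcontrol_subset[OF Fz]) auto
          show "F s < F r" if "s < r" using strict_mono_onD[OF Fs, of s r] r \<tau> that by auto
          show "V q - V s \<le> W" if "s \<le> q" "q < r" for q using VW[of q] V0[of s] that r by auto
        qed (use R R0 in auto)
        also have "\<dots> \<le> (G0 + C * R powr \<alpha> + K1 * C * W powr (\<alpha>/p)) * b powr (1/p)"
          using Fb'[OF r] G0_nonneg C0 K1_nonneg p0 by (intro mult_left_mono powr_mono2 add_nonneg_nonneg) auto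
        finally show ?thesis using 1 by (simp add: Y_def)
      qed
      have kk: "norm (k \<tau> - k s) \<le> dd * (2 * Ml + Y)"
      proof -
        have l': "\<And>r. s \<le> r \<Longrightarrow> r \<le> \<tau> \<Longrightarrow> norm (l r) \<le> Ml" using l \<tau> by auto
        show ?thesis using k_increment[OF sol sT(1) \<tau>(1) l' Y] by linarith
      qed
      have x\<tau>: "norm (x \<tau>) \<le> R2"
      proof -
        have "x \<tau> = x s + (I \<tau> - I s) + (J \<tau> - J s) + (k \<tau> - k s)"
          using x[of s] x[of \<tau>] sT st by simp
        then have "norm (x \<tau>) \<le> norm (x s) + norm (I \<tau> - I s) + norm (J \<tau> - J s) + norm (k \<tau> - k s)"
          using norm_add3_le[of "x s" "I \<tau> - I s" "J \<tau> - J s"]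
            norm_triangle_ineq[of "x s + (I \<tau> - I s) + (J \<tau> - J s)" "k \<tau> - k s"] by simp
        then show ?thesis using R Y[of \<tau>] kk \<tau> by (simp add: R2_def)
      qed
      have "\<exists>G. pcontrol p {\<tau>..T} x G \<and> (\<forall>t\<in>{\<tau>..T}. 0 \<le> G t \<and> G t \<le> B2)"
      proof (rule B2, unfold bounded_sol_def, intro conjI)
        show "0 \<le> \<tau>" using sT st by simp
        show "driver_control {\<tau>..T} a z F"
          using dr \<tau> unfolding driver_control_def by (auto intro: pcontrol_subset monotone_on_subset)
        show "\<forall>t c. \<tau> \<le> t \<longrightarrow> t < T \<longrightarrow> F t < c \<longrightarrow> (\<exists>u. t < u \<and> u \<le> T \<and> F u < c)" using rc \<tau> by auto
        have "real (Suc n) * \<epsilon>0 = real n * \<epsilon>0 + \<epsilon>0" by (simp add: algebra_simps)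
        then show "F T - F \<tau> \<le> real n * \<epsilon>0" using Fb \<tau>D by linarith
        show "\<forall>r\<in>{\<tau>..T}. norm (l r) \<le> Ml" using l \<tau> by auto
        have "v_var p x \<tau> T \<le> ereal (V T - V \<tau>)"
          using \<tau> by (intro v_var_le pcontrol_subset[OF V]) auto
        then show "v_var p x \<tau> T < \<infinity>" by auto
      qed (use sol \<tau> x\<tau> in auto)
      then obtain G2 where G2: "pcontrol p {\<tau>..T} x G2" "\<And>t. \<tau> \<le> t \<Longrightarrow> t \<le> T \<Longrightarrow> 0 \<le> G2 t \<and> G2 t \<le> B2" by auto
      have xR2: "norm (x r) \<le> R2 + B2 powr (1/p)" if "\<tau> \<le> r" "r \<le> T" for r
      proof -
        have "norm (x r - x \<tau>) \<le> (G2 r - G2 \<tau>) powr (1/p)" using that \<tau> by (intro pcontrol_norm[OF G2(1) p0]) auto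
        also have "\<dots> \<le> B2 powr (1/p)"
          using G2(2)[OF that] G2(2)[of \<tau>] \<tau> pcontrol_mono[OF G2(1), of \<tau> r] that p0 by (intro powr_mono2) auto
        finally show ?thesis using x\<tau> norm_triangle_sub[of "x r" "x \<tau>"] by linarith
      qed
      \<comment> \<open>The old control stays below W before \<tau>. Starting the new one at W + b'
        leaves at least \<open>b'\<close> for any increment of x from before \<tau> to after
        it.\<close>
      define G where "G t = (if t < \<tau> then V t else W + b' + G2 t)" for t
      have b'0: "b' \<ge> 0" by (simp add: b'_def)
      have "pcontrol p {s..T} x G"
        unfolding pcontrol_def
      proof (intro ballI impI)
        fix u v assume "u \<in> {s..T}" "v \<in> {s..T}" "u \<le> v"
        then have uv: "s \<le> u" "u \<le> v" "v \<le> T" by auto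
        consider "v < \<tau>" | "u < \<tau>" "\<tau> \<le> v" | "\<tau> \<le> u" by linarith
        then show "norm (x v - x u) powr p \<le> G v - G u"
        proof cases
          case 1
          then show ?thesis using pcontrolD[OF V, of u v] uv by (auto simp: G_def)
        next
          case 2
          have "norm (x v - x u) \<le> norm (x v) + norm (x u)" by (rule norm_triangle_ineq4)
          also have "\<dots> \<le> R + w + R2 + B2 powr (1/p)" using xR[of u] xR2[of v] 2 uv by auto
          finally have "norm (x v - x u) powr p \<le> b'" unfolding b'_def using p0 by (intro powr_mono2) auto
          also have "\<dots> \<le> G v - G u" using VW[of u] G2(2)[of v] 2 uv by (auto simp: G_def)
          finally show ?thesis .
        next
          case 3
          then show ?thesis using pcontrolD[OF G2(1), of u v] uv by (auto simp: G_def)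
        qed
      qed
      moreover have "0 \<le> G t \<and> G t \<le> W + b' + \<bar>B2\<bar>" if "t \<in> {s..T}" for t
        using V0[of t] VW[of t] G2(2)[of t] that W0 b'0 by (auto simp: G_def)
      ultimately show ?thesis by blast
    qed
  qed
  then show ?case by (intro exI[of _ "W + b' + \<bar>B2\<bar>"]) blast
qed

end

subsection \<open>Limits of integrals\<close>

text \<open>With truncated subtraction the term at i = 0 vanishes. It sums errors that are charged
  to the preceding interval.\<close>

lemma sum_telescope_pred:
  fixes a :: "nat \<Rightarrow> real"
  shows "(\<Sum>i<m. a i - a (i - 1)) = a (m - 1) - a 0"
  by (induction m) (auto split: nat_diff_split simp: algebra_simps)

text \<open>D u v w stands for the error of approximating an integral over [u,w] with the integrand
  taken at v. The point v may lie before u, so the error is charged to the increment of E from the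
  smaller of the two; a monotone E of small total increase makes such errors summable over any
  subdivision.\<close>

definition error_control :: "real \<Rightarrow> real \<Rightarrow> real set \<Rightarrow> (real \<Rightarrow> real \<Rightarrow> real \<Rightarrow> 'e::real_normed_vector) \<Rightarrow> bool" where
  "error_control T e S D \<longleftrightarrow> (\<exists>E. (\<forall>s t. 0 \<le> s \<longrightarrow> s \<le> t \<longrightarrow> t \<le> T \<longrightarrow> E s \<le> E t) \<and> E T - E 0 \<le> e \<and>
     (\<forall>u v w. 0 \<le> u \<longrightarrow> u < w \<longrightarrow> 0 \<le> v \<longrightarrow> v < w \<longrightarrow> w \<le> T \<longrightarrow> S \<inter> {min u v<..<w} = {} \<longrightarrow>
        norm (D u v w) \<le> E w - (E (min u v) :: real)))"

text \<open>A tag \<open>\<xi>\<^sub>i\<close> is approximated from the left by points \<open>\<zeta>\<^sub>i\<close>, which may lie in the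
  preceding interval; this fails only for \<open>\<xi>\<^sub>i = Q\<^sub>i \<in> S\<close>, where instead the increment of \<open>z\<close>
  to the right of \<open>Q\<^sub>i\<close> is small.\<close>

lemma RS_has_limit:
  fixes M :: "'x::metric_space \<Rightarrow> 'c::real_normed_vector \<Rightarrow> 'e::real_normed_vector"
  assumes xs: "lu_conv xs x" and zs: "lu_conv zs z" and x: "cadlag x" and z: "cadlag z"
    and Is: "\<And>t. t \<ge> 0 \<Longrightarrow> (\<lambda>n. Is n t) \<longlonglongrightarrow> I t" and I0: "\<And>n. Is n 0 = 0"
    and M: "\<And>X Y y c. (X \<longlongrightarrow> y) sequentially \<Longrightarrow> (Y \<longlongrightarrow> c) sequentially \<Longrightarrow> (\<lambda>n. M (X n) (Y n)) \<longlonglongrightarrow> M y c"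
    and M1: "\<And>c. continuous_on UNIV (\<lambda>y. M y c)" and M2: "\<And>y. continuous_on UNIV (M y)"
    and M0: "\<And>y. M y 0 = 0"
    and T: "T \<ge> 0"
    and err: "\<And>e. e > 0 \<Longrightarrow> \<exists>S N. finite S \<and> (\<forall>n\<ge>N. error_control T e S
        (\<lambda>u v w. Is n w - Is n u - M (xs n v) (zs n w - zs n u)))"
  shows "RS_has M (leftlim x) z 0 T (I T)"
  unfolding RS_has_def
proof (intro allI impI)
  fix e :: real assume e: "e > 0"
  obtain S0 N where S0: "finite S0" and N: "\<And>n. n \<ge> N \<Longrightarrow> error_control T (e/8) S0
        (\<lambda>u v w. Is n w - Is n u - M (xs n v) (zs n w - zs n u))"
    using err[of "e/8"] e by auto
  define S where "S = insert 0 (insert T (S0 \<inter> {0..T}))"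
  have S: "finite S" "0 \<in> S" "T \<in> S" "S \<subseteq> {0..T}" using S0 T by (auto simp: S_def)
  \<comment> \<open>An error d is allowed for every subdivision point in S; at most
    \<open>card S\<close> intervals of any subdivision start there.\<close>
  define d where "d = e / (8 * real (card S))"
  have cS: "card S > 0" using S by (auto simp: card_gt_0_iff)
  have d: "d > 0" using e cS by (simp add: d_def)
  have "\<exists>b. s < b \<and> b < T \<and> (\<forall>u. s \<le> u \<longrightarrow> u \<le> b \<longrightarrow> norm (M (x s) (z u - z s) - M (leftlim x s) (z u - z s)) < d)"
    if s: "0 \<le> s" "s < T" for s
  proof -
    have "(z \<longlongrightarrow> z s) (at_right s)" using z s by (auto simp: cadlag_def)
    then have "((\<lambda>u. z u - z s) \<longlongrightarrow> z s - z s) (at_right s)" by (intro tendsto_intros)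
    then have "((\<lambda>u. M y (z u - z s)) \<longlongrightarrow> M y (z s - z s)) (at_right s)" for y
      by (rule continuous_on_tendsto_compose[OF M2]) auto
    then have "((\<lambda>u. M (x s) (z u - z s) - M (leftlim x s) (z u - z s)) \<longlongrightarrow> M (x s) (z s - z s) - M (leftlim x s) (z s - z s)) (at_right s)"
      by (intro tendsto_diff)
    then have "((\<lambda>u. M (x s) (z u - z s) - M (leftlim x s) (z u - z s)) \<longlongrightarrow> 0) (at_right s)" by (simp add: M0)
    then have "eventually (\<lambda>u. dist (M (x s) (z u - z s) - M (leftlim x s) (z u - z s)) 0 < d) (at_right s)"
      by (rule tendstoD) (rule d)
    then obtain b where b: "b > s" "\<And>u. s < u \<Longrightarrow> u < b \<Longrightarrow> norm (M (x s) (z u - z s) - M (leftlim x s) (z u - z s)) < d"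
      by (auto simp: eventually_at_right[OF less_add_one])
    define b' where "b' = (s + min b T) / 2"
    have b': "s < b'" "b' < b" "b' < T" using b s by (auto simp: b'_def min_def)
    have "norm (M (x s) (z u - z s) - M (leftlim x s) (z u - z s)) < d" if "s \<le> u" "u \<le> b'" for u
    proof (cases "u = s")
      case True
      then show ?thesis using d by (simp add: M0)
    next
      case False
      then show ?thesis using b(2)[of u] that b' by auto
    qed
    then show ?thesis using b' by blast
  qed
  then obtain b where b: "\<And>s. 0 \<le> s \<Longrightarrow> s < T \<Longrightarrow> s < b s \<and> b s < T \<and>
      (\<forall>u. s \<le> u \<longrightarrow> u \<le> b s \<longrightarrow> norm (M (x s) (z u - z s) - M (leftlim x s) (z u - z s)) < d)"
    by metis
  \<comment> \<open>The points b s force the interval starting at s \<in> S to be so short that,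
    against the increment of z over it, the values of x and of its left limit at s give almost the
    same term.\<close>
  define S' where "S' = S \<union> b ` (S - {T})"
  have bS: "0 < b s \<and> b s < T" if "s \<in> S - {T}" for s
  proof -
    have "0 \<le> s" "s < T" using that S(4) by force+
    then show ?thesis using b[of s] by auto
  qed
  have "subdivision (sorted_list_of_set S') 0 T"
  proof (rule subdivision_sorted_list_of_set)
    have "b s \<in> {0..T}" if "s \<in> S - {T}" for s using bS[OF that] by simp
    then show "S' \<subseteq> {0..T}" using S(4) unfolding S'_def by blast
  qed (use S in \<open>auto simp: S'_def\<close>)
  moreover have "norm ((\<Sum>i < length Q - 1. M (leftlim x (\<xi> i)) (z (Q ! Suc i) - z (Q ! i))) - I T) < e"
    if Q: "subdivision Q 0 T" and QS: "set (sorted_list_of_set S') \<subseteq> set Q"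
      and \<xi>: "\<forall>i < length Q - 1. Q ! i \<le> \<xi> i \<and> \<xi> i \<le> Q ! Suc i" for Q \<xi>
  proof -
    note D = subdivisionD[OF Q]
    define m where "m = length Q - 1"
    have QS': "S' \<subseteq> set Q" using QS S(1) by (simp add: S'_def)
    have Ql: "Q!i < Q!Suc i" if "i < m" for i using D(4)[of i "Suc i"] that by (simp add: m_def)
    have Qb: "0 \<le> Q!i" "Q!i \<le> T" if "i \<le> m" for i using D(6)[of i] that by (auto simp: m_def)
    have gap: "s \<le> Q!i \<or> Q!Suc i \<le> s" if i: "i < m" and "s \<in> set Q" for i s
    proof -
      obtain j where j: "j < length Q" "Q!j = s" using \<open>s \<in> set Q\<close> by (auto simp: in_set_conv_nth)
      show ?thesis using D(5)[of j i] D(5)[of "Suc i" j] j i by (cases "j \<le> i") (auto simp: m_def)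
    qed
    define c where "c i = z (Q ! Suc i) - z (Q ! i)" for i
    define h where "h = e / (8 * (real m + 1))"
    have h: "h > 0" using e by (simp add: h_def)
    have approx: "\<exists>\<zeta>. u \<le> \<zeta> \<and> \<zeta> < t \<and> norm (M (leftlim x t) a - M (x \<zeta>) a) < h" if ut: "0 \<le> u" "u < t" for u t a
    proof -
      have "((\<lambda>r. M (x r) a) \<longlongrightarrow> M (leftlim x t) a) (at_left t)"
        using continuous_on_tendsto_compose[OF M1 leftlim_tendsto[OF x]] ut by simp
      then have "eventually (\<lambda>r. dist (M (x r) a) (M (leftlim x t) a) < h) (at_left t)"
        by (rule tendstoD) (rule h)
      moreover have "eventually (\<lambda>r. u < r \<and> r < t) (at_left t)"
        using ut by (subst eventually_at_left[of u]) (auto intro!: exI[of _ u])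
      ultimately have "eventually (\<lambda>r. dist (M (x r) a) (M (leftlim x t) a) < h \<and> u < r \<and> r < t) (at_left t)"
        by (rule eventually_conj)
      then obtain r where "dist (M (x r) a) (M (leftlim x t) a) < h \<and> u < r \<and> r < t"
        using eventually_happens'[OF trivial_limit_at_left_real] by blast
      then show ?thesis by (intro exI[of _ r]) (auto simp: dist_norm norm_minus_commute)
    qed
    \<comment> \<open>At i = 0 truncated subtraction makes Q!(i - 1) the point 0. As 0 lies in S, a
      tag there is never moved into a preceding interval.\<close>
    have "\<exists>\<zeta>. Q!(i - 1) \<le> \<zeta> \<and> \<zeta> < Q!Suc i \<and> S0 \<inter> {min (Q!i) \<zeta><..<Q!Suc i} = {} \<and>
        norm (M (leftlim x (\<xi> i)) (c i) - M (x \<zeta>) (c i)) \<le> h + (if Q!i \<in> S then d else 0)" if i: "i < m" for i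
    proof -
      have \<xi>i: "Q!i \<le> \<xi> i" "\<xi> i \<le> Q!Suc i" using \<xi> i by (auto simp: m_def)
      have pred: "Q!(i-1) \<le> Q!i" using D(5)[of "i-1" i] i by (simp add: m_def)
      have noS: "S0 \<inter> {Q!i<..<Q!Suc i} = {}"
      proof -
        have "s \<notin> {Q!i<..<Q!Suc i}" if "s \<in> S0" for s
          using gap[OF i, of s] QS' that Qb[of i] Qb[of "Suc i"] i by (force simp: S'_def S_def)
        then show ?thesis by blast
      qed
      consider "Q!i < \<xi> i" | "\<xi> i = Q!i" "Q!i \<notin> S" | "\<xi> i = Q!i" "Q!i \<in> S" using \<xi>i by fastforce
      then show ?thesis
      proof cases
        case 1
        obtain \<zeta> where "Q!i \<le> \<zeta>" "\<zeta> < \<xi> i" "norm (M (leftlim x (\<xi> i)) (c i) - M (x \<zeta>) (c i)) < h"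
          using approx[of "Q!i" "\<xi> i" "c i"] 1 Qb[of i] i by auto
        then show ?thesis using \<xi>i pred noS d by (intro exI[of _ \<zeta>]) (auto simp: min_def)
      next
        case 2
        then have "i \<noteq> 0" using D(1) S(2) by (metis)
        then have i1: "i - 1 < m" "Suc (i - 1) = i" using i by auto
        obtain \<zeta> where \<zeta>: "Q!(i-1) \<le> \<zeta>" "\<zeta> < Q!i" "norm (M (leftlim x (\<xi> i)) (c i) - M (x \<zeta>) (c i)) < h"
          using approx[of "Q!(i-1)" "Q!i" "c i"] 2 Qb[of "i-1"] i1 Ql[of "i-1"] by auto
        have "s \<notin> {\<zeta><..<Q!Suc i}" if s: "s \<in> S0" for s
        proof
          assume s': "s \<in> {\<zeta><..<Q!Suc i}"
          then have "s \<in> S" using s Qb[of "i-1"] Qb[of "Suc i"] i \<zeta> i1 by (auto simp: S_def)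
          then have "s \<in> set Q" "s \<noteq> Q!i" using QS' 2 by (auto simp: S'_def)
          then show False using gap[OF i, of s] gap[OF i1(1), of s] i1(2) s' \<zeta> by auto
        qed
        then show ?thesis using \<zeta> Ql[OF i] d h by (intro exI[of _ \<zeta>]) (auto simp: min_def)
      next
        case 3
        have lt: "Q!i < T" using Ql[OF i] Qb[of "Suc i"] i by simp
        have "b (Q!i) \<in> set Q" using QS' 3 lt by (auto simp: S'_def)
        then have "Q!Suc i \<le> b (Q!i)" using gap[OF i, of "b (Q!i)"] b[of "Q!i"] Qb[of i] i lt by auto
        then have "norm (M (x (Q!i)) (c i) - M (leftlim x (Q!i)) (c i)) < d"
          unfolding c_def using b[of "Q!i"] Qb[of i] i lt Ql[OF i] by auto
        then show ?thesis using 3 pred Ql[OF i] noS h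
          by (intro exI[of _ "Q!i"]) (auto simp: norm_minus_commute)
      qed
    qed
    then obtain \<zeta> where \<zeta>: "\<And>i. i < m \<Longrightarrow> Q!(i - 1) \<le> \<zeta> i" "\<And>i. i < m \<Longrightarrow> \<zeta> i < Q!Suc i"
        "\<And>i. i < m \<Longrightarrow> S0 \<inter> {min (Q!i) (\<zeta> i)<..<Q!Suc i} = {}"
        "\<And>i. i < m \<Longrightarrow> norm (M (leftlim x (\<xi> i)) (c i) - M (x (\<zeta> i)) (c i)) \<le> h + (if Q!i \<in> S then d else 0)"
      by metis
    have \<zeta>0: "0 \<le> \<zeta> i" if "i < m" for i 
    proof -
      have "i - 1 \<le> m" using that by linarith
      then show ?thesis using \<zeta>(1)[OF that] Qb(1)[of "i-1"] by linarith
    qed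
    let ?X = "\<Sum>i<m. M (leftlim x (\<xi> i)) (c i)" and ?Z = "\<Sum>i<m. M (x (\<zeta> i)) (c i)"
    have 1: "norm (?X - ?Z) \<le> e/8 + e/8"
    proof -
      have "norm (?X - ?Z) \<le> (\<Sum>i<m. h + (if Q!i \<in> S then d else 0))"
        unfolding sum_subtractf[symmetric] using \<zeta>(4) by (intro sum_norm_le) auto
      also have "\<dots> = real m * h + (\<Sum>i\<in>{i\<in>{..<m}. Q!i \<in> S}. d)"
        by (simp only: sum.distrib sum.inter_filter[OF finite_lessThan]) simp
      also have "(\<Sum>i\<in>{i\<in>{..<m}. Q!i \<in> S}. d) \<le> real (card S) * d"
      proof -
        have "card {i\<in>{..<m}. Q!i \<in> S} \<le> card S"
        proof (rule card_inj_on_le[of "\<lambda>i. Q!i"])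
          show "inj_on (\<lambda>i. Q!i) {i\<in>{..<m}. Q!i \<in> S}"
            using D(10) by (auto simp: inj_on_def m_def nth_eq_iff_index_eq)
        qed (use S in auto)
        then show ?thesis using d by (simp add: mult_right_mono)
      qed
      also have "real (card S) * d = e/8" using cS by (simp add: d_def)
      also have "real m * h \<le> (real m + 1) * h" using h by simp
      also have "(real m + 1) * h = e/8"
      proof -
        have "a * (e / (8 * a)) = e / 8" if "a > 0" for a :: real using that by simp
        from this[of "real m + 1"] show ?thesis unfolding h_def by linarith
      qed
      finally show ?thesis by simp
    qed
    \<comment> \<open>For this fixed subdivision with fixed points \<zeta> i the sums are finite and
      converge with n, so an error bound uniform in n passes to the limit.\<close>
    have 2: "norm (I T - ?Z) \<le> e/4"
    proof (rule LIMSEQ_le_const2)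
      show "(\<lambda>n. norm (Is n T - (\<Sum>i<m. M (xs n (\<zeta> i)) (zs n (Q ! Suc i) - zs n (Q ! i))))) \<longlonglongrightarrow> norm (I T - ?Z)"
      proof (intro tendsto_norm tendsto_diff tendsto_sum)
        fix i assume i: "i \<in> {..<m}"
        show "(\<lambda>n. M (xs n (\<zeta> i)) (zs n (Q ! Suc i) - zs n (Q ! i))) \<longlonglongrightarrow> M (x (\<zeta> i)) (c i)"
          unfolding c_def using \<zeta>0[of i] Qb[of i] Qb[of "Suc i"] i
          by (intro M tendsto_diff lu_conv_tendsto[OF xs] lu_conv_tendsto[OF zs]) auto
      qed (use Is T in auto)
      show "\<exists>K. \<forall>n\<ge>K. norm (Is n T - (\<Sum>i<m. M (xs n (\<zeta> i)) (zs n (Q ! Suc i) - zs n (Q ! i)))) \<le> e/4"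
      proof (intro exI[of _ N] allI impI)
        fix n assume "n \<ge> N"
        then have "error_control T (e/8) S0 (\<lambda>u v w. Is n w - Is n u - M (xs n v) (zs n w - zs n u))" by (rule N)
        then obtain E where E: "\<And>s t. 0 \<le> s \<Longrightarrow> s \<le> t \<Longrightarrow> t \<le> T \<Longrightarrow> E s \<le> E t" "E T - E 0 \<le> e/8"
          "\<And>u v w. 0 \<le> u \<Longrightarrow> u < w \<Longrightarrow> 0 \<le> v \<Longrightarrow> v < w \<Longrightarrow> w \<le> T \<Longrightarrow> S0 \<inter> {min u v<..<w} = {} \<Longrightarrow>
            norm (Is n w - Is n u - M (xs n v) (zs n w - zs n u)) \<le> E w - E (min u v)"
          unfolding error_control_def by blast
        have tel: "(\<Sum>i<m. Is n (Q!Suc i) - Is n (Q!i)) = Is n T"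
          using sum_lessThan_telescope[of "\<lambda>i. Is n (Q!i)" m] D(1,2) I0 by (simp add: m_def)
        have "norm (Is n T - (\<Sum>i<m. M (xs n (\<zeta> i)) (zs n (Q ! Suc i) - zs n (Q ! i))))
          = norm (\<Sum>i<m. Is n (Q!Suc i) - Is n (Q!i) - M (xs n (\<zeta> i)) (zs n (Q ! Suc i) - zs n (Q ! i)))"
          unfolding tel[symmetric] by (simp add: sum_subtractf)
        \<comment> \<open>Since \<zeta> i may lie in the preceding interval, every interval of Q is
          charged at most twice.\<close>
        also have "\<dots> \<le> (\<Sum>i<m. (E (Q!Suc i) - E (Q!i)) + (E (Q!i) - E (Q!(i-1))))"
        proof (rule sum_norm_le)
          fix i assume i: "i \<in> {..<m}"
          then have "norm (Is n (Q!Suc i) - Is n (Q!i) - M (xs n (\<zeta> i)) (zs n (Q ! Suc i) - zs n (Q ! i)))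
             \<le> E (Q!Suc i) - E (min (Q!i) (\<zeta> i))"
            using \<zeta>(2,3)[of i] \<zeta>0[of i] Qb[of i] Qb[of "Suc i"] Ql[of i] by (intro E(3)) auto
          moreover have "E (Q!(i-1)) \<le> E (min (Q!i) (\<zeta> i))"
            using \<zeta>(1)[of i] D(5)[of "i-1" i] Qb[of i] Qb[of "i-1"] i by (intro E(1)) (auto simp: m_def)
          ultimately show "norm (Is n (Q!Suc i) - Is n (Q!i) - M (xs n (\<zeta> i)) (zs n (Q ! Suc i) - zs n (Q ! i)))
             \<le> (E (Q!Suc i) - E (Q!i)) + (E (Q!i) - E (Q!(i-1)))" by linarith
        qed
        also have "\<dots> = (E (Q!m) - E (Q!0)) + (E (Q!(m-1)) - E (Q!0))"
          unfolding sum.distrib sum_telescope_pred[of "\<lambda>i. E (Q!i)" m] sum_lessThan_telescope[of "\<lambda>i. E (Q!i)" m] ..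
        also have "\<dots> \<le> e/8 + e/8"
        proof -
          have "E (Q!(m-1)) \<le> E (Q!m)" using D(5)[of "m-1" m] Qb[of "m-1"] Qb[of m] by (intro E(1)) (auto simp: m_def)
          then show ?thesis using E(2) D(1,2) by (simp add: m_def)
        qed
        finally show "norm (Is n T - (\<Sum>i<m. M (xs n (\<zeta> i)) (zs n (Q ! Suc i) - zs n (Q ! i)))) \<le> e/4" by simp
      qed
    qed
    have "norm (?X - I T) \<le> norm (?X - ?Z) + norm (I T - ?Z)"
      using norm_triangle_ineq4[of "?X - ?Z" "I T - ?Z"] by simp
    also have "\<dots> < e" using 1 2 e by linarith
    finally show ?thesis by (simp add: c_def m_def)
  qed
  ultimately show "\<exists>P. subdivision P 0 T \<and> (\<forall>Q \<xi>. subdivision Q 0 T \<and> set P \<subseteq> set Q \<and>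
      (\<forall>i < length Q - 1. Q ! i \<le> \<xi> i \<and> \<xi> i \<le> Q ! Suc i) \<longrightarrow>
      norm ((\<Sum>i < length Q - 1. M (leftlim x (\<xi> i)) (z (Q ! Suc i) - z (Q ! i))) - I T) < e)"
    by blast
qed

lemma small_powr:
  fixes K e \<eta> :: real
  assumes "K \<ge> 0" "e > 0" "\<eta> > 0"
  obtains \<delta> where "\<delta> > 0" "K * \<delta> powr \<eta> \<le> e"
proof (rule that[of "(e / (K + 1)) powr (1/\<eta>)"])
  show "(e / (K + 1)) powr (1/\<eta>) > 0" using assms by simp
  have "K * ((e / (K + 1)) powr (1/\<eta>)) powr \<eta> = K * (e / (K + 1))" using assms by (simp add: powr_powr)
  also have "\<dots> \<le> e" using assms by (simp add: field_simps)
  finally show "K * ((e / (K + 1)) powr (1/\<eta>)) powr \<eta> \<le> e" .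
qed

section \<open>Interpolated estimates for the integrals\<close>

context young_sde
begin

text \<open>Half of the slack 1 + \<alpha> - p. After removing \<eta>0 from either of the exponents
  \<alpha> and 1, the rest divided by p is \<theta>0, which still exceeds 1.\<close>

definition \<eta>0 :: real where "\<eta>0 = (1 + \<alpha> - p) / 2"
definition \<theta>0 :: real where "\<theta>0 = 1 + \<eta>0 / p"

lemma \<eta>0: "0 < \<eta>0" "\<eta>0 < 1" "\<eta>0 < \<alpha>"
  using p1 \<alpha> by (auto simp: \<eta>0_def)

lemma \<theta>0: "\<theta>0 > 1" using \<eta>0(1) p0 by (simp add: \<theta>0_def)

text \<open>A little of the exponent is spent on the smallness \<open>\<delta>\<close>, keeping the total power of the
  control above \<open>1\<close>.\<close>

lemma prod_bound:
  fixes X Z h \<delta> :: real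
  assumes X: "0 \<le> X" "X powr p \<le> h" and Z: "0 \<le> Z" "Z powr p \<le> h" and \<delta>: "X \<le> \<delta> \<or> Z \<le> \<delta>"
  shows "X powr \<alpha> * Z \<le> \<delta> powr \<eta>0 * h powr \<theta>0"
proof (cases "X = 0 \<or> Z = 0")
  case True
  then show ?thesis by auto
next
  case False
  then have pos: "X > 0" "Z > 0" using X Z by auto
  have Xh: "X \<le> h powr (1/p)" and Zh: "Z \<le> h powr (1/p)" using le_powr_inverse X Z p0 by auto
  have hh: "h powr ((q::real) / p) = (h powr (1/p)) powr q" for q by (simp add: powr_powr)
  have th: "\<theta>0 = (\<alpha> - \<eta>0) / p + 1 / p" "\<theta>0 = \<alpha> / p + (1 - \<eta>0) / p"
    using p0 by (auto simp: \<theta>0_def \<eta>0_def field_simps)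
  show ?thesis
    using \<delta>
  proof
    assume d: "X \<le> \<delta>"
    have "X powr \<alpha> * Z = X powr \<eta>0 * (X powr (\<alpha> - \<eta>0) * Z)" using pos by (simp add: powr_diff)
    also have "\<dots> \<le> \<delta> powr \<eta>0 * ((h powr (1/p)) powr (\<alpha> - \<eta>0) * h powr (1/p))"
      using d Xh Zh pos \<eta>0 by (intro mult_mono powr_mono2) auto
    also have "\<dots> = \<delta> powr \<eta>0 * h powr \<theta>0"
      unfolding th(1) powr_add hh[of "\<alpha> - \<eta>0"] by simp
    finally show ?thesis .
  next
    assume d: "Z \<le> \<delta>"
    have "X powr \<alpha> * Z = Z powr \<eta>0 * (X powr \<alpha> * Z powr (1 - \<eta>0))" using pos by (simp add: powr_diff)
    also have "\<dots> \<le> \<delta> powr \<eta>0 * ((h powr (1/p)) powr \<alpha> * (h powr (1/p)) powr (1 - \<eta>0))"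
      using d Xh Zh pos \<eta>0 \<alpha>0 by (intro mult_mono powr_mono2) auto
    also have "\<dots> = \<delta> powr \<eta>0 * h powr \<theta>0"
      unfolding th(2) powr_add hh[of \<alpha>] hh[of "1 - \<eta>0"] by simp
    finally show ?thesis .
  qed
qed

definition total_control :: "real \<Rightarrow> real \<Rightarrow> (real \<Rightarrow> real^'d) \<Rightarrow> (real \<Rightarrow> real) \<Rightarrow> (real \<Rightarrow> real^'d) \<Rightarrow> (real \<Rightarrow> real) \<Rightarrow> bool" where
  "total_control T B x a z H \<longleftrightarrow> pcontrol p {0..T} x H \<and> pcontrol 1 {0..T} a H \<and> pcontrol p {0..T} z H \<and>
     (\<forall>t\<in>{0..T}. 0 \<le> H t \<and> H t \<le> B)"

lemma total_controlD:
  assumes "total_control T B x a z H"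
  shows "pcontrol p {0..T} x H" "pcontrol 1 {0..T} a H" "pcontrol p {0..T} z H"
    and "\<And>t. 0 \<le> t \<Longrightarrow> t \<le> T \<Longrightarrow> 0 \<le> H t" "\<And>t. 0 \<le> t \<Longrightarrow> t \<le> T \<Longrightarrow> H t \<le> B"
    and "\<And>s t. 0 \<le> s \<Longrightarrow> s \<le> t \<Longrightarrow> t \<le> T \<Longrightarrow> H s \<le> H t"
    and "\<And>s t. 0 \<le> s \<Longrightarrow> s \<le> t \<Longrightarrow> t \<le> T \<Longrightarrow> H t - H s \<le> B"
proof -
  show 1: "pcontrol p {0..T} x H" "pcontrol 1 {0..T} a H" "pcontrol p {0..T} z H"
    and 2: "\<And>t. 0 \<le> t \<Longrightarrow> t \<le> T \<Longrightarrow> 0 \<le> H t" "\<And>t. 0 \<le> t \<Longrightarrow> t \<le> T \<Longrightarrow> H t \<le> B"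
    using assms by (auto simp: total_control_def)
  show "H s \<le> H t" if "0 \<le> s" "s \<le> t" "t \<le> T" for s t using pcontrol_mono[OF 1(1), of s t] that by auto
  show "H t - H s \<le> B" if "0 \<le> s" "s \<le> t" "t \<le> T" for s t using 2(1)[of s] 2(2)[of t] that by auto
qed

text \<open>Smallness of either path on the interval makes the remainder small. Small z is used to
  find a convergent subsequence, before anything is known about the oscillation of x; small x is
  used afterwards to identify the limit.\<close>

lemma J_error:
  assumes J: "Lint Mg x z J" and H: "total_control T B x a z H" and uv: "0 \<le> u" "u < v" "v \<le> T"
    and \<delta>: "(\<forall>r s. u \<le> r \<longrightarrow> r \<le> s \<longrightarrow> s < v \<longrightarrow> norm (x s - x r) \<le> \<delta>) \<or>
            (\<forall>r s. u \<le> r \<longrightarrow> r \<le> s \<longrightarrow> s \<le> v \<longrightarrow> norm (z s - z r) \<le> \<delta>)"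
  shows "norm (J v - J u - Mg (x u) (z v - z u)) \<le> sew_const \<theta>0 * (C * \<delta> powr \<eta>0) * (H v - H u) powr \<theta>0"
proof (rule Lint_young[OF J uv(1,2) Mg_diff \<theta>0])
  note H = total_controlD[OF H]
  show "0 \<le> C * \<delta> powr \<eta>0" using C0 by simp
  show "H s \<le> H t" if "u \<le> s" "s \<le> t" "t \<le> v" for s t using H(6)[of s t] that uv by auto
  fix r s t assume rst: "u \<le> r" "r \<le> s" "s < t" "t \<le> v"
  have "norm (x s - x r) powr p \<le> H s - H r" "norm (z t - z s) powr p \<le> H t - H s"
    using pcontrolD[OF H(1), of r s] pcontrolD[OF H(3), of s t] rst uv by auto
  then have "norm (x s - x r) powr p \<le> H t - H r" "norm (z t - z s) powr p \<le> H t - H r"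
    using H(6)[of r s] H(6)[of s t] rst uv by auto
  moreover have "norm (x s - x r) \<le> \<delta> \<or> norm (z t - z s) \<le> \<delta>" using \<delta> rst by auto
  ultimately have "norm (x s - x r) powr \<alpha> * norm (z t - z s) \<le> \<delta> powr \<eta>0 * (H t - H r) powr \<theta>0"
    by (intro prod_bound) auto
  then have "C * (norm (x s - x r) powr \<alpha> * norm (z t - z s)) \<le> C * (\<delta> powr \<eta>0 * (H t - H r) powr \<theta>0)"
    using C0 by (intro mult_left_mono) auto
  then show "norm (Mg (x s) (z t - z s) - Mg (x r) (z t - z s)) \<le> C * \<delta> powr \<eta>0 * (H t - H r) powr \<theta>0"
    using Mg_holder[of "x s" "z t - z s" "x r"] by (simp add: mult.assoc)
qed

text \<open>Replaces the power by a bound linear in the increment of control, so that errors over a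
  subdivision can be added.\<close>

lemma powr_\<theta>0_le:
  assumes "0 \<le> h" "h \<le> B"
  shows "h powr \<theta>0 \<le> B powr (\<eta>0 / p) * h"
proof -
  have "h powr \<theta>0 = h powr (\<eta>0/p) * h"
    using assms by (cases "h = 0") (auto simp: \<theta>0_def powr_add)
  also have "\<dots> \<le> B powr (\<eta>0 / p) * h"
    using assms \<eta>0 p0 by (intro mult_right_mono powr_mono2) auto
  finally show ?thesis .
qed

text \<open>Two errors of the same form: the Young remainder with the integrand at u, and the change
  of the integrand from u to v. Both gain the factor \<delta> powr \<eta>0 from the small
  oscillation of x.\<close>

lemma J_limit_error:
  assumes J: "Lint Mg x z J" and H: "total_control T B x a z H"
    and uvw: "0 \<le> u" "u < w" "0 \<le> v" "v < w" "w \<le> T"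
    and \<delta>: "\<And>r s. min u v \<le> r \<Longrightarrow> r \<le> s \<Longrightarrow> s < w \<Longrightarrow> norm (x s - x r) \<le> \<delta>"
  defines "K \<equiv> (sew_const \<theta>0 + 1) * C * B powr (\<eta>0 / p) * \<delta> powr \<eta>0"
  shows "norm (J w - J u - Mg (x v) (z w - z u)) \<le> K * H w - K * H (min u v)"
proof -
  let ?m = "min u v"
  note HD = total_controlD[OF H]
  have m: "0 \<le> ?m" "?m < w" "?m \<le> u" "?m \<le> v" using uvw by auto
  have h: "H u \<le> H w" "H ?m \<le> H u" "0 \<le> H w - H ?m" "H w - H ?m \<le> B"
    using HD(6)[of u w] HD(6)[of ?m u] HD(6)[of ?m w] HD(7)[of ?m w] uvw m by auto
  have 1: "norm (J w - J u - Mg (x u) (z w - z u)) \<le> sew_const \<theta>0 * (C * \<delta> powr \<eta>0) * (H w - H u) powr \<theta>0"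
    using \<delta> m by (intro J_error[OF J H]) (use uvw in auto)
  have le: "(H w - H u) powr \<theta>0 \<le> (H w - H ?m) powr \<theta>0" using h \<theta>0 by (intro powr_mono2) auto
  have "norm (x v - x u) \<le> \<delta>"
    using \<delta>[of u v] \<delta>[of v u] uvw by (cases "u \<le> v") (auto simp: norm_minus_commute)
  moreover have "norm (x v - x u) powr p \<le> H w - H ?m"
  proof (cases "u \<le> v")
    case True
    then show ?thesis using pcontrolD[OF HD(1), of u v] HD(6)[of v w] uvw by auto
  next
    case False
    then show ?thesis using pcontrolD[OF HD(1), of v u] HD(6)[of u w] uvw by (auto simp: norm_minus_commute)
  qed
  moreover have "norm (z w - z u) powr p \<le> H w - H ?m" using pcontrolD[OF HD(3), of u w] uvw h by auto
  ultimately have "norm (x v - x u) powr \<alpha> * norm (z w - z u) \<le> \<delta> powr \<eta>0 * (H w - H ?m) powr \<theta>0"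
    by (intro prod_bound) auto
  then have "C * (norm (x v - x u) powr \<alpha> * norm (z w - z u)) \<le> C * (\<delta> powr \<eta>0 * (H w - H ?m) powr \<theta>0)"
    using C0 by (intro mult_left_mono) auto
  then have 2: "norm (Mg (x v) (z w - z u) - Mg (x u) (z w - z u)) \<le> C * \<delta> powr \<eta>0 * (H w - H ?m) powr \<theta>0"
    using Mg_holder[of "x v" "z w - z u" "x u"] by (simp add: mult.assoc)
  have "norm (a - b) \<le> norm (a - c) + norm (b - c)" for a b c :: "real^'d"
    using norm_triangle_ineq4[of "a - c" "b - c"] by simp
  then have "norm (J w - J u - Mg (x v) (z w - z u)) \<le> norm (J w - J u - Mg (x u) (z w - z u))
      + norm (Mg (x v) (z w - z u) - Mg (x u) (z w - z u))" .
  also have "\<dots> \<le> sew_const \<theta>0 * (C * \<delta> powr \<eta>0) * (H w - H ?m) powr \<theta>0 + C * \<delta> powr \<eta>0 * (H w - H ?m) powr \<theta>0"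
    using 1 2 mult_left_mono[OF le, of "sew_const \<theta>0 * (C * \<delta> powr \<eta>0)"] sew_const_props(1)[OF \<theta>0] C0
    by (auto intro: order_trans add_mono)
  also have "\<dots> = (sew_const \<theta>0 + 1) * C * \<delta> powr \<eta>0 * (H w - H ?m) powr \<theta>0" by (simp add: algebra_simps)
  also have "\<dots> \<le> (sew_const \<theta>0 + 1) * C * \<delta> powr \<eta>0 * (B powr (\<eta>0 / p) * (H w - H ?m))"
    using powr_\<theta>0_le[OF h(3,4)] sew_const_props(1)[OF \<theta>0] C0 by (intro mult_left_mono) auto
  finally show ?thesis by (simp add: K_def algebra_simps)
qed

lemma I_limit_error:
  assumes I: "Lint Mf x a I" and H: "total_control T B x a z H"
    and uvw: "0 \<le> u" "u < w" "0 \<le> v" "v < w" "w \<le> T"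
    and \<omega>: "\<And>r s. min u v \<le> r \<Longrightarrow> r < w \<Longrightarrow> min u v \<le> s \<Longrightarrow> s < w \<Longrightarrow> norm (f (x s) - f (x r)) \<le> \<omega>"
  shows "norm (I w - I u - Mf (x v) (a w - a u)) \<le> \<omega> * H w - \<omega> * H (min u v)"
proof -
  note HD = total_controlD[OF H]
  have \<omega>0: "\<omega> \<ge> 0" using \<omega>[of u u] uvw by auto
  have "norm (I w - I u - Mf (x v) (a w - a u)) \<le> \<omega> * H w - \<omega> * H u"
  proof (rule Lint_telescope[OF I uvw(1,2)])
    fix s t assume st: "u \<le> s" "s < t" "t \<le> w"
    have "norm (Mf (x s) (a t - a s) - Mf (x v) (a t - a s)) = \<bar>a t - a s\<bar> * norm (f (x s) - f (x v))"
      by (simp add: scaleR_diff_right[symmetric])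
    also have "\<dots> \<le> (H t - H s) * \<omega>"
      using pcontrol_1_norm[OF HD(2), of s t] \<omega>[of v s] st uvw by (intro mult_mono) auto
    finally show "norm (Mf (x s) (a t - a s) - Mf (x v) (a t - a s)) \<le> \<omega> * H t - \<omega> * H s"
      by (simp add: algebra_simps)
  qed (rule Mf_diff)
  also have "\<dots> \<le> \<omega> * H w - \<omega> * H (min u v)"
    using HD(6)[of "min u v" u] uvw \<omega>0 by (intro diff_left_mono mult_left_mono) auto
  finally show ?thesis .
qed

text \<open>Only z has to oscillate little: the first-order term is linear in \<delta>, and the
  remainder gains a power of \<delta> although x is merely of bounded p-variation.\<close>

lemma J_osc:
  assumes J: "Lint Mg x z J" and H: "total_control T B x a z H" and uv: "0 \<le> u" "u < v" "v \<le> T"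
    and R: "norm (x u) \<le> R" and \<delta>: "\<And>r s. u \<le> r \<Longrightarrow> r \<le> s \<Longrightarrow> s \<le> v \<Longrightarrow> norm (z s - z r) \<le> \<delta>"
  shows "norm (J v - J u) \<le> (G0 + C * R powr \<alpha>) * \<delta> + sew_const \<theta>0 * C * B powr \<theta>0 * \<delta> powr \<eta>0"
proof -
  note HD = total_controlD[OF H]
  have R0: "R \<ge> 0" using R norm_ge_zero[of "x u"] by linarith
  have 1: "norm (J v - J u - Mg (x u) (z v - z u)) \<le> sew_const \<theta>0 * (C * \<delta> powr \<eta>0) * (H v - H u) powr \<theta>0"
    using \<delta> by (intro J_error[OF J H uv]) auto
  also have "\<dots> \<le> sew_const \<theta>0 * (C * \<delta> powr \<eta>0) * B powr \<theta>0"
    using HD(6)[of u v] HD(7)[of u v] uv \<theta>0 C0 sew_const_props(1)[OF \<theta>0] by (intro mult_left_mono powr_mono2) auto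
  finally have 1: "norm (J v - J u - Mg (x u) (z v - z u)) \<le> sew_const \<theta>0 * C * B powr \<theta>0 * \<delta> powr \<eta>0"
    by (simp add: algebra_simps)
  have "norm (Mg (x u) (z v - z u)) \<le> (G0 + C * norm (x u) powr \<alpha>) * norm (z v - z u)"
    by (rule Mg_bound)
  also have "\<dots> \<le> (G0 + C * R powr \<alpha>) * \<delta>"
    using R \<alpha>0 C0 G0_nonneg \<delta>[of u v] uv R0
    by (intro mult_mono add_left_mono mult_left_mono powr_mono2 add_nonneg_nonneg) auto
  finally show ?thesis using 1 norm_triangle_sub[of "J v - J u" "Mg (x u) (z v - z u)"] by linarith
qed

text \<open>The variation of a over [u,v] may be large although its oscillation is small, so the
  size of f times this variation is useless. But f along x changes by more than \<omega> only after
  H has gained d powr p, hence a bounded number of times, and between two such moments only one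
  increment of a counts.\<close>

lemma I_osc:
  assumes I: "Lint Mf x a I" and H: "total_control T B x a z H" and uv: "0 \<le> u" "u < v" "v \<le> T"
    and R: "\<And>r. u \<le> r \<Longrightarrow> r \<le> v \<Longrightarrow> norm (x r) \<le> R"
    and \<delta>: "\<And>r s. u \<le> r \<Longrightarrow> r \<le> s \<Longrightarrow> s \<le> v \<Longrightarrow> \<bar>a s - a r\<bar> \<le> \<delta>"
    and d: "d > 0" and \<omega>: "\<And>y y'. norm y \<le> R \<Longrightarrow> norm y' \<le> R \<Longrightarrow> norm (y - y') < d \<Longrightarrow> norm (f y - f y') \<le> \<omega>"
    and \<omega>0: "\<omega> \<ge> 0"
  shows "norm (I v - I u) \<le> \<omega> * B + (1 + B / d powr p) * (L * (1 + R) * \<delta>)"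
proof -
  note HD = total_controlD[OF H]
  have R0: "R \<ge> 0" using R[of u] norm_ge_zero[of "x u"] uv by linarith
  have \<delta>0: "\<delta> \<ge> 0" using \<delta>[of u u] uv by simp
  have "norm (I v - I u) \<le> \<omega> * (H v - H u) + (1 + (H v - H u) / d powr p) * (L * (1 + R) * \<delta>)"
  proof (rule Lint_count[OF I uv(1,2) Mf_diff])
    show "d powr p > 0" using d by simp
    show "0 \<le> L * (1 + R)" using L0 R0 by simp
    show "H s \<le> H t" if "u \<le> s" "s \<le> t" "t \<le> v" for s t using HD(6)[of s t] that uv by auto
    show "norm (a t - a s) \<le> H t - H s" if "u \<le> s" "s \<le> t" "t \<le> v" for s t
      using pcontrol_1_norm[OF HD(2), of s t] that uv by auto
    show "norm (a t - a s) \<le> \<delta>" if "u \<le> s" "s \<le> t" "t \<le> v" for s t using \<delta>[of s t] that by simp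
    fix s c assume s: "u \<le> s" "s \<le> v"
    have "norm (f (x s)) \<le> L * (1 + norm (x s))" by (rule f_lin)
    also have "\<dots> \<le> L * (1 + R)" using R[of s] s L0 by simp
    finally have "\<bar>c\<bar> * norm (f (x s)) \<le> \<bar>c\<bar> * (L * (1 + R))" by (intro mult_left_mono) auto
    then show "norm (Mf (x s) c) \<le> L * (1 + R) * norm c" by (simp add: mult.commute)
  next
    fix r s c assume rs: "u \<le> r" "r \<le> s" "s \<le> v" "H s - H r < d powr p"
    have "norm (x s - x r) \<le> (H s - H r) powr (1/p)" using rs uv by (intro pcontrol_norm[OF HD(1) p0]) auto
    also have "\<dots> < (d powr p) powr (1/p)" using rs HD(6)[of r s] uv p0 by (intro powr_less_mono2) auto
    also have "\<dots> = d" using d p0 by (simp add: powr_powr)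
    finally have "norm (f (x s) - f (x r)) \<le> \<omega>" using R[of s] R[of r] rs by (intro \<omega>) auto
    then have "\<bar>c\<bar> * norm (f (x s) - f (x r)) \<le> \<bar>c\<bar> * \<omega>" by (intro mult_left_mono) auto
    then show "norm (Mf (x s) c - Mf (x r) c) \<le> \<omega> * norm c"
      by (simp add: scaleR_diff_right[symmetric] mult.commute)
  qed (use \<omega>0 \<delta>0 in auto)
  also have "\<dots> \<le> \<omega> * B + (1 + B / d powr p) * (L * (1 + R) * \<delta>)"
    using HD(7)[of u v] uv \<omega>0 L0 R0 \<delta>0 d
    by (intro add_mono mult_left_mono mult_right_mono divide_right_mono) auto
  finally show ?thesis .
qed

end

subsection \<open>Compactness for locally uniformly convergent drivers\<close>

text \<open>A partition for the limit path serves all late n.\<close>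

lemma lu_conv_osc:
  assumes lu: "lu_conv xs x" and x: "cadlag x" and T: "0 \<le> T" and d: "\<delta> > 0"
  obtains S N where "finite S" "\<And>n u v. n \<ge> N \<Longrightarrow> 0 \<le> u \<Longrightarrow> u \<le> v \<Longrightarrow> v \<le> T \<Longrightarrow> S \<inter> {u<..v} = {} \<Longrightarrow>
    dist (xs n u) (xs n v) \<le> \<delta>"
proof -
  obtain S where S: "finite S"
    "\<And>u v. 0 \<le> u \<Longrightarrow> u \<le> v \<Longrightarrow> v \<le> T \<Longrightarrow> S \<inter> {u<..v} = {} \<Longrightarrow> dist (x u) (x v) \<le> \<delta>/3"
    using cadlag_partition[OF x T, of "\<delta>/3"] d by auto
  obtain N where N: "\<And>n t. n \<ge> N \<Longrightarrow> 0 \<le> t \<Longrightarrow> t \<le> T \<Longrightarrow> dist (xs n t) (x t) < \<delta>/3"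
    using lu_convD[OF lu, of "\<delta>/3" T] d by auto
  show ?thesis
  proof (rule that[OF S(1), of N])
    fix n u v assume *: "n \<ge> N" "0 \<le> u" "u \<le> v" "v \<le> T" "S \<inter> {u<..v} = {}"
    have "dist (xs n u) (xs n v) \<le> dist (xs n u) (x u) + (dist (x u) (x v) + dist (xs n v) (x v))"
      using dist_triangle[of "xs n u" "xs n v" "x u"] dist_triangle2[of "x u" "xs n v" "x v"] by linarith
    then show "dist (xs n u) (xs n v) \<le> \<delta>" using S(2)[of u v] N[of n u] N[of n v] * by auto
  qed
qed

lemma lu_conv_cong:
  assumes "lu_conv xs x" "\<And>n t. t \<ge> 0 \<Longrightarrow> ys n t = xs n t" "\<And>t. t \<ge> 0 \<Longrightarrow> y t = x t"
  shows "lu_conv ys y"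
proof (rule lu_convI)
  fix T e :: real assume "e > 0"
  then obtain N where "\<And>n t. n \<ge> N \<Longrightarrow> 0 \<le> t \<Longrightarrow> t \<le> T \<Longrightarrow> dist (xs n t) (x t) < e"
    using lu_convD[OF assms(1), of e T] by blast
  then show "\<exists>N. \<forall>n\<ge>N. \<forall>t. 0 \<le> t \<longrightarrow> t \<le> T \<longrightarrow> dist (ys n t) (y t) < e"
    using assms(2,3) by (intro exI[of _ N]) auto
qed

lemma lu_conv_lipschitz:
  assumes "lu_conv xs x" "\<And>a b. dist (h a) (h b) \<le> dist a b"
  shows "lu_conv (\<lambda>n t. h (xs n t)) (\<lambda>t. h (x t))"
proof (rule lu_convI)
  fix T e :: real assume "e > 0"
  then obtain N where "\<And>n t. n \<ge> N \<Longrightarrow> 0 \<le> t \<Longrightarrow> t \<le> T \<Longrightarrow> dist (xs n t) (x t) < e"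
    using lu_convD[OF assms(1), of e T] by blast
  then show "\<exists>N. \<forall>n\<ge>N. \<forall>t. 0 \<le> t \<longrightarrow> t \<le> T \<longrightarrow> dist (h (xs n t)) (h (x t)) < e"
    using le_less_trans[OF assms(2)] by (intro exI[of _ N]) auto
qed

lemma lu_conv_vec:
  fixes xs :: "nat \<Rightarrow> real \<Rightarrow> real^'d"
  assumes "\<And>i. lu_conv (\<lambda>n t. xs n t $ i) (\<lambda>t. x t $ i)"
  shows "lu_conv xs x"
proof (rule lu_convI)
  fix T e :: real assume e: "e > 0"
  let ?d = "e / real CARD('d)"
  have "?d > 0" using e by simp
  then have "\<forall>i. \<exists>N. \<forall>n t. n \<ge> N \<longrightarrow> 0 \<le> t \<longrightarrow> t \<le> T \<longrightarrow> dist (xs n t $ i) (x t $ i) < ?d"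
    using lu_convD[OF assms, of ?d T] by metis
  then obtain N where N: "\<And>i n t. n \<ge> N i \<Longrightarrow> 0 \<le> t \<Longrightarrow> t \<le> T \<Longrightarrow> dist (xs n t $ i) (x t $ i) < ?d"
    by metis
  have "dist (xs n t) (x t) < e" if n: "n \<ge> Max (range N)" and t: "0 \<le> t" "t \<le> T" for n t
  proof -
    have Ni: "n \<ge> N i" for i using n Max_ge[of "range N" "N i"] by (auto intro: order_trans)
    have "dist (xs n t) (x t) \<le> (\<Sum>i\<in>UNIV. \<bar>(xs n t - x t) $ i\<bar>)"
      unfolding dist_norm by (rule norm_le_l1_cart)
    also have "\<dots> < (\<Sum>i\<in>(UNIV::'d set). ?d)"
      using N[OF Ni t] by (intro sum_strict_mono) (auto simp: dist_real_def)
    also have "\<dots> = e" by simp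
    finally show ?thesis .
  qed
  then show "\<exists>N. \<forall>n\<ge>N. \<forall>t. 0 \<le> t \<longrightarrow> t \<le> T \<longrightarrow> dist (xs n t) (x t) < e" by blast
qed

lemma bounded_range_eventually:
  fixes X :: "nat \<Rightarrow> 'a::real_normed_vector"
  assumes "\<And>n. n \<ge> N \<Longrightarrow> norm (X n) \<le> B"
  shows "bounded (range X)"
proof -
  have "Bseq (\<lambda>n. X (n + N))" using assms by (intro BseqI'[where K = B]) auto
  then have "Bseq X" by (simp add: Bseq_ignore_initial_segment Bseq_offset)
  then show ?thesis by (simp add: Bseq_eq_bounded)
qed

text \<open>Lower semicontinuity of the p-variation: for a fixed subdivision the sum depends
  continuously on finitely many values.\<close>

lemma v_var_limit:
  fixes xs :: "nat \<Rightarrow> real \<Rightarrow> 'a::real_normed_vector"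
  assumes p: "p > 0" and a: "0 \<le> a" and lim: "\<And>t. t \<ge> 0 \<Longrightarrow> (\<lambda>n. xs n t) \<longlonglongrightarrow> x t"
    and B: "\<And>n. n \<ge> N \<Longrightarrow> v_var p (xs n) a b \<le> ereal B"
  shows "v_var p x a b \<le> ereal B"
  unfolding v_var_def
proof (rule SUP_least)
  fix P assume "P \<in> {P. subdivision P a b}"
  then have P: "subdivision P a b" by simp
  note D = subdivisionD[OF P]
  have nn: "0 \<le> P ! i" if "i \<le> length P - 1" for i using D(6)[OF that] a by linarith
  have "(\<lambda>n. \<Sum>i < length P - 1. norm (xs n (P ! Suc i) - xs n (P ! i)) powr p)
     \<longlonglongrightarrow> (\<Sum>i < length P - 1. norm (x (P ! Suc i) - x (P ! i)) powr p)"
    using p nn lim by (intro tendsto_sum tendsto_powr' tendsto_norm tendsto_diff tendsto_const) auto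
  moreover have "(\<Sum>i < length P - 1. norm (xs n (P ! Suc i) - xs n (P ! i)) powr p) \<le> B" if "n \<ge> N" for n
  proof -
    have "ereal (\<Sum>i < length P - 1. norm (xs n (P ! Suc i) - xs n (P ! i)) powr p) \<le> v_var p (xs n) a b"
      unfolding v_var_def by (intro SUP_upper) (use P in simp)
    from order_trans[OF this B[OF that]] show ?thesis by simp
  qed
  ultimately have "(\<Sum>i < length P - 1. norm (x (P ! Suc i) - x (P ! i)) powr p) \<le> B"
    by (intro LIMSEQ_le_const2) auto
  then show "ereal (\<Sum>i < length P - 1. norm (x (P ! Suc i) - x (P ! i)) powr p) \<le> ereal B" by simp
qed

section \<open>Passage to the limit in the equation\<close>

context young_sde
begin

lemma f_uniform:
  assumes "\<omega> > 0"
  obtains d where "d > 0" "\<And>y y'. norm y \<le> R \<Longrightarrow> norm y' \<le> R \<Longrightarrow> norm (y - y') < d \<Longrightarrow> norm (f y - f y') \<le> \<omega>"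
proof -
  have "uniformly_continuous_on (cball 0 R) f"
    using f_cont by (intro compact_uniformly_continuous) (auto intro: continuous_on_subset)
  then obtain d where "d > 0" "\<And>y y'. y \<in> cball 0 R \<Longrightarrow> y' \<in> cball 0 R \<Longrightarrow> dist y' y < d \<Longrightarrow> dist (f y') (f y) < \<omega>"
    using assms unfolding uniformly_continuous_on_def by metis
  then show ?thesis using that[of d] by (simp add: dist_norm less_imp_le)
qed

lemma g_tendsto:
  assumes "(X \<longlongrightarrow> y) F" "(Y \<longlongrightarrow> c) F"
  shows "((\<lambda>n. Mg (X n) (Y n)) \<longlongrightarrow> Mg y c) F"
proof -
  have "((\<lambda>n. norm (X n - y) powr \<alpha>) \<longlongrightarrow> norm (y - y) powr \<alpha>) F"
    using assms \<alpha>0 by (intro tendsto_powr' tendsto_norm tendsto_diff tendsto_const) auto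
  then have "((\<lambda>n. C * norm (X n - y) powr \<alpha> * norm (Y n)) \<longlongrightarrow> C * norm (y - y) powr \<alpha> * norm c) F"
    using assms by (intro tendsto_mult tendsto_const tendsto_norm)
  then have 0: "((\<lambda>n. C * norm (X n - y) powr \<alpha> * norm (Y n)) \<longlongrightarrow> 0) F" using \<alpha>0 by simp
  have "((\<lambda>n. Mg (X n) (Y n) - Mg y (Y n)) \<longlongrightarrow> 0) F"
    by (rule Lim_null_comparison[OF _ 0]) (simp add: Mg_holder)
  moreover have "((\<lambda>n. Mg y (Y n)) \<longlongrightarrow> Mg y c) F"
    using assms(2) by (intro bounded_linear.tendsto[OF matrix_vector_mul_bounded_linear])
  ultimately have "((\<lambda>n. (Mg (X n) (Y n) - Mg y (Y n)) + Mg y (Y n)) \<longlongrightarrow> 0 + Mg y c) F"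
    by (rule tendsto_add)
  then show ?thesis by simp
qed

lemma f_tendsto:
  assumes "(X \<longlongrightarrow> y) F" "(Y \<longlongrightarrow> c) F"
  shows "((\<lambda>n. Mf (X n) (Y n)) \<longlongrightarrow> Mf y c) F"
  using assms f_cont by (intro tendsto_scaleR) (auto intro: continuous_on_tendsto_compose)

lemma Mf_cont1: "continuous_on UNIV (\<lambda>y. Mf y c)"
  unfolding continuous_on_def by (intro ballI f_tendsto tendsto_ident_at tendsto_const)

lemma Mf_cont2: "continuous_on UNIV (Mf y)"
  unfolding continuous_on_def by (intro ballI f_tendsto tendsto_ident_at tendsto_const)

lemma Mg_cont1: "continuous_on UNIV (\<lambda>y. Mg y c)"
  unfolding continuous_on_def by (intro ballI g_tendsto tendsto_ident_at tendsto_const)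

lemma Mg_cont2: "continuous_on UNIV (Mg y)"
  unfolding continuous_on_def by (intro ballI g_tendsto tendsto_ident_at tendsto_const)

text \<open>Compactness is extracted for the two integrals only; the reflection term follows by
  stability, and x is the sum. Once \<open>xn\<close> converges locally uniformly, a partition for
  the limit path makes all late \<open>xn\<close> oscillate little on its pieces, and the error
  estimates of the integrals apply with the smallness on x.\<close>

lemma sol_limit:
  fixes an :: "nat \<Rightarrow> real \<Rightarrow> real" and zn ln xn kn In Jn :: "nat \<Rightarrow> real \<Rightarrow> real^'d"
  assumes sol: "\<And>n. sol (cn n) (an n) (zn n) (ln n) (xn n) (kn n) (In n) (Jn n)"
    and cad: "\<And>n. cadlag (xn n)" "\<And>n. cadlag (kn n)"
    and lu: "lu_conv an a" "lu_conv zn z" "lu_conv ln l"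
    and cadl: "cadlag a" "cadlag z" "cadlag l"
    and c: "cn \<longlonglongrightarrow> c0"
    and tot: "\<And>T. T \<ge> 0 \<Longrightarrow> \<exists>B N. \<forall>n\<ge>N. \<exists>H. total_control T B (xn n) (an n) (zn n) H"
  obtains r x k where "strict_mono (r :: nat \<Rightarrow> nat)" "lu_conv (\<lambda>n. xn (r n)) x" "lu_conv (\<lambda>n. kn (r n)) k"
    "is_solution p f g c0 a z l x k"
proof -
  have I: "\<And>n. Lint Mf (xn n) (an n) (In n)" and J: "\<And>n. Lint Mg (xn n) (zn n) (Jn n)"
    and I0: "\<And>n. In n 0 = 0" and J0: "\<And>n. Jn n 0 = 0" and k0: "\<And>n. kn n 0 = 0"
    and x: "\<And>n t. t \<ge> 0 \<Longrightarrow> xn n t = cn n + In n t + Jn n t + kn n t"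
    and sk: "\<And>n i. skor (\<lambda>t. ln n t $ i - (cn n + In n t + Jn n t) $ i) (\<lambda>t. kn n t $ i)"
    using sol by (auto simp: sol_def)
  have bnd: "\<exists>B R N. 0 \<le> B \<and> 0 \<le> R \<and> (\<forall>n\<ge>N. (\<exists>H. total_control T B (xn n) (an n) (zn n) H) \<and>
      (\<forall>t. 0 \<le> t \<longrightarrow> t \<le> T \<longrightarrow> norm (xn n t) \<le> R))" if T: "T \<ge> 0" for T
  proof -
    have "Bseq cn" using c by (intro convergent_imp_Bseq) (auto simp: convergent_def)
    then obtain Rc where Rc: "\<And>n. norm (cn n) \<le> Rc" unfolding Bseq_def by blast
    obtain B N where BN: "\<And>n. n \<ge> N \<Longrightarrow> \<exists>H. total_control T B (xn n) (an n) (zn n) H" using tot[OF T] by blast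
    have B0: "B \<ge> 0"
    proof -
      obtain H where H: "total_control T B (xn N) (an N) (zn N) H" using BN by blast
      show ?thesis using total_controlD(4,5)[OF H, of 0] T by linarith
    qed
    have "norm (xn n t) \<le> Rc + B powr (1/p)" if n: "n \<ge> N" and t: "0 \<le> t" "t \<le> T" for n t
    proof -
      obtain H where H: "total_control T B (xn n) (an n) (zn n) H" using BN n by blast
      note HD = total_controlD[OF H]
      have "norm (xn n t - xn n 0) \<le> (H t - H 0) powr (1/p)" using t by (intro pcontrol_norm[OF HD(1) p0]) auto
      also have "\<dots> \<le> B powr (1/p)" using HD(6)[of 0 t] HD(7)[of 0 t] t p0 by (intro powr_mono2) auto
      finally have "norm (xn n t - xn n 0) \<le> B powr (1/p)" .
      moreover have "norm (xn n 0) \<le> Rc" using x[of 0 n] I0 J0 k0 Rc[of n] by simp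
      ultimately show ?thesis using norm_triangle_sub[of "xn n t" "xn n 0"] by linarith
    qed
    moreover have "0 \<le> Rc + B powr (1/p)" using Rc[of 0] norm_ge_zero[of "cn 0"] by (smt (verit) powr_ge_zero)
    ultimately show ?thesis using BN B0 by blast
  qed
  \<comment> \<open>The pair is treated as one path, so that both integrals converge along the same
    subsequence.\<close>
  define Y where "Y n t = (In n t, Jn n t)" for n t
  obtain r Y0 where r: "strict_mono (r :: nat \<Rightarrow> nat)" and Y0: "lu_conv (\<lambda>n. Y (r n)) Y0"
  proof (rule regulated_Ascoli[of Y])
    fix t :: real assume t: "t \<ge> 0"
    obtain B R N where B: "0 \<le> B" "0 \<le> R" and N: "\<And>n. n \<ge> N \<Longrightarrow> \<exists>H. total_control t B (xn n) (an n) (zn n) H"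
      "\<And>n s. n \<ge> N \<Longrightarrow> 0 \<le> s \<Longrightarrow> s \<le> t \<Longrightarrow> norm (xn n s) \<le> R" using bnd[OF t] by blast
    define D where "D = (G0 + C * R powr \<alpha>) * B powr (1/p) + sew_const \<theta>0 * C * B powr \<theta>0 * (B powr (1/p)) powr \<eta>0"
    have D0: "D \<ge> 0" unfolding D_def using G0_nonneg C0 sew_const_props(1)[OF \<theta>0] by simp
    have "norm (Y n t) \<le> L * (1 + R) * B + D" if n: "n \<ge> N" for n
    proof (cases "t = 0")
      case True
      then show ?thesis using D0 L0 B I0 J0 by (simp add: Y_def)
    next
      case False
      then have t': "0 < t" using t by simp
      obtain H where H: "total_control t B (xn n) (an n) (zn n) H" using N n by blast
      note HD = total_controlD[OF H]
      have "norm (In n t - In n 0) \<le> L * (1 + R) * (H t - H 0)"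
        using N(2)[OF n] t HD(2) by (intro I_increment[OF I]) auto
      also have "\<dots> \<le> L * (1 + R) * B" using HD(7)[of 0 t] t L0 B by (intro mult_left_mono) auto
      finally have 1: "norm (In n t) \<le> L * (1 + R) * B" by (simp add: I0)
      have "norm (Jn n t - Jn n 0) \<le> D"
        unfolding D_def
      proof (rule J_osc[OF J H _ t'])
        fix u v assume uv: "0 \<le> u" "u \<le> v" "v \<le> t"
        have "norm (zn n v - zn n u) \<le> (H v - H u) powr (1/p)" using uv by (intro pcontrol_norm[OF HD(3) p0]) auto
        also have "\<dots> \<le> B powr (1/p)" using HD(6)[of u v] HD(7)[of u v] uv p0 by (intro powr_mono2) auto
        finally show "norm (zn n v - zn n u) \<le> B powr (1/p)" .
      qed (use N(2)[OF n] t in auto)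
      then show ?thesis using 1 norm_Pair_le[of "In n t" "Jn n t"] by (simp add: J0 Y_def)
    qed
    then show "bounded (range (\<lambda>n. Y n t))" by (rule bounded_range_eventually)
  next
    fix T e :: real assume T: "0 \<le> T" and e: "e > 0"
    obtain B R N where B: "0 \<le> B" "0 \<le> R" and N: "\<And>n. n \<ge> N \<Longrightarrow> \<exists>H. total_control T B (xn n) (an n) (zn n) H"
      "\<And>n s. n \<ge> N \<Longrightarrow> 0 \<le> s \<Longrightarrow> s \<le> T \<Longrightarrow> norm (xn n s) \<le> R" using bnd[OF T] by blast
    \<comment> \<open>Each integral may use e/2: for J, one quarter for the remainder and one for
      the first-order term; for I, one for the modulus of continuity of f and one for the counted
      increments of a.\<close>
    have e4: "e/4 > 0" using e by simp
    obtain \<delta>1 where d1: "\<delta>1 > 0" "sew_const \<theta>0 * C * B powr \<theta>0 * \<delta>1 powr \<eta>0 \<le> e/4"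
      using small_powr[OF _ e4 \<eta>0(1), of "sew_const \<theta>0 * C * B powr \<theta>0"] C0 sew_const_props(1)[OF \<theta>0] by auto
    obtain \<delta>2 where d2: "\<delta>2 > 0" "(G0 + C * R powr \<alpha>) * \<delta>2 powr 1 \<le> e/4"
      using small_powr[OF _ e4, of "G0 + C * R powr \<alpha>" 1] C0 G0_nonneg by auto
    define \<omega> where "\<omega> = e / (4 * (B + 1))"
    have \<omega>: "\<omega> > 0" "\<omega> * B \<le> e/4" using e B by (auto simp: \<omega>_def field_simps)
    obtain d where d: "d > 0" "\<And>y y'. norm y \<le> R \<Longrightarrow> norm y' \<le> R \<Longrightarrow> norm (y - y') < d \<Longrightarrow> norm (f y - f y') \<le> \<omega>"
      using f_uniform[OF \<omega>(1), of R] by blast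
    obtain \<delta>3 where d3: "\<delta>3 > 0" "((1 + B / d powr p) * (L * (1 + R))) * \<delta>3 powr 1 \<le> e/4"
      using small_powr[OF _ e4, of "(1 + B / d powr p) * (L * (1 + R))" 1] L0 B d by auto
    define \<delta> where "\<delta> = min \<delta>1 \<delta>2"
    have \<delta>: "\<delta> > 0" using d1 d2 by (simp add: \<delta>_def)
    obtain S1 N1 where S1: "finite S1" "\<And>n u v. n \<ge> N1 \<Longrightarrow> 0 \<le> u \<Longrightarrow> u \<le> v \<Longrightarrow> v \<le> T \<Longrightarrow> S1 \<inter> {u<..v} = {} \<Longrightarrow>
      dist (zn n u) (zn n v) \<le> \<delta>" using lu_conv_osc[OF lu(2) cadl(2) T \<delta>] by blast
    obtain S2 N2 where S2: "finite S2" "\<And>n u v. n \<ge> N2 \<Longrightarrow> 0 \<le> u \<Longrightarrow> u \<le> v \<Longrightarrow> v \<le> T \<Longrightarrow> S2 \<inter> {u<..v} = {} \<Longrightarrow>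
      dist (an n u) (an n v) \<le> \<delta>3" using lu_conv_osc[OF lu(1) cadl(1) T d3(1)] by blast
    have "dist (Y n u) (Y n v) \<le> e" if n: "n \<ge> max N (max N1 N2)" and uv: "0 \<le> u" "u \<le> v" "v \<le> T"
      and S: "(S1 \<union> S2) \<inter> {u<..v} = {}" for n u v
    proof (cases "u = v")
      case True
      then show ?thesis using e by simp
    next
      case False
      then have lt: "u < v" using uv by simp
      have n': "n \<ge> N" "n \<ge> N1" "n \<ge> N2" using n by auto
      obtain H where H: "total_control T B (xn n) (an n) (zn n) H" using N n' by blast
      have sub: "S1 \<inter> {s<..t} = {} \<and> S2 \<inter> {s<..t} = {}" if "u \<le> s" "t \<le> v" for s t using S that by auto
      have "norm (Jn n v - Jn n u) \<le> (G0 + C * R powr \<alpha>) * \<delta> + sew_const \<theta>0 * C * B powr \<theta>0 * \<delta> powr \<eta>0"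
      proof (rule J_osc[OF J H uv(1) lt uv(3)])
        show "norm (xn n u) \<le> R" using N(2)[OF n'(1), of u] uv by auto
        fix s t assume st: "u \<le> s" "s \<le> t" "t \<le> v"
        show "norm (zn n t - zn n s) \<le> \<delta>"
          using S1(2)[OF n'(2), of s t] sub[OF st(1,3)] st uv by (simp add: dist_norm norm_minus_commute)
      qed
      also have "(G0 + C * R powr \<alpha>) * \<delta> \<le> (G0 + C * R powr \<alpha>) * \<delta>2"
        using G0_nonneg C0 by (intro mult_left_mono) (auto simp: \<delta>_def)
      also have "\<dots> \<le> e/4" using d2 by simp
      also have "sew_const \<theta>0 * C * B powr \<theta>0 * \<delta> powr \<eta>0 \<le> sew_const \<theta>0 * C * B powr \<theta>0 * \<delta>1 powr \<eta>0"
        using sew_const_props(1)[OF \<theta>0] C0 \<delta> \<eta>0 by (intro mult_left_mono powr_mono2) (auto simp: \<delta>_def)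
      also have "\<dots> \<le> e/4" by (rule d1)
      finally have 1: "norm (Jn n v - Jn n u) \<le> e/4 + e/4" by simp
      have "norm (In n v - In n u) \<le> \<omega> * B + (1 + B / d powr p) * (L * (1 + R) * \<delta>3)"
      proof (rule I_osc[OF I H uv(1) lt uv(3) _ _ d(1)])
        fix s t assume st: "u \<le> s" "s \<le> t" "t \<le> v"
        show "\<bar>an n t - an n s\<bar> \<le> \<delta>3"
          using S2(2)[OF n'(3), of s t] sub[OF st(1,3)] st uv by (simp add: dist_real_def abs_minus_commute)
      qed (use d(2) \<omega> N(2)[OF n'(1)] uv in auto)
      also have "\<dots> \<le> e/4 + e/4" using \<omega>(2) d3 by (intro add_mono) (auto simp: mult.assoc)
      finally have 2: "norm (In n v - In n u) \<le> e/4 + e/4" .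
      have "dist (Y n u) (Y n v) = norm (In n v - In n u, Jn n v - Jn n u)"
        unfolding dist_commute[of "Y n u"] by (simp add: Y_def dist_norm)
      also have "\<dots> \<le> norm (In n v - In n u) + norm (Jn n v - Jn n u)" by (rule norm_Pair_le)
      finally show ?thesis using 1 2 by linarith
    qed
    then show "\<exists>S N. finite S \<and> (\<forall>n\<ge>N. \<forall>u v. 0 \<le> u \<longrightarrow> u \<le> v \<longrightarrow> v \<le> T \<longrightarrow>
            S \<inter> {u<..v} = {} \<longrightarrow> dist (Y n u) (Y n v) \<le> e)"
      using S1(1) S2(1) by (intro exI[of _ "S1 \<union> S2"] exI[of _ "max N (max N1 N2)"]) blast
  qed
  define I' where "I' t = fst (Y0 t)" for t
  define J' where "J' t = snd (Y0 t)" for t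
  have luI: "lu_conv (\<lambda>n. In (r n)) I'" and luJ: "lu_conv (\<lambda>n. Jn (r n)) J'"
    using lu_conv_lipschitz[OF Y0, of fst] lu_conv_lipschitz[OF Y0, of snd]
    by (auto simp: Y_def I'_def[abs_def] J'_def[abs_def] dist_fst_le dist_snd_le)
  have rr: "r n \<ge> n" for n using seq_suble[OF r] .
  have cr: "(\<lambda>n. cn (r n)) \<longlonglongrightarrow> c0" using LIMSEQ_subseq_LIMSEQ[OF c r] by (simp add: o_def)
  have luY: "lu_conv (\<lambda>n t. cn (r n) + In (r n) t + Jn (r n) t) (\<lambda>t. c0 + I' t + J' t)"
    by (intro lu_conv_add lu_conv_const cr luI luJ)
  have lul: "lu_conv (\<lambda>n. ln (r n)) l" and lua: "lu_conv (\<lambda>n. an (r n)) a" and luz: "lu_conv (\<lambda>n. zn (r n)) z"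
    using lu_conv_subseq[OF lu(3) r] lu_conv_subseq[OF lu(1) r] lu_conv_subseq[OF lu(2) r] by auto
  have "\<forall>i. \<exists>ki. lu_conv (\<lambda>n t. kn (r n) t $ i) ki \<and> skor (\<lambda>t. l t $ i - (c0 + I' t + J' t) $ i) ki"
  proof
    fix i
    have "lu_conv (\<lambda>n t. (ln (r n) t - (cn (r n) + In (r n) t + Jn (r n) t)) $ i) (\<lambda>t. (l t - (c0 + I' t + J' t)) $ i)"
      by (rule lu_conv_lipschitz[OF lu_conv_minus[OF lul luY]]) (rule dist_vec_nth_le)
    then have "lu_conv (\<lambda>n t. ln (r n) t $ i - (cn (r n) + In (r n) t + Jn (r n) t) $ i) (\<lambda>t. l t $ i - (c0 + I' t + J' t) $ i)"
      by simp
    from skor_limit[OF sk this] show "\<exists>ki. lu_conv (\<lambda>n t. kn (r n) t $ i) ki \<and> skor (\<lambda>t. l t $ i - (c0 + I' t + J' t) $ i) ki"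
      by blast
  qed
  from choice[OF this] obtain ki where ki: "\<And>i. lu_conv (\<lambda>n t. kn (r n) t $ i) (ki i)"
    "\<And>i. skor (\<lambda>t. l t $ i - (c0 + I' t + J' t) $ i) (ki i)" by blast
  define k where "k t = (\<chi> i. ki i t)" for t
  define x' where "x' t = c0 + I' t + J' t + k t" for t
  have luk: "lu_conv (\<lambda>n. kn (r n)) k"
    by (rule lu_conv_vec) (use ki(1) in \<open>simp add: k_def\<close>)
  have lux: "lu_conv (\<lambda>n. xn (r n)) x'"
    by (rule lu_conv_cong[OF lu_conv_add[OF luY luk]]) (use x in \<open>auto simp: x'_def\<close>)
  have sk': "skor (\<lambda>t. l t $ i - (c0 + I' t + J' t) $ i) (\<lambda>t. k t $ i)" for i using ki(2) by (simp add: k_def)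
  have cadx: "cadlag x'" by (rule cadlag_lu_limit[OF lux]) (rule cad)
  have cadk: "cadlag k" by (rule cadlag_lu_limit[OF luk]) (rule cad)
  have var: "V_var p x' 0 T < \<infinity>" if T: "T \<ge> 0" for T
  proof -
    obtain B N where BN: "\<And>n. n \<ge> N \<Longrightarrow> \<exists>H. total_control T B (xn n) (an n) (zn n) H" using tot[OF T] by blast
    have "v_var p x' 0 T \<le> ereal B"
    proof (rule v_var_limit[where xs = "\<lambda>n. xn (r n)" and N = N])
      show "v_var p (xn (r n)) 0 T \<le> ereal B" if n: "n \<ge> N" for n
      proof -
        obtain H where H: "total_control T B (xn (r n)) (an (r n)) (zn (r n)) H"
          using BN[of "r n"] rr[of n] n by auto
        have "v_var p (xn (r n)) 0 T \<le> ereal (H T - H 0)" by (rule v_var_le) (rule total_controlD(1)[OF H])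
        also have "\<dots> \<le> ereal B" using total_controlD(7)[OF H, of 0 T] T by simp
        finally show ?thesis .
      qed
    qed (use p0 lu_conv_tendsto[OF lux] in auto)
    then show ?thesis by (auto simp: V_var_def)
  qed
  have RSI: "RS_has Mf (leftlim x') a 0 t (I' t)" if t: "t \<ge> 0" for t
  proof (rule RS_has_limit[where M = Mf and xs = "\<lambda>n. xn (r n)" and zs = "\<lambda>n. an (r n)" and x = x' and z = a
        and Is = "\<lambda>n. In (r n)" and I = I' and T = t,
        OF lux lua cadx cadl(1) lu_conv_tendsto[OF luI] _ f_tendsto Mf_cont1 Mf_cont2 _ t])
    fix e :: real assume e: "e > 0"
    obtain B R N where B: "0 \<le> B" "0 \<le> R" and N: "\<And>n. n \<ge> N \<Longrightarrow> \<exists>H. total_control t B (xn n) (an n) (zn n) H"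
      "\<And>n s. n \<ge> N \<Longrightarrow> 0 \<le> s \<Longrightarrow> s \<le> t \<Longrightarrow> norm (xn n s) \<le> R" using bnd[OF t] by blast
    define \<omega> where "\<omega> = e / (B + 1)"
    have \<omega>: "\<omega> > 0" "\<omega> * B \<le> e" using e B by (auto simp: \<omega>_def field_simps)
    obtain d where d: "d > 0" "\<And>y y'. norm y \<le> R \<Longrightarrow> norm y' \<le> R \<Longrightarrow> norm (y - y') < d \<Longrightarrow> norm (f y - f y') \<le> \<omega>"
      using f_uniform[OF \<omega>(1), of R] by blast
    have d2: "d/2 > 0" using d by simp
    obtain S N1 where S: "finite S" "\<And>n u v. n \<ge> N1 \<Longrightarrow> 0 \<le> u \<Longrightarrow> u \<le> v \<Longrightarrow> v \<le> t \<Longrightarrow> S \<inter> {u<..v} = {} \<Longrightarrow>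
      dist (xn (r n) u) (xn (r n) v) \<le> d/2" using lu_conv_osc[OF lux cadx t d2] by blast
    have "error_control t e S (\<lambda>u v w. In (r n) w - In (r n) u - Mf (xn (r n) v) (an (r n) w - an (r n) u))"
      if n: "n \<ge> max N N1" for n
    proof -
      have n': "r n \<ge> N" "n \<ge> N1" using n rr[of n] by auto
      obtain H where H: "total_control t B (xn (r n)) (an (r n)) (zn (r n)) H" using N n' by blast
      note HD = total_controlD[OF H]
      have dif: "norm (xn (r n) s - xn (r n) q) < d"
        if "0 \<le> m" "m \<le> s" "m \<le> q" "s < w" "q < w" "w \<le> t" "S \<inter> {m<..<w} = {}" for s q m w
      proof -
        have *: "S \<inter> {s<..q} = {}" "S \<inter> {q<..s} = {}" using that by fastforce+
        show ?thesis using S(2)[OF n'(2), of s q] S(2)[OF n'(2), of q s] that d *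
          by (cases "s \<le> q") (auto simp: dist_norm norm_minus_commute)
      qed
      show ?thesis
        unfolding error_control_def
      proof (intro exI[of _ "\<lambda>s. \<omega> * H s"] conjI allI impI)
        show "\<omega> * H s \<le> \<omega> * H q" if "0 \<le> s" "s \<le> q" "q \<le> t" for s q
          using HD(6)[OF that] \<omega> by (intro mult_left_mono) auto
        have "\<omega> * (H t - H 0) \<le> \<omega> * B" using HD(7)[of 0 t] t \<omega> by (intro mult_left_mono) auto
        then show "\<omega> * H t - \<omega> * H 0 \<le> e" using \<omega>(2) by (simp add: algebra_simps)
        fix u v w assume uvw: "0 \<le> u" "u < w" "0 \<le> v" "v < w" "w \<le> t" "S \<inter> {min u v<..<w} = {}"
        show "norm (In (r n) w - In (r n) u - Mf (xn (r n) v) (an (r n) w - an (r n) u)) \<le> \<omega> * H w - \<omega> * H (min u v)"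
        proof (rule I_limit_error[OF I H uvw(1-5)])
          fix s q assume "min u v \<le> s" "s < w" "min u v \<le> q" "q < w"
          then show "norm (f (xn (r n) q) - f (xn (r n) s)) \<le> \<omega>"
            using dif[of "min u v" q s w] N(2)[OF n'(1)] uvw by (intro d(2)) auto
        qed
      qed
    qed
    then show "\<exists>S N. finite S \<and> (\<forall>n\<ge>N. error_control t e S
        (\<lambda>u v w. In (r n) w - In (r n) u - Mf (xn (r n) v) (an (r n) w - an (r n) u)))"
      using S(1) by (intro exI[of _ S] exI[of _ "max N N1"]) blast
  qed (use I0 in auto)
  have RSJ: "RS_has Mg (leftlim x') z 0 t (J' t)" if t: "t \<ge> 0" for t
  proof (rule RS_has_limit[where M = Mg and xs = "\<lambda>n. xn (r n)" and zs = "\<lambda>n. zn (r n)" and x = x' and z = z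
        and Is = "\<lambda>n. Jn (r n)" and I = J' and T = t,
        OF lux luz cadx cadl(2) lu_conv_tendsto[OF luJ] _ g_tendsto Mg_cont1 Mg_cont2 _ t])
    fix e :: real assume e: "e > 0"
    obtain B R N where B: "0 \<le> B" "0 \<le> R" and N: "\<And>n. n \<ge> N \<Longrightarrow> \<exists>H. total_control t B (xn n) (an n) (zn n) H"
      "\<And>n s. n \<ge> N \<Longrightarrow> 0 \<le> s \<Longrightarrow> s \<le> t \<Longrightarrow> norm (xn n s) \<le> R" using bnd[OF t] by blast
    define K where "K = (sew_const \<theta>0 + 1) * C * B powr (\<eta>0 / p)"
    have K0: "K \<ge> 0" using sew_const_props(1)[OF \<theta>0] C0 by (simp add: K_def)
    obtain \<delta> where \<delta>: "\<delta> > 0" "K * B * \<delta> powr \<eta>0 \<le> e"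
      using small_powr[OF _ e \<eta>0(1), of "K * B"] K0 B by auto
    have d0: "K * \<delta> powr \<eta>0 \<ge> 0" using K0 by simp
    obtain S N1 where S: "finite S" "\<And>n u v. n \<ge> N1 \<Longrightarrow> 0 \<le> u \<Longrightarrow> u \<le> v \<Longrightarrow> v \<le> t \<Longrightarrow> S \<inter> {u<..v} = {} \<Longrightarrow>
      dist (xn (r n) u) (xn (r n) v) \<le> \<delta>" using lu_conv_osc[OF lux cadx t \<delta>(1)] by blast
    have "error_control t e S (\<lambda>u v w. Jn (r n) w - Jn (r n) u - Mg (xn (r n) v) (zn (r n) w - zn (r n) u))"
      if n: "n \<ge> max N N1" for n
    proof -
      have n': "r n \<ge> N" "n \<ge> N1" using n rr[of n] by auto
      obtain H where H: "total_control t B (xn (r n)) (an (r n)) (zn (r n)) H" using N n' by blast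
      note HD = total_controlD[OF H]
      show ?thesis
        unfolding error_control_def
      proof (intro exI[of _ "\<lambda>s. K * \<delta> powr \<eta>0 * H s"] conjI allI impI)
        show "K * \<delta> powr \<eta>0 * H s \<le> K * \<delta> powr \<eta>0 * H q" if "0 \<le> s" "s \<le> q" "q \<le> t" for s q
          using HD(6)[OF that] d0 by (intro mult_left_mono) auto
        have "K * \<delta> powr \<eta>0 * (H t - H 0) \<le> K * \<delta> powr \<eta>0 * B"
          using HD(7)[of 0 t] t d0 by (intro mult_left_mono) auto
        also have "\<dots> = K * B * \<delta> powr \<eta>0" by simp
        finally show "K * \<delta> powr \<eta>0 * H t - K * \<delta> powr \<eta>0 * H 0 \<le> e" using \<delta>(2) by (simp add: right_diff_distrib)
        fix u v w assume uvw: "0 \<le> u" "u < w" "0 \<le> v" "v < w" "w \<le> t" "S \<inter> {min u v<..<w} = {}"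
        show "norm (Jn (r n) w - Jn (r n) u - Mg (xn (r n) v) (zn (r n) w - zn (r n) u))
          \<le> K * \<delta> powr \<eta>0 * H w - K * \<delta> powr \<eta>0 * H (min u v)"
          unfolding K_def
        proof (rule J_limit_error[OF J H uvw(1-5)])
          fix s q assume sq: "min u v \<le> s" "s \<le> q" "q < w"
          then have "S \<inter> {s<..q} = {}" using uvw(6) by fastforce
          then show "norm (xn (r n) q - xn (r n) s) \<le> \<delta>"
            using S(2)[OF n'(2), of s q] sq uvw by (auto simp: dist_norm norm_minus_commute)
        qed
      qed
    qed
    then show "\<exists>S N. finite S \<and> (\<forall>n\<ge>N. error_control t e S
        (\<lambda>u v w. Jn (r n) w - Jn (r n) u - Mg (xn (r n) v) (zn (r n) w - zn (r n) u)))"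
      using S(1) by (intro exI[of _ S] exI[of _ "max N N1"]) blast
  qed (use J0 in auto)
  have SP: "SP l (\<lambda>t. c0 + I' t + J' t) x' k"
    unfolding SP_def
  proof (intro conjI allI impI)
    show "x' t = c0 + I' t + J' t + k t" for t by (simp add: x'_def)
    show "l t \<le> x' t" if "t \<ge> 0" for t
      using skorD(3)[OF sk' that] by (simp add: less_eq_vec_def x'_def algebra_simps)
    show "k 0 = 0" using LIMSEQ_unique[OF lu_conv_tendsto[OF luk order_refl]] k0 by simp
    show "mono_on {0..} (\<lambda>t. k t $ i)" for i using sk'[of i] by (simp add: skor_def)
    fix i and t :: real assume "0 \<le> t"
    have gap: "k s $ i - (l s $ i - (c0 + I' s + J' s) $ i) = x' s $ i - l s $ i" for s
      by (simp add: x'_def)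
    have "(\<integral>\<^sup>+ s. ennreal (k s $ i - (l s $ i - (c0 + I' s + J' s) $ i)) * indicator {0<..t} s
        \<partial>interval_measure (\<lambda>s. k (max 0 s) $ i)) = 0"
    proof (rule skor_imp_interval_measure[OF _ _ sk'])
      show "mono_on {0..} (\<lambda>t. k t $ i)" using sk'[of i] by (simp add: skor_def)
      show "((\<lambda>t. k t $ i) \<longlongrightarrow> k t $ i) (at_right t)" if "t \<ge> 0" for t
        using cadk that by (intro tendsto_vec_nth) (auto simp: cadlag_def)
      show "((\<lambda>s. k s $ i - (l s $ i - (c0 + I' s + J' s) $ i)) \<longlongrightarrow> k t $ i - (l t $ i - (c0 + I' t + J' t) $ i)) (at_right t)"
        if "t \<ge> 0" for t
        unfolding gap using cadx cadl(3) that by (intro tendsto_diff tendsto_vec_nth) (auto simp: cadlag_def)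
    qed
    then show "(\<integral>\<^sup>+ s. ennreal (x' s $ i - l s $ i) * indicator {0<..t} s
        \<partial>interval_measure (\<lambda>s. k (max 0 s) $ i)) = 0"
      unfolding gap .
  qed
  have RS: "\<forall>t\<ge>0. RS_has (\<lambda>v r. r *\<^sub>R v) (\<lambda>s. f (leftlim x' s)) a 0 t (I' t) \<and>
      RS_has (\<lambda>A v. A *v v) (\<lambda>s. g (leftlim x' s)) z 0 t (J' t)"
    using RSI RSJ by (simp add: RS_has_def)
  have "is_solution p f g c0 a z l x' k"
    unfolding is_solution_def using cadx cadk var RS SP by blast
  then show ?thesis using that r lux luk by blast
qed

end

subsection \<open>Time changes\<close>

lemma time_changeD:
  assumes "time_change lam"
  shows "lam 0 = 0" "\<And>t. t \<ge> 0 \<Longrightarrow> lam t \<ge> 0" "\<And>s t. 0 \<le> s \<Longrightarrow> s < t \<Longrightarrow> lam s < lam t"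
    and "\<And>s t. 0 \<le> s \<Longrightarrow> s \<le> t \<Longrightarrow> lam s \<le> lam t" "\<And>s. s \<ge> 0 \<Longrightarrow> \<exists>t\<ge>0. lam t = s"
    and "\<And>t. t \<ge> 0 \<Longrightarrow> filterlim lam (at_right (lam t)) (at_right t)"
    and "\<And>t. t > 0 \<Longrightarrow> filterlim lam (at_left (lam t)) (at_left t)"
proof -
  have sm: "strict_mono_on {0..} lam" and im: "lam ` {0..} = {0..}" and cont: "continuous_on {0..} lam"
    using assms by (auto simp: time_change_def)
  show "lam 0 = 0" using assms by (simp add: time_change_def)
  show "lam t \<ge> 0" if "t \<ge> 0" for t using im that by auto
  show lt: "lam s < lam t" if "0 \<le> s" "s < t" for s t using strict_mono_onD[OF sm, of s t] that by auto
  show "lam s \<le> lam t" if "0 \<le> s" "s \<le> t" for s t using lt[of s t] that by (cases "s = t") auto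
  show "\<exists>t\<ge>0. lam t = s" if "s \<ge> 0" for s
  proof -
    have "s \<in> lam ` {0..}" using im that by simp
    then show ?thesis by auto
  qed
  have tend: "(lam \<longlongrightarrow> lam t) (at t within {0..})" if "t \<ge> 0" for t
    using cont that by (auto simp: continuous_on_def)
  show "filterlim lam (at_right (lam t)) (at_right t)" if t: "t \<ge> 0" for t
    unfolding filterlim_at
  proof
    have ev: "eventually (\<lambda>s. s \<in> {t<..}) (at_right t)" by (auto simp: eventually_at_topological)
    show "eventually (\<lambda>s. lam s \<in> {lam t<..} \<and> lam s \<noteq> lam t) (at_right t)"
      by (rule eventually_mono[OF ev]) (use lt[OF t] in force)
    show "(lam \<longlongrightarrow> lam t) (at_right t)" using t by (intro tendsto_within_subset[OF tend]) auto
  qed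
  show "filterlim lam (at_left (lam t)) (at_left t)" if t: "t > 0" for t
    unfolding filterlim_at
  proof
    have "eventually (\<lambda>s. s \<in> {0<..<t}) (at_left t)"
      using t by (subst eventually_at_left[of 0 t]) auto
    then show "eventually (\<lambda>s. lam s \<in> {..<lam t} \<and> lam s \<noteq> lam t) (at_left t)"
    proof (rule eventually_mono)
      fix s assume "s \<in> {0<..<t}"
      then have "lam s < lam t" using lt[of s t] by simp
      then show "lam s \<in> {..<lam t} \<and> lam s \<noteq> lam t" by simp
    qed
    have "(lam \<longlongrightarrow> lam t) (at t within {0..t})" using t by (intro tendsto_within_subset[OF tend]) auto
    then show "(lam \<longlongrightarrow> lam t) (at_left t)" by (simp add: at_within_Icc_at_left[OF t])
  qed
qed

lemma cadlag_compose:
  assumes "cadlag x" "time_change lam"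
  shows "cadlag (x \<circ> lam)"
  unfolding cadlag_def
proof (intro conjI allI impI)
  note T = time_changeD[OF assms(2)]
  fix t :: real assume t: "0 \<le> t"
  have "(x \<longlongrightarrow> x (lam t)) (at_right (lam t))" using assms(1) T(2)[OF t] by (auto simp: cadlag_def)
  then show "((x \<circ> lam) \<longlongrightarrow> (x \<circ> lam) t) (at_right t)"
    using filterlim_compose[OF _ T(6)[OF t], of x] by (simp add: o_def)
next
  note T = time_changeD[OF assms(2)]
  fix t :: real assume t: "0 < t"
  have "lam t > 0" using T(1) T(3)[of 0 t] t by simp
  then obtain L where "(x \<longlongrightarrow> L) (at_left (lam t))" using assms(1) by (auto simp: cadlag_def)
  then have "((\<lambda>s. x (lam s)) \<longlongrightarrow> L) (at_left t)" by (rule filterlim_compose[OF _ T(7)[OF t]])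
  then show "\<exists>L. ((x \<circ> lam) \<longlongrightarrow> L) (at_left t)" by (auto simp: o_def)
qed

lemma cadlag_Pair:
  assumes "cadlag x" "cadlag y"
  shows "cadlag (\<lambda>t. (x t, y t))"
  unfolding cadlag_def
proof (intro conjI allI impI)
  fix t :: real assume "0 \<le> t"
  then show "((\<lambda>t. (x t, y t)) \<longlongrightarrow> (x t, y t)) (at_right t)"
    using assms by (intro tendsto_Pair) (auto simp: cadlag_def)
next
  fix t :: real assume "0 < t"
  then obtain L K where "(x \<longlongrightarrow> L) (at_left t)" "(y \<longlongrightarrow> K) (at_left t)"
    using assms unfolding cadlag_def by blast
  from tendsto_Pair[OF this] show "\<exists>L. ((\<lambda>t. (x t, y t)) \<longlongrightarrow> L) (at_left t)" by blast
qed

lemma cadlag_continuous_compose: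
  assumes x: "cadlag x" and h: "continuous_on UNIV h"
  shows "cadlag (\<lambda>t. h (x t))"
  unfolding cadlag_def
proof (intro conjI allI impI)
  fix t :: real assume "0 \<le> t"
  then have "(x \<longlongrightarrow> x t) (at_right t)" using x by (auto simp: cadlag_def)
  from continuous_on_tendsto_compose[OF h this] show "((\<lambda>t. h (x t)) \<longlongrightarrow> h (x t)) (at_right t)" by simp
next
  fix t :: real assume "0 < t"
  then obtain L where "(x \<longlongrightarrow> L) (at_left t)" using x unfolding cadlag_def by blast
  from continuous_on_tendsto_compose[OF h this] show "\<exists>L. ((\<lambda>t. h (x t)) \<longlongrightarrow> L) (at_left t)" by auto
qed

lemma cadlag_fst: "cadlag (\<lambda>t. (x t, y t)) \<Longrightarrow> cadlag x"
  using cadlag_continuous_compose[of "\<lambda>t. (x t, y t)" fst] by (simp add: continuous_on_fst)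

lemma cadlag_snd: "cadlag (\<lambda>t. (x t, y t)) \<Longrightarrow> cadlag y"
  using cadlag_continuous_compose[of "\<lambda>t. (x t, y t)" snd] by (simp add: continuous_on_snd)

text \<open>At a time s slightly after t, both time changes carry a point of (t,b) to s. So
  \<open>xs n\<close> at s is close to a value of x and to a value of y taken just after t, and
  right-continuity leads back to t.\<close>

lemma J1_conv_unique:
  assumes x: "J1_conv xs x" and y: "J1_conv xs y" and t: "t \<ge> 0"
  shows "x t = y t"
proof (rule ccontr)
  assume "x t \<noteq> y t"
  define e where "e = dist (x t) (y t) / 5"
  have e: "e > 0" using \<open>x t \<noteq> y t\<close> by (simp add: e_def)
  from x obtain lam where L: "\<forall>n. time_change (lam n)" "\<forall>e>0. \<exists>N. \<forall>n\<ge>N. \<forall>t\<ge>0. \<bar>lam n t - t\<bar> \<le> e"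
    "\<forall>T\<ge>0. \<forall>e>0. \<exists>N. \<forall>n\<ge>N. \<forall>t\<in>{0..T}. dist (xs n (lam n t)) (x t) \<le> e"
    unfolding J1_conv_def by (elim conjE exE)
  note lam = L[rule_format]
  from y obtain mu where M: "\<forall>n. time_change (mu n)" "\<forall>e>0. \<exists>N. \<forall>n\<ge>N. \<forall>t\<ge>0. \<bar>mu n t - t\<bar> \<le> e"
    "\<forall>T\<ge>0. \<forall>e>0. \<exists>N. \<forall>n\<ge>N. \<forall>t\<in>{0..T}. dist (xs n (mu n t)) (y t) \<le> e"
    unfolding J1_conv_def by (elim conjE exE)
  note mu = M[rule_format]
  have "(x \<longlongrightarrow> x t) (at_right t)" "(y \<longlongrightarrow> y t) (at_right t)"
    using x y t by (auto simp: J1_conv_def cadlag_def)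
  then have "eventually (\<lambda>s. dist (x s) (x t) < e \<and> dist (y s) (y t) < e) (at_right t)"
    using e by (intro eventually_conj tendstoD)
  then obtain b where b: "b > t" "\<And>s. t < s \<Longrightarrow> s < b \<Longrightarrow> dist (x s) (x t) < e \<and> dist (y s) (y t) < e"
    by (auto simp: eventually_at_right[OF less_add_one])
  \<comment> \<open>A quarter of the length around the midpoint s: points moved by at most d stay
    inside (t,b).\<close>
  define d where "d = (b - t) / 4"
  define s where "s = (t + b) / 2"
  have d: "d > 0" "s - d > t" "s + d < b" "s \<ge> 0" using b t by (auto simp: d_def s_def field_simps)
  obtain N1 where N1: "\<And>n r. n \<ge> N1 \<Longrightarrow> r \<ge> 0 \<Longrightarrow> \<bar>lam n r - r\<bar> \<le> d" using lam(2)[OF d(1)] by blast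
  obtain N2 where N2: "\<And>n r. n \<ge> N2 \<Longrightarrow> r \<ge> 0 \<Longrightarrow> \<bar>mu n r - r\<bar> \<le> d" using mu(2)[OF d(1)] by blast
  have b0: "b \<ge> 0" using b t by simp
  obtain N3 where N3: "\<And>n r. n \<ge> N3 \<Longrightarrow> r \<in> {0..b} \<Longrightarrow> dist (xs n (lam n r)) (x r) \<le> e" using lam(3)[OF b0 e] by blast
  obtain N4 where N4: "\<And>n r. n \<ge> N4 \<Longrightarrow> r \<in> {0..b} \<Longrightarrow> dist (xs n (mu n r)) (y r) \<le> e" using mu(3)[OF b0 e] by blast
  define n where "n = max (max N1 N2) (max N3 N4)"
  have n: "n \<ge> N1" "n \<ge> N2" "n \<ge> N3" "n \<ge> N4" by (auto simp: n_def)
  obtain r where r: "r \<ge> 0" "lam n r = s" using time_changeD(5)[OF lam(1)] d by blast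
  obtain q where q: "q \<ge> 0" "mu n q = s" using time_changeD(5)[OF mu(1)] d by blast
  have r': "t < r" "r < b" using N1[OF n(1) r(1)] r d by linarith+
  have q': "t < q" "q < b" using N2[OF n(2) q(1)] q d by linarith+
  have 1: "dist (xs n s) (x r) \<le> e" using N3[OF n(3), of r] r r' by auto
  have 2: "dist (xs n s) (y q) \<le> e" using N4[OF n(4), of q] q q' by auto
  have "dist (x t) (y t) \<le> dist (x r) (x t) + (dist (xs n s) (x r) + (dist (xs n s) (y q) + dist (y q) (y t)))"
    using dist_triangle3[of "x t" "y t" "x r"] dist_triangle3[of "x r" "y t" "xs n s"]
      dist_triangle[of "xs n s" "y t" "y q"] by linarith
  then have "dist (x t) (y t) < e + (e + (e + e))" using b(2)[OF r'] b(2)[OF q'] 1 2 by linarith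
  then show False using e by (simp add: e_def)
qed

lemma J1_conv_subseq:
  assumes "J1_conv xs x" "strict_mono r"
  shows "J1_conv (\<lambda>n. xs (r n)) x"
proof -
  from assms(1) obtain lam where L: "\<forall>n. time_change (lam n)" "\<forall>e>0. \<exists>N. \<forall>n\<ge>N. \<forall>t\<ge>0. \<bar>lam n t - t\<bar> \<le> e"
    "\<forall>T\<ge>0. \<forall>e>0. \<exists>N. \<forall>n\<ge>N. \<forall>t\<in>{0..T}. dist (xs n (lam n t)) (x t) \<le> e"
    unfolding J1_conv_def by (elim conjE exE)
  note lam = L[rule_format]
  have rr: "\<And>n N. n \<ge> N \<Longrightarrow> r n \<ge> N" using seq_suble[OF assms(2)] order_trans by blast
  show ?thesis
    unfolding J1_conv_def
  proof (intro conjI exI[of _ "\<lambda>n. lam (r n)"] allI impI)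
    show "cadlag x" using assms by (simp add: J1_conv_def)
    show "\<exists>N. \<forall>n\<ge>N. \<forall>t\<ge>0. \<bar>lam (r n) t - t\<bar> \<le> e" if "e > 0" for e
      using lam(2)[OF that] rr by meson
    show "\<exists>N. \<forall>n\<ge>N. \<forall>t\<in>{0..T}. dist (xs (r n) (lam (r n) t)) (x t) \<le> e" if "T \<ge> 0" "e > 0" for T e
      using lam(3)[OF that] rr by meson
  qed (rule lam)
qed

lemma J1_conv_const:
  assumes "cadlag x"
  shows "J1_conv (\<lambda>n. x) x"
proof -
  have "time_change (\<lambda>t. t)" by (auto simp: time_change_def strict_mono_on_def)
  then show ?thesis using assms unfolding J1_conv_def
    by (intro conjI exI[of _ "\<lambda>n t. t"]) auto
qed

subsection \<open>Paths that agree on the half-line\<close>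

lemma eventually_at_right_nonneg: "t \<ge> 0 \<Longrightarrow> (\<And>s. s \<ge> 0 \<Longrightarrow> P s) \<Longrightarrow> eventually P (at_right (t::real))"
  by (subst eventually_at_right[of t "t + 1"]) (auto intro!: exI[of _ "t + 1"])

lemma eventually_at_left_nonneg: "t > 0 \<Longrightarrow> (\<And>s. s \<ge> 0 \<Longrightarrow> P s) \<Longrightarrow> eventually P (at_left (t::real))"
  by (subst eventually_at_left[of 0 t]) auto

lemma cadlag_cong:
  assumes "cadlag x" and eq: "\<And>t. t \<ge> 0 \<Longrightarrow> x' t = x t"
  shows "cadlag x'"
  unfolding cadlag_def
proof (intro conjI allI impI)
  fix t :: real assume t: "t \<ge> 0"
  have "(x' \<longlongrightarrow> x' t) (at_right t) \<longleftrightarrow> (x \<longlongrightarrow> x t) (at_right t)"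
    using eq t by (intro filterlim_cong) (auto intro: eventually_at_right_nonneg)
  then show "(x' \<longlongrightarrow> x' t) (at_right t)" using assms t by (auto simp: cadlag_def)
next
  fix t :: real assume t: "t > 0"
  obtain L where "(x \<longlongrightarrow> L) (at_left t)" using assms t by (auto simp: cadlag_def)
  moreover have "(x' \<longlongrightarrow> L) (at_left t) \<longleftrightarrow> (x \<longlongrightarrow> L) (at_left t)"
    using eq t by (intro filterlim_cong) (auto intro: eventually_at_left_nonneg)
  ultimately show "\<exists>L. (x' \<longlongrightarrow> L) (at_left t)" by blast
qed

lemma leftlim_cong:
  assumes eq: "\<And>t. t \<ge> 0 \<Longrightarrow> x' t = x t"
  shows "leftlim x' = leftlim x"
proof
  fix s
  show "leftlim x' s = leftlim x s"
  proof (cases "s \<le> 0")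
    case True
    then show ?thesis using eq[of 0] by (simp add: leftlim_def)
  next
    case False
    have "(x' \<longlongrightarrow> L) (at_left s) \<longleftrightarrow> (x \<longlongrightarrow> L) (at_left s)" for L
      using eq False by (intro filterlim_cong) (auto intro: eventually_at_left_nonneg)
    then show ?thesis using False by (simp add: leftlim_def Topological_Spaces.Lim_def)
  qed
qed

lemma v_var_cong:
  assumes eq: "\<And>t. t \<ge> 0 \<Longrightarrow> x' t = x t" and a: "0 \<le> a"
  shows "v_var p x' a b = v_var p x a b"
  unfolding v_var_def
proof (rule SUP_cong)
  fix P assume "P \<in> {P. subdivision P a b}"
  then have P: "subdivision P a b" by simp
  have "0 \<le> P ! i" if "i \<le> length P - 1" for i using subdivisionD(6)[OF P that] a by linarith
  then show "ereal (\<Sum>i < length P - 1. norm (x' (P ! Suc i) - x' (P ! i)) powr p)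
    = ereal (\<Sum>i < length P - 1. norm (x (P ! Suc i) - x (P ! i)) powr p)"
    using eq by (auto intro!: sum.cong)
qed simp

lemma SP_cong:
  assumes SP: "SP l y x k" and eq: "\<And>t. t \<ge> 0 \<Longrightarrow> x' t = x t" "\<And>t. t \<ge> 0 \<Longrightarrow> k' t = k t"
  shows "SP l y x' k'"
  unfolding SP_def
proof (intro conjI allI impI)
  show "x' t = y t + k' t" "l t \<le> x' t" if "0 \<le> t" for t using SP eq that by (auto simp: SP_def)
  show "k' 0 = 0" using SP eq(2)[of 0] by (simp add: SP_def)
  show "mono_on {0..} (\<lambda>t. k' t $ i)" for i using SP eq by (auto simp: SP_def mono_on_def)
  fix i and t :: real assume t: "0 \<le> t"
  \<comment> \<open>The measure sees k through \<open>max 0 s\<close> only, so the two functions are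
    equal everywhere.\<close>
  have k: "(\<lambda>s. k' (max 0 s) $ i) = (\<lambda>s. k (max 0 s) $ i)" using eq by auto
  have "(\<integral>\<^sup>+ s. ennreal (x' s $ i - l s $ i) * indicator {0<..t} s \<partial>interval_measure (\<lambda>s. k (max 0 s) $ i))
    = (\<integral>\<^sup>+ s. ennreal (x s $ i - l s $ i) * indicator {0<..t} s \<partial>interval_measure (\<lambda>s. k (max 0 s) $ i))"
    using eq by (intro nn_integral_cong) (auto simp: indicator_def)
  also have "\<dots> = 0" using SP t by (auto simp: SP_def)
  finally show "(\<integral>\<^sup>+ s. ennreal (x' s $ i - l s $ i) * indicator {0<..t} s \<partial>interval_measure (\<lambda>s. k' (max 0 s) $ i)) = 0"
    unfolding k .
qed

text \<open>J1 limits are determined on [0,\<infinity>) only, so an arbitrary limit point agrees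
  with the constructed solution only there.\<close>

lemma is_solution_cong:
  assumes sol: "is_solution p f g x0 a z l x k"
    and eq: "\<And>t. t \<ge> 0 \<Longrightarrow> x' t = x t" "\<And>t. t \<ge> 0 \<Longrightarrow> k' t = k t"
  shows "is_solution p f g x0 a z l x' k'"
proof -
  have cad: "cadlag x'" "cadlag k'"
    using sol eq by (auto simp: is_solution_def intro: cadlag_cong)
  have V: "V_var p x' 0 T = V_var p x 0 T" for T
    using v_var_cong[of x' x 0 p T] eq(1) by (simp add: V_var_def)
  obtain I J where IJ: "\<forall>t\<ge>0. RS_has (\<lambda>v r. r *\<^sub>R v) (\<lambda>s. f (leftlim x s)) a 0 t (I t) \<and>
      RS_has (\<lambda>A v. A *v v) (\<lambda>s. g (leftlim x s)) z 0 t (J t)" and SP: "SP l (\<lambda>t. x0 + I t + J t) x k"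
    using sol unfolding is_solution_def by blast
  have "\<forall>T\<ge>0. V_var p x 0 T < \<infinity>" using sol unfolding is_solution_def by blast
  moreover have "\<exists>I J. (\<forall>t\<ge>0. RS_has (\<lambda>v r. r *\<^sub>R v) (\<lambda>s. f (leftlim x' s)) a 0 t (I t) \<and>
      RS_has (\<lambda>A v. A *v v) (\<lambda>s. g (leftlim x' s)) z 0 t (J t)) \<and> SP l (\<lambda>t. x0 + I t + J t) x' k'"
  proof -
    have ll: "leftlim x' = leftlim x" using eq(1) by (rule leftlim_cong)
    have "\<forall>t\<ge>0. RS_has (\<lambda>v r. r *\<^sub>R v) (\<lambda>s. f (leftlim x' s)) a 0 t (I t) \<and>
      RS_has (\<lambda>A v. A *v v) (\<lambda>s. g (leftlim x' s)) z 0 t (J t)" using IJ by (simp only: ll)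
    moreover have "SP l (\<lambda>t. x0 + I t + J t) x' k'" using SP eq by (rule SP_cong)
    ultimately show ?thesis by blast
  qed
  ultimately show ?thesis
    unfolding is_solution_def V using cad by (intro conjI)
qed

section \<open>Uniform bounds in original time and transfer along the time changes\<close>

context young_sde
begin

lemma sol_compose:
  assumes sol: "sol c a z l x k I J" and lam: "time_change lam"
  shows "sol c (a \<circ> lam) (z \<circ> lam) (l \<circ> lam) (x \<circ> lam) (k \<circ> lam) (I \<circ> lam) (J \<circ> lam)"
proof -
  note T = time_changeD[OF lam]
  have sk: "skor (\<lambda>t. l t $ i - (c + I t + J t) $ i) (\<lambda>t. k t $ i)" for i using sol by (simp add: sol_def)
  have "skor (\<lambda>t. (l \<circ> lam) t $ i - (c + (I \<circ> lam) t + (J \<circ> lam) t) $ i) (\<lambda>t. (k \<circ> lam) t $ i)" for i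
    using skor_compose[OF sk[of i] lam] by (simp add: o_def)
  then show ?thesis
    using sol Lint_compose[OF _ lam, of Mf x a I] Lint_compose[OF _ lam, of Mg x z J] T(1,2)
    by (auto simp: sol_def)
qed

lemma RS_has_0:
  assumes RS: "RS_has m h z 0 0 I" and m: "\<And>y. m y 0 = 0"
  shows "I = 0"
proof -
  have "norm I < e" if e: "e > 0" for e
  proof -
    from RS[unfolded RS_has_def, rule_format, OF e] obtain P where P: "subdivision P 0 0" and
      P': "\<forall>Q \<xi>. subdivision Q 0 0 \<and> set P \<subseteq> set Q \<and> (\<forall>i < length Q - 1. Q ! i \<le> \<xi> i \<and> \<xi> i \<le> Q ! Suc i) \<longrightarrow>
         norm ((\<Sum>i < length Q - 1. m (h (\<xi> i)) (z (Q ! Suc i) - z (Q ! i))) - I) < e"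
      by (elim exE conjE)
    note D = subdivisionD[OF P]
    have "length P - 1 = 0"
    proof (rule ccontr)
      assume "length P - 1 \<noteq> 0"
      then have "P ! 0 < P ! (length P - 1)" using D(4)[of 0 "length P - 1"] by simp
      then show False using D(1,2) by simp
    qed
    then show ?thesis using P'[rule_format, of P "\<lambda>i. P!i"] P by simp
  qed
  then show ?thesis using norm_le_zero_iff[of I] by (meson linorder_not_less less_irrefl zero_less_norm_iff)
qed

lemma is_solution_imp_sol:
  assumes "is_solution p f g c a z l x k"
  obtains I J where "sol c a z l x k I J"
proof -
  obtain I J where cad: "cadlag x" "cadlag k"
    and RI: "\<And>t. t \<ge> 0 \<Longrightarrow> RS_has (\<lambda>v r. r *\<^sub>R v) (\<lambda>s. f (leftlim x s)) a 0 t (I t)"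
    and RJ: "\<And>t. t \<ge> 0 \<Longrightarrow> RS_has (\<lambda>A v. A *v v) (\<lambda>s. g (leftlim x s)) z 0 t (J t)"
    and SP: "SP l (\<lambda>t. c + I t + J t) x k"
    using assms unfolding is_solution_def by blast
  have RI': "RS_has Mf (leftlim x) a 0 t (I t)" and RJ': "RS_has Mg (leftlim x) z 0 t (J t)" if "t \<ge> 0" for t
    using RI[OF that] RJ[OF that] by (simp_all add: RS_has_def)
  have "I 0 = 0" "J 0 = 0" using RS_has_0[OF RI'[OF order_refl]] RS_has_0[OF RJ'[OF order_refl]] by auto
  moreover have "Lint Mf x a I" by (rule RS_has_imp_Lint[OF cad(1) Mf_cont1 RI'])
  moreover have "Lint Mg x z J" by (rule RS_has_imp_Lint[OF cad(1) Mg_cont1 RJ'])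
  moreover have x: "x t = c + I t + J t + k t" "l t \<le> x t" if "t \<ge> 0" for t using SP that by (auto simp: SP_def)
  moreover have k0: "k 0 = 0" using SP by (simp add: SP_def)
  moreover have "skor (\<lambda>t. l t $ i - (c + I t + J t) $ i) (\<lambda>t. k t $ i)" for i
  proof (rule interval_measure_imp_skor)
    show "mono_on {0..} (\<lambda>t. k t $ i)" using SP by (simp add: SP_def)
    show "((\<lambda>t. k t $ i) \<longlongrightarrow> k t $ i) (at_right t)" if "t \<ge> 0" for t
      using cad(2) that by (intro tendsto_vec_nth) (auto simp: cadlag_def)
    show "k 0 $ i = 0" using k0 by simp
    show "l t $ i - (c + I t + J t) $ i \<le> k t $ i" if "t \<ge> 0" for t
      using x[OF that] by (auto simp: less_eq_vec_def dest: spec[of _ i])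
    fix t :: real assume t: "t \<ge> 0"
    have "(\<integral>\<^sup>+ s. ennreal (k s $ i - (l s $ i - (c + I s + J s) $ i)) * indicator {0<..t} s
        \<partial>interval_measure (\<lambda>s. k (max 0 s) $ i))
      = (\<integral>\<^sup>+ s. ennreal (x s $ i - l s $ i) * indicator {0<..t} s \<partial>interval_measure (\<lambda>s. k (max 0 s) $ i))"
    \<comment> \<open>The equation for x is known at nonnegative times only; elsewhere the indicator
      is 0 on both sides.\<close>
    proof (rule nn_integral_cong)
      fix s
      show "ennreal (k s $ i - (l s $ i - (c + I s + J s) $ i)) * indicator {0<..t} s
        = ennreal (x s $ i - l s $ i) * indicator {0<..t} s"
        using x(1)[of s] by (cases "s > 0") (auto simp: indicator_def algebra_simps)
    qed
    also have "\<dots> = 0" using SP t by (auto simp: SP_def)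
    finally show "(\<integral>\<^sup>+ s. ennreal (k s $ i - (l s $ i - (c + I s + J s) $ i)) * indicator {0<..t} s
        \<partial>interval_measure (\<lambda>s. k (max 0 s) $ i)) = 0" .
  qed
  ultimately have "sol c a z l x k I J" unfolding sol_def by blast
  then show ?thesis using that by blast
qed

text \<open>The sum of the two variation functions and the identity, made right-continuous by
  \<open>rlim\<close>. The identity provides strict monotonicity and survives \<open>rlim\<close>
  because it is itself controlled.\<close>

lemma driver_control_exists:
  fixes a :: "real \<Rightarrow> real" and z :: "real \<Rightarrow> real^'d"
  assumes a: "cadlag a" and z: "cadlag z"
    and V: "\<And>T. T \<ge> 0 \<Longrightarrow> V_var 1 a 0 T \<le> ereal (Mb T) \<and> V_var p z 0 T \<le> ereal (Mb T)"
  obtains F where "driver_control {0..} a z F" "\<And>t c. 0 \<le> t \<Longrightarrow> F t < c \<Longrightarrow> \<exists>u>t. F u < c"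
    "\<And>T. T \<ge> 0 \<Longrightarrow> F T - F 0 \<le> \<bar>Mb (T + 1)\<bar> + \<bar>Mb (T + 1)\<bar> powr p + (T + 1)"
proof -
  define Fa where "Fa t = real_of_ereal (v_var 1 a 0 t)" for t
  define Fz where "Fz t = real_of_ereal (v_var p z 0 t)" for t
  have va: "v_var 1 a 0 t \<le> ereal (\<bar>Mb t\<bar>)" if "t \<ge> 0" for t
    using V_var_imp_v_var[of 1 a 0 t "Mb t"] V[OF that] that by simp
  have vz: "v_var p z 0 t \<le> ereal (\<bar>Mb t\<bar> powr p)" if "t \<ge> 0" for t
    using V_var_imp_v_var[of p z 0 t "Mb t"] V[OF that] that p0 by simp
  have pa: "pcontrol 1 {0..} a Fa"
    unfolding Fa_def
  proof (rule v_var_pcontrol)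
    fix t :: real assume "t \<in> {0..}"
    then show "0 \<le> t \<and> v_var 1 a 0 t < \<infinity>" using va[of t] by (cases "v_var 1 a 0 t") auto
  qed
  have pz: "pcontrol p {0..} z Fz"
    unfolding Fz_def
  proof (rule v_var_pcontrol)
    fix t :: real assume "t \<in> {0..}"
    then show "0 \<le> t \<and> v_var p z 0 t < \<infinity>" using vz[of t] by (cases "v_var p z 0 t") auto
  qed
  have Fa: "0 \<le> Fa t" "Fa t \<le> \<bar>Mb t\<bar>" if "t \<ge> 0" for t
    using va[OF that] v_var_nonneg[OF that, of 1 a] by (cases "v_var 1 a 0 t"; simp add: Fa_def)+
  have Fz: "0 \<le> Fz t" "Fz t \<le> \<bar>Mb t\<bar> powr p" if "t \<ge> 0" for t
    using vz[OF that] v_var_nonneg[OF that, of p z] by (cases "v_var p z 0 t"; simp add: Fz_def)+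
  define F where "F t = Fa t + Fz t + t" for t
  have Fam: "Fa s \<le> Fa t" if "s \<in> {0..}" "t \<in> {0..}" "s \<le> t" for s t using pcontrol_mono[OF pa that] .
  have Fzm: "Fz s \<le> Fz t" if "s \<in> {0..}" "t \<in> {0..}" "s \<le> t" for s t using pcontrol_mono[OF pz that] .
  have Fm: "mono_on {0..} F" using Fam Fzm by (auto simp: mono_on_def F_def intro!: add_mono)
  have 1: "pcontrol 1 {0..} a F"
    using pcontrol_add[OF pa, of "\<lambda>t. Fz t + t"] Fzm by (simp add: F_def[abs_def] add.assoc add_mono)
  have 2: "pcontrol p {0..} z F"
    using pcontrol_add[OF pz, of "\<lambda>t. Fa t + t"] Fam by (simp add: F_def[abs_def] add.assoc add_mono add.left_commute)
  have 3: "pcontrol 1 {0..} (\<lambda>t. t) F"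
  proof -
    have "pcontrol 1 {0..} (\<lambda>t::real. t) (\<lambda>t. t)" by (simp add: pcontrol_def)
    from pcontrol_add[OF this, of "\<lambda>t. Fa t + Fz t"] show ?thesis
      using Fam Fzm by (simp add: F_def[abs_def] add_mono add.commute add.assoc)
  qed
  show ?thesis
  proof (rule that[of "rlim F"])
    have ra: "\<And>t. t \<ge> 0 \<Longrightarrow> (a \<longlongrightarrow> a t) (at_right t)" and rz: "\<And>t. t \<ge> 0 \<Longrightarrow> (z \<longlongrightarrow> z t) (at_right t)"
      using a z by (auto simp: cadlag_def)
    have 4: "pcontrol 1 {0..} (\<lambda>t. t) (rlim F)" by (rule pcontrol_rlim[OF Fm 3]) auto
    have "strict_mono_on {0..} (rlim F)"
    proof (rule strict_mono_onI)
      fix s t :: real assume "s \<in> {0..}" "t \<in> {0..}" "s < t"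
      then show "rlim F s < rlim F t" using pcontrolD[OF 4, of s t] by simp
    qed
    then show "driver_control {0..} a z (rlim F)"
      using pcontrol_rlim[OF Fm 1 _ ra] pcontrol_rlim[OF Fm 2 p0 rz] by (simp add: driver_control_def)
    show "\<exists>u>t. rlim F u < c" if "0 \<le> t" "rlim F t < c" for t c
      using rlim_right[OF Fm that] by blast
    fix T :: real assume T: "T \<ge> 0"
    \<comment> \<open>The right limit at T looks past T, hence the variation bounds at T +
      1.\<close>
    have "rlim F T \<le> F (T + 1)" using T by (intro rlim_le[OF Fm]) auto
    moreover have "0 \<le> rlim F 0" using rlim_ge[OF Fm order_refl] Fa(1)[of 0] Fz(1)[of 0] by (simp add: F_def)
    ultimately show "rlim F T - rlim F 0 \<le> \<bar>Mb (T + 1)\<bar> + \<bar>Mb (T + 1)\<bar> powr p + (T + 1)"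
      using Fa(2)[of "T+1"] Fz(2)[of "T+1"] T by (simp add: F_def)
  qed
qed

text \<open>The number of portions is the ceiling of b / \<epsilon>0 and hence the same for all
  paths. Adding the increase of F to the control of x gives one H for x and both drivers.\<close>

lemma a_priori:
  "\<exists>B. \<forall>c a z l x k I J F T. bounded_sol 0 T b R Ml c a z l x k I J F \<longrightarrow> (\<exists>H. total_control T B x a z H)"
proof -
  define n where "n = nat \<lceil>b / \<epsilon>0\<rceil>"
  have nb: "b \<le> real n * \<epsilon>0"
  proof -
    have "b / \<epsilon>0 \<le> real n" unfolding n_def by (rule real_nat_ceiling_ge)
    then show ?thesis using \<epsilon>0(1) by (simp add: field_simps)
  qed
  obtain B where B: "\<And>c a z l x k I J F s T. bounded_sol s T (real n * \<epsilon>0) R Ml c a z l x k I J F \<Longrightarrow>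
     (\<exists>G. pcontrol p {s..T} x G \<and> (\<forall>t\<in>{s..T}. 0 \<le> G t \<and> G t \<le> B))"
    using a_priori_steps[of n R Ml] by blast
  have "\<exists>H. total_control T (B + b) x a z H" if bs: "bounded_sol 0 T b R Ml c a z l x k I J F" for c a z l x k I J F T
  proof -
    have dr: "driver_control {0..T} a z F" and Fb: "F T - F 0 \<le> b"
      using bs unfolding bounded_sol_def by blast+
    have Fm: "F s \<le> F t" if "0 \<le> s" "s \<le> t" "t \<le> T" for s t
      using dr that pcontrol_mono[of 1 "{0..T}" a F s t] by (auto simp: driver_control_def)
    have "bounded_sol 0 T (real n * \<epsilon>0) R Ml c a z l x k I J F"
      using bs Fb nb unfolding bounded_sol_def by force
    from B[OF this] obtain G where G: "pcontrol p {0..T} x G" "\<And>t. t \<in> {0..T} \<Longrightarrow> 0 \<le> G t \<and> G t \<le> B" by blast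
    have Gm: "G s \<le> G t" if "s \<in> {0..T}" "t \<in> {0..T}" "s \<le> t" for s t using pcontrol_mono[OF G(1) that] .
    define H where "H t = G t + (F t - F 0)" for t
    have "total_control T (B + b) x a z H"
      unfolding total_control_def
    proof (intro conjI ballI)
      show "pcontrol p {0..T} x H" unfolding H_def using Fm by (intro pcontrol_add[OF G(1)]) auto
      have F': "pcontrol 1 {0..T} a (\<lambda>t. F t - F 0)" "pcontrol p {0..T} z (\<lambda>t. F t - F 0)"
        using dr by (auto simp: driver_control_def pcontrol_def)
      show "pcontrol 1 {0..T} a H" "pcontrol p {0..T} z H"
        unfolding H_def[abs_def] add.commute[of "G _"] using Gm by (intro pcontrol_add F'; simp)+
      fix t assume t: "t \<in> {0..T}"
      show "0 \<le> H t" using G(2)[OF t] Fm[of 0 t] t by (simp add: H_def)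
      show "H t \<le> B + b" using G(2)[OF t] Fm[of t T] t Fb by (simp add: H_def)
    qed
    then show ?thesis by blast
  qed
  then show ?thesis by (intro exI[of _ "B + b"]) blast
qed

text \<open>Joint convergence supplies one time change for all three drivers, and composing with it
  turns J1 convergence into locally uniform convergence of the data. The a priori bound is obtained
  in original time, where the driver control is right-continuous, and its control H is then composed
  with the time change.\<close>

lemma subsequence_solution:
  fixes an :: "nat \<Rightarrow> real \<Rightarrow> real" and zn ln xn kn :: "nat \<Rightarrow> real \<Rightarrow> real^'d"
  assumes cad: "\<And>n. cadlag (an n)" "\<And>n. cadlag (zn n)"
    and V: "\<And>n T. T \<ge> 0 \<Longrightarrow> V_var 1 (an n) 0 T \<le> ereal (Mb T) \<and> V_var p (zn n) 0 T \<le> ereal (Mb T)"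
    and x0: "x0n \<longlonglongrightarrow> x0"
    and J1: "J1_conv (\<lambda>n t. (an n t, zn n t, ln n t)) (\<lambda>t. (a t, z t, l t))"
    and sol: "\<And>n. is_solution p f g (x0n n) (an n) (zn n) (ln n) (xn n) (kn n)"
  obtains r x k where "strict_mono (r :: nat \<Rightarrow> nat)"
    "J1_conv (\<lambda>j t. (xn (r j) t, kn (r j) t)) (\<lambda>t. (x t, k t))" "is_solution p f g x0 a z l x k"
proof -
  have cadl: "cadlag a" "cadlag z" "cadlag l"
    using J1 cadlag_fst[of a "\<lambda>t. (z t, l t)"] cadlag_snd[of a "\<lambda>t. (z t, l t)"] cadlag_fst[of z l] cadlag_snd[of z l]
    by (auto simp: J1_conv_def)
  from J1 obtain lam where Lam: "\<forall>n. time_change (lam n)" "\<forall>e>0. \<exists>N. \<forall>n\<ge>N. \<forall>t\<ge>0. \<bar>lam n t - t\<bar> \<le> e"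
    "\<forall>T\<ge>0. \<forall>e>0. \<exists>N. \<forall>n\<ge>N. \<forall>t\<in>{0..T}. dist (an n (lam n t), zn n (lam n t), ln n (lam n t)) (a t, z t, l t) \<le> e"
    unfolding J1_conv_def by (elim conjE exE)
  note lam = Lam(1)[rule_format] and lam1 = Lam(2)[rule_format] and lam2 = Lam(3)[rule_format]
  have lu3: "lu_conv (\<lambda>n t. (an n (lam n t), zn n (lam n t), ln n (lam n t))) (\<lambda>t. (a t, z t, l t))"
  proof (rule lu_convI)
    fix T e :: real assume T: "0 \<le> T" and e: "e > 0"
    have e2: "e/2 > 0" using e by simp
    obtain N where N: "\<forall>n\<ge>N. \<forall>t\<in>{0..T}. dist (an n (lam n t), zn n (lam n t), ln n (lam n t)) (a t, z t, l t) \<le> e/2"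
      using lam2[OF T e2] by blast
    show "\<exists>N. \<forall>n\<ge>N. \<forall>t. 0 \<le> t \<longrightarrow> t \<le> T \<longrightarrow> dist (an n (lam n t), zn n (lam n t), ln n (lam n t)) (a t, z t, l t) < e"
    proof (intro exI[of _ N] allI impI)
      fix n t assume "n \<ge> N" "0 \<le> t" "t \<le> T"
      then have "dist (an n (lam n t), zn n (lam n t), ln n (lam n t)) (a t, z t, l t) \<le> e/2" using N by auto
      then show "dist (an n (lam n t), zn n (lam n t), ln n (lam n t)) (a t, z t, l t) < e" using e by linarith
    qed
  qed
  have lua: "lu_conv (\<lambda>n. an n \<circ> lam n) a"
    using lu_conv_lipschitz[OF lu3, of fst] dist_fst_le by (force simp: o_def)
  have lu2: "lu_conv (\<lambda>n t. (zn n (lam n t), ln n (lam n t))) (\<lambda>t. (z t, l t))"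
    using lu_conv_lipschitz[OF lu3, of snd] dist_snd_le by force
  have luz: "lu_conv (\<lambda>n. zn n \<circ> lam n) z"
    using lu_conv_lipschitz[OF lu2, of fst] dist_fst_le by (force simp: o_def)
  have lul: "lu_conv (\<lambda>n. ln n \<circ> lam n) l"
    using lu_conv_lipschitz[OF lu2, of snd] dist_snd_le by (force simp: o_def)
  have "\<forall>n. \<exists>I J. sol (x0n n) (an n) (zn n) (ln n) (xn n) (kn n) I J"
    using is_solution_imp_sol[OF sol] by metis
  then obtain In Jn where IJ: "\<And>n. sol (x0n n) (an n) (zn n) (ln n) (xn n) (kn n) (In n) (Jn n)" by metis
  define bb where "bb T = \<bar>Mb (T + 1)\<bar> + \<bar>Mb (T + 1)\<bar> powr p + (T + 1)" for T
  have "\<forall>n. \<exists>F. driver_control {0..} (an n) (zn n) F \<and> (\<forall>t c. 0 \<le> t \<longrightarrow> F t < c \<longrightarrow> (\<exists>u>t. F u < c)) \<and>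
     (\<forall>T\<ge>0. F T - F 0 \<le> bb T)"
  proof
    fix n
    obtain F where "driver_control {0..} (an n) (zn n) F" "\<And>t c. 0 \<le> t \<Longrightarrow> F t < c \<Longrightarrow> \<exists>u>t. F u < c"
      "\<And>T. T \<ge> 0 \<Longrightarrow> F T - F 0 \<le> bb T"
      using driver_control_exists[OF cad(1)[of n] cad(2)[of n] V] unfolding bb_def by blast
    then show "\<exists>F. driver_control {0..} (an n) (zn n) F \<and> (\<forall>t c. 0 \<le> t \<longrightarrow> F t < c \<longrightarrow> (\<exists>u>t. F u < c)) \<and>
     (\<forall>T\<ge>0. F T - F 0 \<le> bb T)" by blast
  qed
  then obtain F where F: "\<And>n. driver_control {0..} (an n) (zn n) (F n)" "\<And>n. \<forall>t c. 0 \<le> t \<longrightarrow> F n t < c \<longrightarrow> (\<exists>u>t. F n u < c)"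
     "\<And>n T. T \<ge> 0 \<Longrightarrow> F n T - F n 0 \<le> bb T" by metis
  have x00: "xn n 0 = x0n n" for n using IJ[of n] by (simp add: sol_def)
  have "Bseq x0n" using x0 by (intro convergent_imp_Bseq) (auto simp: convergent_def)
  then obtain R where R: "\<And>n. norm (x0n n) \<le> R" unfolding Bseq_def by blast
  obtain N1 where N1: "\<And>n t. n \<ge> N1 \<Longrightarrow> t \<ge> 0 \<Longrightarrow> \<bar>lam n t - t\<bar> \<le> 1" using lam1[of 1] by auto
  have tot: "\<exists>B N. \<forall>n\<ge>N. \<exists>H. total_control T B (xn n \<circ> lam n) (an n \<circ> lam n) (zn n \<circ> lam n) H" if T: "T \<ge> 0" for T
  proof -
    \<comment> \<open>The time changes differ from the identity by at most 1 for late n. So [0,T] is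
      mapped into [0,T+1], and times up to T + 1 are images of times up to T + 2.\<close>
    obtain Bl where Bl: "\<And>t. 0 \<le> t \<Longrightarrow> t \<le> T + 2 \<Longrightarrow> norm (l t) \<le> Bl" using cadlag_bounded[OF cadl(3)] by metis
    obtain N2 where N2: "\<And>n t. n \<ge> N2 \<Longrightarrow> 0 \<le> t \<Longrightarrow> t \<le> T + 2 \<Longrightarrow> dist ((ln n \<circ> lam n) t) (l t) < 1"
      using lu_convD[OF lul, of 1 "T + 2"] by auto
    obtain B where B: "\<And>c a z l x k I J F T'. bounded_sol 0 T' (bb (T + 1)) R (Bl + 1) c a z l x k I J F \<Longrightarrow>
     (\<exists>H. total_control T' B x a z H)" using a_priori[of "bb (T + 1)" R "Bl + 1"] by blast
    have "\<exists>H. total_control T B (xn n \<circ> lam n) (an n \<circ> lam n) (zn n \<circ> lam n) H" if n: "n \<ge> max N1 N2" for n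
    proof -
      note tc = time_changeD[OF lam[of n]]
      have "\<exists>H. total_control (T + 1) B (xn n) (an n) (zn n) H"
      proof (rule B, unfold bounded_sol_def, intro conjI)
        show "driver_control {0..T + 1} (an n) (zn n) (F n)"
          using F(1)[of n] unfolding driver_control_def by (auto intro: pcontrol_subset monotone_on_subset)
        show "\<forall>t c. 0 \<le> t \<longrightarrow> t < T + 1 \<longrightarrow> F n t < c \<longrightarrow> (\<exists>u. t < u \<and> u \<le> T + 1 \<and> F n u < c)"
        proof (intro allI impI)
          fix t c assume tc: "0 \<le> t" "t < T + 1" "F n t < c"
          then obtain u where u: "u > t" "F n u < c" using F(2) by blast
          have pc: "pcontrol 1 {0..} (an n) (F n)" using F(1)[of n] by (simp add: driver_control_def)
          have "F n (min u (T + 1)) \<le> F n u" using u T tc by (intro pcontrol_mono[OF pc]) simp_all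
          then show "\<exists>u. t < u \<and> u \<le> T + 1 \<and> F n u < c" using u tc by (intro exI[of _ "min u (T + 1)"]) auto
        qed
        show "norm (xn n 0) \<le> R" using x00 R by simp
        \<comment> \<open>Only the time-changed barriers converge uniformly, so a bound at time s is
          read off at a preimage of s.\<close>
        show "\<forall>r\<in>{0..T + 1}. norm (ln n r) \<le> Bl + 1"
        proof
          fix s assume s: "s \<in> {0..T + 1}"
          then obtain t where t: "t \<ge> 0" "lam n t = s" using tc(5)[of s] by auto
          have t2: "t \<le> T + 2" using N1[of n t] n t s by auto
          have "dist (ln n s) (l t) < 1" using N2[of n t] n t t2 by simp
          then have "norm (ln n s) \<le> norm (l t) + 1"
            using norm_triangle_sub[of "ln n s" "l t"] by (simp add: dist_norm)
          then show "norm (ln n s) \<le> Bl + 1" using Bl[OF t(1) t2] by linarith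
        qed
        have "V_var p (xn n) 0 (T + 1) < \<infinity>" using sol[of n] T by (auto simp: is_solution_def)
        then show "v_var p (xn n) 0 (T + 1) < \<infinity>" by (cases "v_var p (xn n) 0 (T + 1) = \<infinity>") (auto simp: V_var_def)
      qed (use T IJ F(3) in auto)
      then obtain H where H: "total_control (T + 1) B (xn n) (an n) (zn n) H" by blast
      have in1: "lam n t \<in> {0..T + 1}" if "t \<in> {0..T}" for t using tc(2)[of t] N1[of n t] n that by auto
      have pc: "pcontrol q {0..T} (y \<circ> lam n) (H \<circ> lam n)" if y: "pcontrol q {0..T + 1} y H" for q and y :: "real \<Rightarrow> 'b::real_normed_vector"
        unfolding pcontrol_def
      proof (intro ballI impI)
        fix s t assume st: "s \<in> {0..T}" "t \<in> {0..T}" "s \<le> t"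
        then show "norm ((y \<circ> lam n) t - (y \<circ> lam n) s) powr q \<le> (H \<circ> lam n) t - (H \<circ> lam n) s"
          using pcontrolD[OF y in1[of s] in1[of t]] tc(4)[of s t] by simp
      qed
      have "total_control T B (xn n \<circ> lam n) (an n \<circ> lam n) (zn n \<circ> lam n) (H \<circ> lam n)"
        using H in1 unfolding total_control_def by (auto intro!: pc)
      then show ?thesis by blast
    qed
    then show ?thesis by blast
  qed
  have cadx: "cadlag (xn n \<circ> lam n)" "cadlag (kn n \<circ> lam n)" for n
    using sol[of n] by (auto simp: is_solution_def intro: cadlag_compose lam)
  obtain r x k where r: "strict_mono (r :: nat \<Rightarrow> nat)" and lux: "lu_conv (\<lambda>n. xn (r n) \<circ> lam (r n)) x"
    and luk: "lu_conv (\<lambda>n. kn (r n) \<circ> lam (r n)) k" and S: "is_solution p f g x0 a z l x k"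
    using sol_limit[OF sol_compose[OF IJ lam] cadx lua luz lul cadl x0 tot] by blast
  have rr: "\<And>n N. n \<ge> N \<Longrightarrow> r n \<ge> N" using seq_suble[OF r] order_trans by blast
  have "J1_conv (\<lambda>j t. (xn (r j) t, kn (r j) t)) (\<lambda>t. (x t, k t))"
    unfolding J1_conv_def
  proof (intro conjI exI[of _ "\<lambda>j. lam (r j)"] allI impI)
    show "cadlag (\<lambda>t. (x t, k t))" using S by (auto simp: is_solution_def intro: cadlag_Pair)
    show "\<exists>N. \<forall>n\<ge>N. \<forall>t\<ge>0. \<bar>lam (r n) t - t\<bar> \<le> e" if "e > 0" for e
      using lam1[OF that] rr by meson
    fix T e :: real assume e: "e > 0"
    obtain N3 where N3: "\<And>n t. n \<ge> N3 \<Longrightarrow> 0 \<le> t \<Longrightarrow> t \<le> T \<Longrightarrow> dist ((xn (r n) \<circ> lam (r n)) t) (x t) < e/2"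
      using lu_convD[OF lux, of "e/2" T] e by auto
    obtain N4 where N4: "\<And>n t. n \<ge> N4 \<Longrightarrow> 0 \<le> t \<Longrightarrow> t \<le> T \<Longrightarrow> dist ((kn (r n) \<circ> lam (r n)) t) (k t) < e/2"
      using lu_convD[OF luk, of "e/2" T] e by auto
    show "\<exists>N. \<forall>n\<ge>N. \<forall>t\<in>{0..T}. dist (xn (r n) (lam (r n) t), kn (r n) (lam (r n) t)) (x t, k t) \<le> e"
    proof (intro exI[of _ "max N3 N4"] allI impI ballI)
      fix n t assume "n \<ge> max N3 N4" "t \<in> {0..T}"
      then have "norm (xn (r n) (lam (r n) t) - x t) < e/2" "norm (kn (r n) (lam (r n) t) - k t) < e/2"
        using N3[of n t] N4[of n t] by (auto simp: dist_norm)
      then show "dist (xn (r n) (lam (r n) t), kn (r n) (lam (r n) t)) (x t, k t) \<le> e"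
        using norm_Pair_le[of "xn (r n) (lam (r n) t) - x t" "kn (r n) (lam (r n) t) - k t"]
        by (simp add: dist_norm)
    qed
  qed (rule lam)
  then show ?thesis using that r S by blast
qed

end

text \<open>Relative compactness of a range concerns arbitrary sequences of its members, with
  indices in any order. If no index recurs infinitely often, only finitely many n have m n below a
  given bound, so both n and m n can be increased together.\<close>

lemma index_subsequence:
  fixes m :: "nat \<Rightarrow> nat"
  obtains (const) v q where "strict_mono (q :: nat \<Rightarrow> nat)" "\<And>n. m (q n) = v"
  | (strict) q where "strict_mono (q :: nat \<Rightarrow> nat)" "strict_mono (m \<circ> q)"
proof (cases "\<exists>v. infinite {n. m n = v}")
  case True
  then obtain v where v: "infinite {n. m n = v}" by blast
  have "m (enumerate {n. m n = v} n) = v" for n using enumerate_in_set[OF v, of n] by simp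
  then show ?thesis using const[of "enumerate {n. m n = v}" v] strict_mono_enumerate[OF v] by blast
next
  case False
  have ex: "\<exists>y. x < y \<and> m x < m y" for x
  proof -
    have "finite (\<Union>v\<in>{..m x}. {n. m n = v})" using False by auto
    moreover have "(\<Union>v\<in>{..m x}. {n. m n = v}) = {n. m n \<le> m x}" by auto
    ultimately have "finite ({n. m n \<le> m x} \<union> {..x})" by simp
    then obtain y where "y \<notin> {n. m n \<le> m x} \<union> {..x}" using ex_new_if_finite[OF infinite_UNIV_nat] by blast
    then show ?thesis by (intro exI[of _ y]) auto
  qed
  obtain q where q: "\<And>n::nat. q n < q (Suc n) \<and> m (q n) < m (q (Suc n))"
    using dependent_nat_choice[of "\<lambda>_ _. True" "\<lambda>_ x y. x < y \<and> m x < m y"] ex by auto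
  show ?thesis
  proof (rule strict[of q])
    show "strict_mono q" "strict_mono (m \<circ> q)" using q by (auto simp: strict_mono_Suc_iff)
  qed
qed

theorem theorem3:
  fixes p L \<alpha> C\<alpha> :: real
    and f :: "real^'d \<Rightarrow> real^'d" and g :: "real^'d \<Rightarrow> real^'d^'d"
    and an :: "nat \<Rightarrow> real \<Rightarrow> real" and zn ln :: "nat \<Rightarrow> real \<Rightarrow> real^'d"
    and x0n :: "nat \<Rightarrow> real^'d"
    and a :: "real \<Rightarrow> real" and z l :: "real \<Rightarrow> real^'d" and x0 :: "real^'d"
    and xn kn :: "nat \<Rightarrow> real \<Rightarrow> real^'d"
  assumes "p \<ge> 1"
    and "continuous_on UNIV f" and "L > 0" and "\<forall>x. norm (f x) \<le> L * (1 + norm x)"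
    and "p - 1 < \<alpha>" and "\<alpha> \<le> 1" and "C\<alpha> > 0"
    and "\<forall>x y. onorm (\<lambda>v. (g x - g y) *v v) \<le> C\<alpha> * norm (x - y) powr \<alpha>"
    and "\<forall>n. cadlag (an n) \<and> cadlag (zn n) \<and> cadlag (ln n)"
    and "\<forall>n. ln n 0 \<le> x0n n"
    and "\<forall>T\<ge>0. \<exists>M::real. \<forall>n. V_var 1 (an n) 0 T \<le> ereal M \<and> V_var p (zn n) 0 T \<le> ereal M"
    and "x0n \<longlonglongrightarrow> x0"
    and "J1_conv (\<lambda>n t. (an n t, zn n t, ln n t)) (\<lambda>t. (a t, z t, l t))"
    and "\<forall>n. is_solution p f g (x0n n) (an n) (zn n) (ln n) (xn n) (kn n)"
  shows "relcompact_D (range (\<lambda>n t. (xn n t, kn n t))) \<and>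
         (\<forall>r y. strict_mono r \<and> J1_conv (\<lambda>j t. (xn (r j) t, kn (r j) t)) y \<longrightarrow>
                is_solution p f g x0 a z l (\<lambda>t. fst (y t)) (\<lambda>t. snd (y t)))"
proof -
  interpret young_sde p L \<alpha> C\<alpha> f g
  proof
    fix x y v
    have "norm ((g x - g y) *v v) \<le> onorm (\<lambda>v. (g x - g y) *v v) * norm v"
      by (rule onorm) (rule matrix_vector_mul_bounded_linear)
    also have "\<dots> \<le> C\<alpha> * norm (x - y) powr \<alpha> * norm v" using assms(8) by (intro mult_right_mono) auto
    finally show "norm ((g x - g y) *v v) \<le> C\<alpha> * norm (x - y) powr \<alpha> * norm v" .
  qed (use assms in auto)
  obtain Mb where Mb: "\<And>n T. T \<ge> 0 \<Longrightarrow> V_var 1 (an n) 0 T \<le> ereal (Mb T) \<and> V_var p (zn n) 0 T \<le> ereal (Mb T)"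
    using assms(11) by metis
  \<comment> \<open>Stated for an arbitrary subsequence of indices, so that it serves both for
    compactness and, along the subsequence that defines a limit point, for the identification of
    that limit point.\<close>
  have sub: "\<exists>r x k. strict_mono (r :: nat \<Rightarrow> nat) \<and>
      J1_conv (\<lambda>j t. (xn (q (r j)) t, kn (q (r j)) t)) (\<lambda>t. (x t, k t)) \<and> is_solution p f g x0 a z l x k"
    if q: "strict_mono q" for q :: "nat \<Rightarrow> nat"
  proof -
    have "(\<lambda>n. x0n (q n)) \<longlonglongrightarrow> x0" using LIMSEQ_subseq_LIMSEQ[OF assms(12) q] by (simp add: o_def)
    note x0q = this
    show ?thesis
    proof (rule subsequence_solution[where an = "\<lambda>n. an (q n)" and zn = "\<lambda>n. zn (q n)" and ln = "\<lambda>n. ln (q n)"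
          and xn = "\<lambda>n. xn (q n)" and kn = "\<lambda>n. kn (q n)" and Mb = Mb, OF _ _ _ x0q J1_conv_subseq[OF assms(13) q]])
      show "cadlag (an (q n))" "cadlag (zn (q n))" for n using assms(9) by auto
      show "V_var 1 (an (q n)) 0 T \<le> ereal (Mb T) \<and> V_var p (zn (q n)) 0 T \<le> ereal (Mb T)" if "0 \<le> T" for n T
        using Mb[OF that] .
      show "is_solution p f g (x0n (q n)) (an (q n)) (zn (q n)) (ln (q n)) (xn (q n)) (kn (q n))" for n
        using assms(14) by auto
      fix r x k
      assume "strict_mono (r :: nat \<Rightarrow> nat)" "J1_conv (\<lambda>j t. (xn (q (r j)) t, kn (q (r j)) t)) (\<lambda>t. (x t, k t))"
        "is_solution p f g x0 a z l x k"
      then show ?thesis by blast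
    qed
  qed
  have "relcompact_D (range (\<lambda>n t. (xn n t, kn n t)))"
    unfolding relcompact_D_def
  proof (intro allI impI)
    fix X :: "nat \<Rightarrow> real \<Rightarrow> (real^'d) \<times> (real^'d)"
    assume "\<forall>n. X n \<in> range (\<lambda>n t. (xn n t, kn n t))"
    then have "\<forall>n. \<exists>m. X n = (\<lambda>t. (xn m t, kn m t))" by blast
    then obtain m where m: "\<And>n. X n = (\<lambda>t. (xn (m n) t, kn (m n) t))" by metis
    show "\<exists>(r::nat \<Rightarrow> nat) y. strict_mono r \<and> J1_conv (X \<circ> r) y"
    proof (cases rule: index_subsequence[of m])
      case (const v q)
      have "cadlag (\<lambda>t. (xn v t, kn v t))" using assms(14) by (auto simp: is_solution_def intro: cadlag_Pair)
      then have "J1_conv (\<lambda>n t. (xn v t, kn v t)) (\<lambda>t. (xn v t, kn v t))" by (rule J1_conv_const)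
      moreover have "X \<circ> q = (\<lambda>n t. (xn v t, kn v t))" using const(2) by (auto simp: m)
      ultimately have "J1_conv (X \<circ> q) (\<lambda>t. (xn v t, kn v t))" by (simp only:)
      with const(1) show ?thesis by (intro exI conjI)
    next
      case (strict q)
      obtain r x k where r: "strict_mono (r :: nat \<Rightarrow> nat)"
        "J1_conv (\<lambda>j t. (xn ((m \<circ> q) (r j)) t, kn ((m \<circ> q) (r j)) t)) (\<lambda>t. (x t, k t))"
        using sub[OF strict(2)] by blast
      have "X \<circ> (q \<circ> r) = (\<lambda>j t. (xn ((m \<circ> q) (r j)) t, kn ((m \<circ> q) (r j)) t))" by (auto simp: m)
      then have "J1_conv (X \<circ> (q \<circ> r)) (\<lambda>t. (x t, k t))" using r(2) by (simp only:)
      with strict_mono_o[OF strict(1) r(1)] show ?thesis by (intro exI conjI)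
    qed
  qed
  moreover have "is_solution p f g x0 a z l (\<lambda>t. fst (y t)) (\<lambda>t. snd (y t))"
    if q: "strict_mono q" and y: "J1_conv (\<lambda>j t. (xn (q j) t, kn (q j) t)) y" for q :: "nat \<Rightarrow> nat" and y
  proof -
    obtain r x k where r: "strict_mono (r :: nat \<Rightarrow> nat)"
      "J1_conv (\<lambda>j t. (xn (q (r j)) t, kn (q (r j)) t)) (\<lambda>t. (x t, k t))" "is_solution p f g x0 a z l x k"
      using sub[OF q] by blast
    \<comment> \<open>A further subsequence still converges to y, and J1 limits are unique on
      [0,\<infinity>).\<close>
    have "y t = (x t, k t)" if "t \<ge> 0" for t
      using J1_conv_unique[OF J1_conv_subseq[OF y r(1)] r(2) that] .
    then show ?thesis by (intro is_solution_cong[OF r(3)]) auto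
  qed
  ultimately show ?thesis by blast
qed

end
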